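(* Let $B=(B_t)_{t\ge 0}$ be a standard one-dimensional Brownian motion started at $0$, let $T_1=\inf\{t\ge 0: B_t=1\}$, and let $U$ be a random variable uniform on $[0,1]$ and independent of $B$. Then the density $h$ of the random variable $$\alpha=\frac{B_{UT_1}}{\sqrt{T_1}}$$ satisfies, for $y\ge 0$, $$h(y)=\sqrt{\frac{2}{\pi}}\int_0^2\frac{1}{1+w}\exp\Big(-\frac{2y^2}{w^2}\Big)dw,$$ and, for $y\le 0$, $$h(y)=\sqrt{\frac{2}{\pi}}\,\log(3)\exp(-2y^2).$$
   Context: Density means density with respect to Lebesgue measure on $\mathbb{R}$. In the paper $h(y)=\mathbb{E}[l_1^y]$, where $(l_1^y)_{y\in\mathbb{R}}$ is the local time (occupation density) at time $1$ of the process $(B_{sT_1}/\sqrt{T_1})_{s\le 1}$. *)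

theory Defs
  imports "HOL-Probability.Probability"
begin

text \<open>Time is \<open>[0, \<infinity>)\<close>; the values of \<open>B\<close> at negative times are unconstrained. The path
  properties (start at \<open>0\<close>, continuity) are required almost surely only.\<close>

definition brownian_motion :: "'a measure \<Rightarrow> (real \<Rightarrow> 'a \<Rightarrow> real) \<Rightarrow> bool" where
  "brownian_motion M B \<longleftrightarrow>
     prob_space M \<and>
     (\<forall>t\<ge>0. B t \<in> borel_measurable M) \<and>
     (AE \<omega> in M. B 0 \<omega> = 0) \<and>
     (AE \<omega> in M. continuous_on {0..} (\<lambda>t. B t \<omega>)) \<and>
     (\<forall>s t. 0 \<le> s \<longrightarrow> s < t \<longrightarrow>
        distributed M lborel (\<lambda>\<omega>. B t \<omega> - B s \<omega>)
          (\<lambda>x. ennreal (normal_density 0 (sqrt (t - s)) x))) \<and>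
     (\<forall>(n::nat) \<tau>. 0 \<le> \<tau> 0 \<longrightarrow> (\<forall>i<n. \<tau> i \<le> \<tau> (Suc i)) \<longrightarrow>
        prob_space.indep_vars M (\<lambda>_. borel) (\<lambda>i \<omega>. B (\<tau> (Suc i)) \<omega> - B (\<tau> i) \<omega>) {..<n})"

text \<open>The infimum is taken in the reals, so \<open>hitting_time B a \<omega>\<close> is meaningless on the event that
  \<open>a\<close> is never hit; for Brownian motion this event is null.\<close>

definition hitting_time :: "(real \<Rightarrow> 'a \<Rightarrow> real) \<Rightarrow> real \<Rightarrow> 'a \<Rightarrow> real" where
  "hitting_time B a \<omega> = Inf {t. 0 \<le> t \<and> B t \<omega> = a}"

text \<open>Independence of \<open>\<sigma>(U)\<close> and \<open>\<sigma>(B\<^sub>t, t \<ge> 0)\<close>; the latter is the \<open>\<sigma>\<close>-algebra of the process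
  seen as a random element of the product space over \<open>[0, \<infinity>)\<close>. (The library's \<open>indep_var\<close> requires
  both variables to take values in the same type.)\<close>

definition indep_of_process :: "'a measure \<Rightarrow> ('a \<Rightarrow> real) \<Rightarrow> (real \<Rightarrow> 'a \<Rightarrow> real) \<Rightarrow> bool" where
  "indep_of_process M U B \<longleftrightarrow>
     prob_space.indep_set M
       (sets (vimage_algebra (space M) U borel))
       (sets (vimage_algebra (space M) (\<lambda>\<omega>. \<lambda>t\<in>{0..}. B t \<omega>) (PiM {0..} (\<lambda>_. borel))))"

text \<open>The variable \<open>B\<^bsub>U T\<^sub>1\<^esub> / sqrt T\<^sub>1\<close>. It is well defined only up to a null set (where a path is
  discontinuous, \<open>1\<close> is not hit, or \<open>U\<close> leaves \<open>[0, 1]\<close>), hence is a random variable on the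
  completion of the underlying probability space.\<close>

definition alpha :: "(real \<Rightarrow> 'a \<Rightarrow> real) \<Rightarrow> ('a \<Rightarrow> real) \<Rightarrow> 'a \<Rightarrow> real" where
  "alpha B U \<omega> = B (U \<omega> * hitting_time B 1 \<omega>) \<omega> / sqrt (hitting_time B 1 \<omega>)"

end

theory Submission
  imports Defs "HOL-Real_Asymp.Real_Asymp"
begin

text \<open>Write \<open>T\<close> for the hitting time of \<open>1\<close>. Averaging over the uniform variable turns the law of
  \<open>B\<^bsub>U T\<^esub> / sqrt T\<close> into an occupation measure: for \<open>\<phi> \<ge> 0\<close>,
  \<open>E \<phi> (B\<^bsub>U T\<^esub> / sqrt T) = E (\<integral>\<^sub>0\<^sup>T \<phi> (B\<^sub>s / sqrt T) ds / T) = \<integral>\<^sub>0\<^sup>\<infinity> E (\<phi> (B\<^sub>s / sqrt T) / T; s < T) ds\<close>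
  (lemma \<open>occupation_formula\<close>). So it is enough to know, for every fixed \<open>s\<close>, the law of
  \<open>(B\<^sub>s, T)\<close> on the event \<open>s < T\<close>.

  Let \<open>p\<^sub>t\<close> be the Gaussian density of variance \<open>t\<close> and \<open>q\<^sub>a (v)\<close> the density of the first passage
  time to the level \<open>a > 0\<close>. The position at time \<open>s\<close>, killed at the level \<open>1\<close>, has the density
  \<open>p\<^sub>s (x) - p\<^sub>s (2 - x)\<close> on \<open>x < 1\<close> by the reflection principle, and the increments after \<open>s\<close> form an
  independent Brownian motion that has to climb the remaining \<open>1 - x\<close>. Hence \<open>(B\<^sub>s, T)\<close> has the density
  \<open>(p\<^sub>s (x) - p\<^sub>s (2 - x)) q\<^bsub>1-x\<^esub> (r - s)\<close> on \<open>x < 1\<close>, \<open>s < r\<close> (lemma \<open>joint_law\<close>).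

  The reflection principle comes from sums of independent symmetric steps: flipping the signs of all
  steps after the first passage preserves the law of the steps, and on finer and finer time grids the
  overshoot over the level vanishes because the paths are continuous. The Markov property is used
  only at the fixed time \<open>s\<close>, where it is the independence of increments on a grid, passed to the limit.

  What is left is calculus. For fixed \<open>r\<close> and \<open>x\<close> the integral over \<open>s\<close> is a convolution, and
  \<open>\<integral>\<^sub>0\<^sup>r p\<^sub>s (b) q\<^sub>a (r - s) ds = p\<^sub>r (a + b)\<close> gives \<open>p\<^sub>r (\<bar>x\<bar> + 1 - x) - p\<^sub>r (3 - 2 x)\<close>. With \<open>x = y sqrt r\<close>, the
  density at \<open>y\<close> is an integral over \<open>r\<close> of a difference of two values of the standard normal density
  \<open>p\<close>. Writing such a difference as the integral of \<open>z p (z)\<close> between the two points and integrating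
  over \<open>r\<close> first leaves
  \<open>\<integral> z p (z) 2 ln (3 (z - \<bar>y\<bar> + y) / (z + 2 y)) dz\<close> over \<open>z > max y (- 2 y)\<close>. For \<open>y \<le> 0\<close> the logarithm is
  the constant \<open>ln 3\<close>; for \<open>y > 0\<close> the claimed integral over \<open>w\<close> reduces to the same expression in the
  same way.

  The integrals are evaluated with explicit antiderivatives, which keeps the work within nonnegative
  integrals, where the order of integration may be exchanged freely.\<close>

section \<open>Gaussian and first-passage densities\<close>

text \<open>The fundamental theorem of calculus on an open interval, for nonnegative integrands that may be
  singular at the endpoints: only limits of the antiderivative are needed there.\<close>

lemma nn_integral_FTC_einterval:
  fixes f F :: "real \<Rightarrow> real" and a b :: ereal
  assumes "a < b"
    and F: "\<And>x. a < ereal x \<Longrightarrow> ereal x < b \<Longrightarrow> (F has_real_derivative f x) (at x)"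
    and cont: "\<And>x. a < ereal x \<Longrightarrow> ereal x < b \<Longrightarrow> isCont f x"
    and nonneg: "\<And>x. a < ereal x \<Longrightarrow> ereal x < b \<Longrightarrow> 0 \<le> f x"
    and A: "((F \<circ> real_of_ereal) \<longlongrightarrow> A) (at_right a)"
    and B: "((F \<circ> real_of_ereal) \<longlongrightarrow> B) (at_left b)"
  shows "(\<integral>\<^sup>+x. ennreal (f x) * indicator (einterval a b) x \<partial>lborel) = ennreal (B - A)"
proof -
  have int: "set_integrable lborel (einterval a b) f"
    and val: "(LBINT x=a..b. f x) = B - A"
    using interval_integral_FTC_nonneg[of a b F f A B] assms by auto
  have "(\<integral>\<^sup>+x. ennreal (f x) * indicator (einterval a b) x \<partial>lborel)
      = (\<integral>\<^sup>+x. ennreal (indicator (einterval a b) x *\<^sub>R f x) \<partial>lborel)"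
    by (intro nn_integral_cong) (auto split: split_indicator)
  also have "\<dots> = ennreal (\<integral>x. indicator (einterval a b) x *\<^sub>R f x \<partial>lborel)"
    using int nonneg unfolding set_integrable_def
    by (intro nn_integral_eq_integral) (auto split: split_indicator simp: einterval_def)
  also have "(\<integral>x. indicator (einterval a b) x *\<^sub>R f x \<partial>lborel) = B - A"
    using val less_imp_le[OF \<open>a < b\<close>] by (simp add: interval_lebesgue_integral_def set_lebesgue_integral_def)
  finally show ?thesis .
qed

lemma nn_integral_FTC_Ioo:
  fixes f F :: "real \<Rightarrow> real"
  assumes "a < b"
    and F: "\<And>x. a < x \<Longrightarrow> x < b \<Longrightarrow> (F has_real_derivative f x) (at x)"
    and cont: "\<And>x. a < x \<Longrightarrow> x < b \<Longrightarrow> isCont f x"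
    and nonneg: "\<And>x. a < x \<Longrightarrow> x < b \<Longrightarrow> 0 \<le> f x"
    and A: "(F \<longlongrightarrow> A) (at_right a)"
    and B: "(F \<longlongrightarrow> B) (at_left b)"
  shows "(\<integral>\<^sup>+x. ennreal (f x) * indicator {a<..<b} x \<partial>lborel) = ennreal (B - A)"
  using nn_integral_FTC_einterval[of "ereal a" "ereal b" F f A B] assms
  by (auto simp: ereal_tendsto_simps)

lemma nn_integral_FTC_Ioi:
  fixes f F :: "real \<Rightarrow> real"
  assumes F: "\<And>x. a < x \<Longrightarrow> (F has_real_derivative f x) (at x)"
    and cont: "\<And>x. a < x \<Longrightarrow> isCont f x"
    and nonneg: "\<And>x. a < x \<Longrightarrow> 0 \<le> f x"
    and A: "(F \<longlongrightarrow> A) (at_right a)"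
    and B: "(F \<longlongrightarrow> B) at_top"
  shows "(\<integral>\<^sup>+x. ennreal (f x) * indicator {a<..} x \<partial>lborel) = ennreal (B - A)"
  using nn_integral_FTC_einterval[of "ereal a" "\<infinity>" F f A B] assms
  by (auto simp: ereal_tendsto_simps)

abbreviation gauss :: "real \<Rightarrow> real \<Rightarrow> real" where
  "gauss t \<equiv> normal_density 0 (sqrt t)"

abbreviation std_gauss :: "real \<Rightarrow> real" where
  "std_gauss \<equiv> std_normal_density"

text \<open>The density at time \<open>v\<close> of the first passage of Brownian motion to the level \<open>a > 0\<close>.\<close>

definition hit_density :: "real \<Rightarrow> real \<Rightarrow> real" where
  "hit_density a v = a / (v * sqrt (2 * pi * v)) * exp (- (a\<^sup>2 / (2 * v)))"

text \<open>The standard normal distribution function, in terms of which the antiderivatives below are written.\<close>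

definition Phi :: "real \<Rightarrow> real" where
  "Phi = cdf std_normal_distribution"

lemma gauss_eq: "0 < t \<Longrightarrow> gauss t x = exp (- (x\<^sup>2 / (2 * t))) / sqrt (2 * pi * t)"
  by (simp add: normal_density_def)

lemma std_gauss_eq: "std_gauss x = exp (- (x\<^sup>2 / 2)) / sqrt (2 * pi)"
  by (simp add: normal_density_def)

lemma Phi_at_top: "(Phi \<longlongrightarrow> 1) at_top" and Phi_at_bot: "(Phi \<longlongrightarrow> 0) at_bot"
proof -
  interpret real_distribution std_normal_distribution by (rule real_dist_normal_dist)
  show "(Phi \<longlongrightarrow> 1) at_top" "(Phi \<longlongrightarrow> 0) at_bot"
    unfolding Phi_def by (rule cdf_lim_at_top_prob cdf_lim_at_bot)+
qed

lemma measure_std_normal_Ioc: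
  assumes "a \<le> b"
  shows "measure std_normal_distribution {a<..b} = (LBINT y=a..b. std_gauss y)"
proof -
  have "measure std_normal_distribution {a<..b} = (\<integral>y. indicator {a<..b} y *\<^sub>R std_gauss y \<partial>lborel)"
  proof -
    have "emeasure std_normal_distribution {a<..b} = (\<integral>\<^sup>+y. ennreal (std_gauss y) * indicator {a<..b} y \<partial>lborel)"
      by (simp add: emeasure_density)
    also have "\<dots> = (\<integral>\<^sup>+y. ennreal (indicator {a<..b} y *\<^sub>R std_gauss y) \<partial>lborel)"
      by (intro nn_integral_cong) (auto split: split_indicator)
    also have "\<dots> = ennreal (\<integral>y. indicator {a<..b} y *\<^sub>R std_gauss y \<partial>lborel)"
      by (intro nn_integral_eq_integral integrable_mult_indicator)
         (auto split: split_indicator)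
    finally show ?thesis by (simp add: measure_def Bochner_Integration.integral_nonneg)
  qed
  also have "\<dots> = (LBINT y:{a<..b}. std_gauss y)"
    by (simp add: set_lebesgue_integral_def)
  finally show ?thesis using assms by (simp add: interval_integral_Ioc)
qed

lemma Phi_deriv: "(Phi has_real_derivative std_gauss x) (at x)"
proof -
  interpret real_distribution std_normal_distribution by (rule real_dist_normal_dist)
  have cont: "continuous_on A std_gauss" for A
    unfolding normal_density_def by (intro continuous_intros) auto
  have "((\<lambda>u. LBINT y=x-1..u. std_gauss y) has_vector_derivative std_gauss x) (at x within {x-1..x+1})"
    by (rule interval_integral_FTC2) (auto intro: cont)
  then have "((\<lambda>u. LBINT y=x-1..u. std_gauss y) has_vector_derivative std_gauss x) (at x)"
    by (subst (asm) at_within_Icc_at) auto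
  then have D: "((\<lambda>u. Phi (x-1) + (LBINT y=x-1..u. std_gauss y)) has_real_derivative std_gauss x) (at x)"
    by (auto simp: has_real_derivative_iff_has_vector_derivative intro!: derivative_eq_intros)
  have E: "Phi u = Phi (x-1) + (LBINT y=x-1..u. std_gauss y)" if "x - 1 < u" for u
    using that cdf_diff_eq[of "x - 1" u] measure_std_normal_Ioc[of "x - 1" u] by (simp add: Phi_def)
  show ?thesis
    by (rule has_field_derivative_transform_within_open[OF D, where S="{x-1<..}"]) (auto simp: E)
qed

lemma Phi_deriv_chain[derivative_intros]:
  "(g has_real_derivative g') (at x) \<Longrightarrow>
   ((\<lambda>x. Phi (g x)) has_real_derivative std_gauss (g x) * g') (at x)"
  using DERIV_chain2[OF Phi_deriv] by auto

lemma isCont_Phi: "isCont Phi x"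
  using Phi_deriv DERIV_isCont by blast

text \<open>The antiderivative of \<open>hit_density a\<close> is \<open>v \<mapsto> - 2 Phi (a / sqrt v)\<close>; the limit \<open>l\<close> covers both a
  starting point \<open>t > 0\<close> and the singular one \<open>t = 0\<close>.\<close>

lemma nn_integral_hit_density:
  assumes "0 < a" "0 \<le> t" and lim: "((\<lambda>v. Phi (a / sqrt v)) \<longlongrightarrow> l) (at_right t)"
  shows "(\<integral>\<^sup>+v. ennreal (hit_density a v) * indicator {t<..} v \<partial>lborel) = ennreal (2 * l - 2 * Phi 0)"
proof -
  have "(\<integral>\<^sup>+v. ennreal (hit_density a v) * indicator {t<..} v \<partial>lborel) = ennreal (- 2 * Phi 0 - (- 2 * l))"
  proof (rule nn_integral_FTC_Ioi[where F="\<lambda>v. - 2 * Phi (a / sqrt v)"])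
    show "((\<lambda>v. - 2 * Phi (a / sqrt v)) has_real_derivative hit_density a v) (at v)" if "t < v" for v
      using that assms
      by (auto intro!: derivative_eq_intros simp: hit_density_def std_gauss_eq power_divide real_sqrt_mult field_simps)
    show "isCont (hit_density a) v" if "t < v" for v
      using that assms unfolding hit_density_def by (intro continuous_intros) auto
    show "0 \<le> hit_density a v" if "t < v" for v
      using that assms unfolding hit_density_def by auto
    show "((\<lambda>v. - 2 * Phi (a / sqrt v)) \<longlongrightarrow> - 2 * l) (at_right t)"
      by (intro tendsto_intros lim)
    have "((\<lambda>v. a / sqrt v) \<longlongrightarrow> 0) at_top"
      by (intro real_tendsto_divide_at_top[OF tendsto_const] sqrt_at_top)
    then show "((\<lambda>v. - 2 * Phi (a / sqrt v)) \<longlongrightarrow> - 2 * Phi 0) at_top"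
      by (intro tendsto_intros isCont_tendsto_compose[OF isCont_Phi]) auto
  qed
  then show ?thesis by simp
qed

lemma hit_density_tail:
  assumes "0 < a" "0 < t"
  shows "(\<integral>\<^sup>+v. ennreal (hit_density a v) * indicator {t<..} v \<partial>lborel) = ennreal (2 * Phi (a / sqrt t) - 2 * Phi 0)"
  using assms by (intro nn_integral_hit_density tendsto_intros isCont_tendsto_compose[OF isCont_Phi]) auto

lemma hit_density_tail_0:
  assumes "0 < a"
  shows "(\<integral>\<^sup>+v. ennreal (hit_density a v) * indicator {0<..} v \<partial>lborel) = ennreal (2 - 2 * Phi 0)"
proof -
  have "filterlim (\<lambda>v. a / sqrt v) at_top (at_right 0)"
    using assms by real_asymp
  then have "((\<lambda>v. Phi (a / sqrt v)) \<longlongrightarrow> 1) (at_right 0)"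
    by (rule filterlim_compose[OF Phi_at_top])
  from nn_integral_hit_density[OF assms order.refl this] show ?thesis by simp
qed

lemma gauss_scale: "0 < t \<Longrightarrow> gauss t x = std_gauss (x / sqrt t) / sqrt t"
  by (simp add: gauss_eq std_gauss_eq power_divide real_sqrt_mult)

lemma std_normal_deriv: "((\<lambda>z. - std_gauss z) has_real_derivative x * std_gauss x) (at x)"
  unfolding std_gauss_eq by (auto intro!: derivative_eq_intros simp: field_simps)

lemma isCont_std_normal: "isCont std_gauss x"
  using DERIV_isCont[OF std_normal_deriv, of x] continuous_minus[of "at x" "\<lambda>z. - std_gauss z"] by simp

lemma std_normal_at_top: "(std_gauss \<longlongrightarrow> 0) at_top"
  unfolding std_gauss_eq[abs_def] by real_asymp

lemma nn_integral_std_normal: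
  assumes "0 \<le> z1" "z1 < z2"
  shows "(\<integral>\<^sup>+z. ennreal (z * std_gauss z) * indicator {z1<..<z2} z \<partial>lborel)
    = ennreal (std_gauss z1 - std_gauss z2)"
proof -
  have "(\<integral>\<^sup>+z. ennreal (z * std_gauss z) * indicator {z1<..<z2} z \<partial>lborel)
    = ennreal (- std_gauss z2 - (- std_gauss z1))"
  proof (rule nn_integral_FTC_Ioo[OF assms(2) std_normal_deriv])
    show "isCont (\<lambda>z. z * std_gauss z) x" for x
      by (intro continuous_intros isCont_std_normal)
    show "((\<lambda>z. - std_gauss z) \<longlongrightarrow> - std_gauss z1) (at_right z1)"
      "((\<lambda>z. - std_gauss z) \<longlongrightarrow> - std_gauss z2) (at_left z2)"
      using DERIV_isCont[OF std_normal_deriv] by (auto simp: isCont_def intro: filterlim_at_split[THEN iffD1, THEN conjunct1] filterlim_at_split[THEN iffD1, THEN conjunct2])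
  qed (use assms in auto)
  then show ?thesis by simp
qed

lemma nn_integral_std_normal_top:
  assumes "0 \<le> z1"
  shows "(\<integral>\<^sup>+z. ennreal (z * std_gauss z) * indicator {z1<..} z \<partial>lborel)
    = ennreal (std_gauss z1)"
proof -
  have "(\<integral>\<^sup>+z. ennreal (z * std_gauss z) * indicator {z1<..} z \<partial>lborel)
    = ennreal (- 0 - (- std_gauss z1))"
  proof (rule nn_integral_FTC_Ioi[OF std_normal_deriv])
    show "isCont (\<lambda>z. z * std_gauss z) x" for x
      by (intro continuous_intros isCont_std_normal)
    show "((\<lambda>z. - std_gauss z) \<longlongrightarrow> - std_gauss z1) (at_right z1)"
      using DERIV_isCont[OF std_normal_deriv] by (auto simp: isCont_def intro: filterlim_at_split[THEN iffD1, THEN conjunct2])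
    show "((\<lambda>z. - std_gauss z) \<longlongrightarrow> - 0) at_top"
      by (intro tendsto_intros std_normal_at_top)
  qed (use assms in auto)
  then show ?thesis by simp
qed

text \<open>The two lemmas on the quotient \<open>(a s + b (T - s)) / sqrt (T s (T - s))\<close> prepare the antiderivative for
  the convolution. It occurs there with \<open>b\<close> and with \<open>- b\<close>; in the sum of the two derivatives the terms
  with \<open>b\<close> cancel, and the exponential factors of both terms agree by the next lemma.\<close>

lemma bridge_exponent_deriv:
  fixes a b T s :: real
  assumes "0 < s" "s < T"
  shows "((\<lambda>s. (a * s + b * (T - s)) / sqrt (T * s * (T - s))) has_real_derivative
    T\<^sup>2 * (a * s - b * (T - s)) / (2 * (sqrt (T * s * (T - s)))^3)) (at s)"
proof -
  define D where "D = sqrt (T * s * (T - s))"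
  have pos: "0 < T * s * (T - s)" using assms by simp
  have D: "0 < D" "D\<^sup>2 = T * s * (T - s)" unfolding D_def using pos by auto
  have "((\<lambda>s. (a * s + b * (T - s)) / sqrt (T * s * (T - s))) has_real_derivative
    ((a - b) * D - (a * s + b * (T - s)) * (T * (T - s) - T * s) / (2 * D)) / D\<^sup>2) (at s)"
    unfolding D_def using pos assms
    by (auto intro!: derivative_eq_intros simp: power2_eq_square field_simps)
  also have "((a - b) * D - (a * s + b * (T - s)) * (T * (T - s) - T * s) / (2 * D)) / D\<^sup>2
    = (2 * (a - b) * D\<^sup>2 - (a * s + b * (T - s)) * (T * (T - s) - T * s)) / (2 * D^3)"
    using D(1) by (simp add: field_simps power2_eq_square power3_eq_cube)
  also have "\<dots> = T\<^sup>2 * (a * s - b * (T - s)) / (2 * D^3)"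
    unfolding D(2) by (simp add: algebra_simps power2_eq_square)
  finally show ?thesis unfolding D_def .
qed

lemma sqrt_two_pi_mult: "sqrt (2 * pi * x) * sqrt (2 * pi * y) = 2 * pi * sqrt (x * y)"
proof -
  have "sqrt (2 * pi * x) * sqrt (2 * pi * y) = sqrt ((2 * pi)\<^sup>2 * (x * y))"
    by (simp only: real_sqrt_mult[symmetric] power2_eq_square mult_ac)
  then show ?thesis by (simp add: real_sqrt_mult)
qed

lemma bridge_exponent:
  fixes a b T s :: real
  assumes "0 < s" "s < T"
  shows "gauss T (a - b) * std_gauss ((a * s + b * (T - s)) / sqrt (T * s * (T - s)))
    = exp (- (a\<^sup>2 / (2 * (T - s)) + b\<^sup>2 / (2 * s))) / (2 * pi * sqrt T)"
proof -
  have pos: "0 < T * s * (T - s)" "0 < T" "0 < T - s" using assms by auto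
  have "(a - b)\<^sup>2 / (2 * T) + (a * s + b * (T - s))\<^sup>2 / (T * s * (T - s)) / 2
      = a\<^sup>2 / (2 * (T - s)) + b\<^sup>2 / (2 * s)"
  proof -
    have "(a - b)\<^sup>2 / (2 * T) + (a * s + b * (T - s))\<^sup>2 / (T * s * (T - s)) / 2 =
      ((a - b)\<^sup>2 * s * (T - s) + (a * s + b * (T - s))\<^sup>2) / (2 * T * s * (T - s))"
      using pos assms by (simp add: add_divide_distrib)
    also have "(a - b)\<^sup>2 * s * (T - s) + (a * s + b * (T - s))\<^sup>2 = T * (a\<^sup>2 * s + b\<^sup>2 * (T - s))"
      by (simp add: power2_eq_square algebra_simps)
    also have "\<dots> / (2 * T * s * (T - s)) = (a\<^sup>2 * s + b\<^sup>2 * (T - s)) / (2 * s * (T - s))"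
      using pos assms by simp
    also have "\<dots> = a\<^sup>2 / (2 * (T - s)) + b\<^sup>2 / (2 * s)"
      using pos assms by (simp add: add_divide_distrib)
    finally show ?thesis .
  qed
  note exponent = this
  have "gauss T (a - b) * std_gauss ((a * s + b * (T - s)) / sqrt (T * s * (T - s)))
    = exp (- ((a - b)\<^sup>2 / (2 * T) + (a * s + b * (T - s))\<^sup>2 / (T * s * (T - s)) / 2)) / (sqrt (2 * pi * T) * sqrt (2 * pi))"
    unfolding gauss_eq[OF pos(2)] std_gauss_eq power_divide real_sqrt_pow2[OF less_imp_le[OF pos(1)]]
    by (simp add: exp_add[symmetric] add.commute)
  also have "sqrt (2 * pi * T) * sqrt (2 * pi) = 2 * pi * sqrt T"
    using sqrt_two_pi_mult[of T 1] by simp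
  finally show ?thesis unfolding exponent .
qed

text \<open>In probabilistic terms, a path that is at \<open>a + b\<close> at time \<open>T\<close> has passed the level \<open>a\<close> before, for the
  first time at some \<open>T - s\<close>, and has then moved by \<open>b\<close> in the remaining time \<open>s\<close>. The proof differentiates an explicit combination of values of \<open>Phi\<close>.\<close>

lemma gauss_hit_convolution:
  assumes "0 < a" "0 < b" "0 < T"
  shows "(\<integral>\<^sup>+s. ennreal (gauss s b * hit_density a (T - s)) * indicator {0<..<T} s \<partial>lborel) = ennreal (gauss T (a + b))"
proof -
  let ?e = "\<lambda>s. exp (- (a\<^sup>2 / (2 * (T - s)) + b\<^sup>2 / (2 * s)))"
  define F where "F = (\<lambda>s. gauss T (a + b) * Phi ((a * s + (- b) * (T - s)) / sqrt (T * s * (T - s)))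
      + gauss T (a - b) * Phi ((a * s + b * (T - s)) / sqrt (T * s * (T - s))))"
  have "(\<integral>\<^sup>+s. ennreal (gauss s b * hit_density a (T - s)) * indicator {0<..<T} s \<partial>lborel)
     = ennreal ((gauss T (a + b) * 1 + gauss T (a - b) * 1) - (gauss T (a + b) * 0 + gauss T (a - b) * 1))"
  proof (rule nn_integral_FTC_Ioo[where F=F])
    fix s assume s: "0 < s" "s < T"
    let ?D = "sqrt (T * s * (T - s))"
    have D: "?D^3 = T * s * (T - s) * sqrt (T * s * (T - s))" "?D > 0"
      using s assms by (auto simp: power3_eq_cube)
    have e1: "gauss T (a + b) * std_gauss ((a * s + (- b) * (T - s)) / ?D) = ?e s / (2 * pi * sqrt T)"
      using bridge_exponent[OF s, of a "- b"] by simp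
    have "(F has_real_derivative
        gauss T (a + b) * (std_gauss ((a * s + (- b) * (T - s)) / ?D) * (T\<^sup>2 * (a * s - (- b) * (T - s)) / (2 * ?D^3))) +
        gauss T (a - b) * (std_gauss ((a * s + b * (T - s)) / ?D) * (T\<^sup>2 * (a * s - b * (T - s)) / (2 * ?D^3)))) (at s)"
      unfolding F_def by (intro DERIV_add DERIV_cmult Phi_deriv_chain bridge_exponent_deriv s)
    also have "gauss T (a + b) * (std_gauss ((a * s + (- b) * (T - s)) / ?D) * (T\<^sup>2 * (a * s - (- b) * (T - s)) / (2 * ?D^3))) +
        gauss T (a - b) * (std_gauss ((a * s + b * (T - s)) / ?D) * (T\<^sup>2 * (a * s - b * (T - s)) / (2 * ?D^3)))
      = ?e s / (2 * pi * sqrt T) *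
        (T\<^sup>2 * (a * s - (- b) * (T - s)) / (2 * ?D^3) + T\<^sup>2 * (a * s - b * (T - s)) / (2 * ?D^3))"
      unfolding mult.assoc[symmetric] e1 bridge_exponent[OF s] by (simp add: algebra_simps)
    also have "T\<^sup>2 * (a * s - (- b) * (T - s)) / (2 * ?D^3) + T\<^sup>2 * (a * s - b * (T - s)) / (2 * ?D^3) = T\<^sup>2 * a * s / ?D^3"
      by (simp add: add_divide_distrib[symmetric]) (simp add: algebra_simps)?
    also have "\<dots> = a * T / ((T - s) * (sqrt T * sqrt s * sqrt (T - s)))"
      unfolding D(1) using s by (simp add: power2_eq_square real_sqrt_mult mult_ac)
    also have "?e s / (2 * pi * sqrt T) * (a * T / ((T - s) * (sqrt T * sqrt s * sqrt (T - s))))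
      = ?e s * a * T / (2 * pi * (T - s) * (sqrt T * sqrt T) * sqrt s * sqrt (T - s))"
      by (simp only: times_divide_times_eq mult_ac)
    also have "\<dots> = ?e s * a / (2 * pi * (T - s) * sqrt s * sqrt (T - s))"
      using assms by simp
    also have "\<dots> = gauss s b * hit_density a (T - s)"
    proof -
      have "?e s = exp (- (b\<^sup>2 / (2 * s))) * exp (- (a\<^sup>2 / (2 * (T - s))))"
        by (simp add: exp_add[symmetric])
      moreover have "sqrt (2 * pi * s) * ((T - s) * sqrt (2 * pi * (T - s))) = 2 * pi * (T - s) * sqrt s * sqrt (T - s)"
        by (subst mult.left_commute, subst sqrt_two_pi_mult) (simp only: real_sqrt_mult mult_ac)
      moreover have "gauss s b * hit_density a (T - s) = exp (- (b\<^sup>2 / (2 * s))) / sqrt (2 * pi * s) *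
          (a / ((T - s) * sqrt (2 * pi * (T - s))) * exp (- (a\<^sup>2 / (2 * (T - s)))))"
        unfolding gauss_eq[OF s(1)] hit_density_def ..
      ultimately show ?thesis
        by (simp only: times_divide_times_eq times_divide_eq_left times_divide_eq_right divide_divide_eq_left mult_ac)
    qed
    finally show "(F has_real_derivative gauss s b * hit_density a (T - s)) (at s)" .
    have "isCont (\<lambda>s. gauss s b) s"
      unfolding normal_density_def using s by (intro continuous_intros) auto
    moreover have "isCont (\<lambda>s. hit_density a (T - s)) s"
      unfolding hit_density_def using s by (intro continuous_intros) auto
    ultimately show "isCont (\<lambda>s. gauss s b * hit_density a (T - s)) s"
      by (intro continuous_intros)
    show "0 \<le> gauss s b * hit_density a (T - s)"
      using s assms by (auto simp: hit_density_def)
  next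
    have "filterlim (\<lambda>s. (a * s + (- b) * (T - s)) / sqrt (T * s * (T - s))) at_bot (at_right 0)"
      "filterlim (\<lambda>s. (a * s + b * (T - s)) / sqrt (T * s * (T - s))) at_top (at_right 0)"
      using assms by real_asymp+
    then show "(F \<longlongrightarrow> gauss T (a + b) * 0 + gauss T (a - b) * 1) (at_right 0)"
      unfolding F_def
      by (intro tendsto_intros filterlim_compose[OF Phi_at_top] filterlim_compose[OF Phi_at_bot])
  next
    have "filterlim (\<lambda>s. (a * s + (- b) * (T - s)) / sqrt (T * s * (T - s))) at_top (at_left T)"
      "filterlim (\<lambda>s. (a * s + b * (T - s)) / sqrt (T * s * (T - s))) at_top (at_left T)"
      using assms by real_asymp+
    then show "(F \<longlongrightarrow> gauss T (a + b) * 1 + gauss T (a - b) * 1) (at_left T)"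
      unfolding F_def
      by (intro tendsto_intros filterlim_compose[OF Phi_at_top])
  qed (use assms in auto)
  then show ?thesis by simp
qed

text \<open>For \<open>x < 1\<close>, the density at \<open>x\<close> of Brownian motion at time \<open>s\<close> on the event that it has not yet
  exceeded the level \<open>1\<close>: the second term is the image of the first under reflection at \<open>1\<close>.\<close>

definition killed_gauss :: "real \<Rightarrow> real \<Rightarrow> real" where
  "killed_gauss s x = gauss s x - gauss s (2 - x)"

lemma killed_gauss_nonneg: "0 < s \<Longrightarrow> x \<le> 1 \<Longrightarrow> 0 \<le> killed_gauss s x"
  unfolding killed_gauss_def
  by (simp add: gauss_eq divide_right_mono) (auto intro!: divide_right_mono simp: power2_eq_square algebra_simps)

lemma hit_density_nonneg: "0 \<le> a \<Longrightarrow> 0 \<le> v \<Longrightarrow> 0 \<le> hit_density a v"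
  by (simp add: hit_density_def)

text \<open>The convolution formula for both terms of the killed density, with \<open>b = \<bar>x\<bar>\<close> and \<open>b = 2 - x\<close>. The
  excluded point \<open>x = 0\<close> would be the case \<open>b = 0\<close>, in which the limits of the antiderivative differ; it
  is null for the later integration over \<open>x\<close>.\<close>

lemma killed_hit_convolution:
  assumes "x < 1" "x \<noteq> 0" "0 < T"
  shows "(\<integral>\<^sup>+s. ennreal (killed_gauss s x * hit_density (1 - x) (T - s)) * indicator {0<..<T} s \<partial>lborel)
    = ennreal (gauss T (\<bar>x\<bar> + 1 - x) - gauss T (3 - 2 * x))"
proof -
  have *: "gauss s \<bar>x\<bar> = gauss s x" for s by (simp add: normal_density_def)
  let ?f = "\<lambda>s. ennreal (gauss s \<bar>x\<bar> * hit_density (1 - x) (T - s)) * indicator {0<..<T} s"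
  let ?g = "\<lambda>s. ennreal (gauss s (2 - x) * hit_density (1 - x) (T - s)) * indicator {0<..<T} s"
  have f: "(\<integral>\<^sup>+s. ?f s \<partial>lborel) = ennreal (gauss T (\<bar>x\<bar> + 1 - x))"
    using gauss_hit_convolution[of "1 - x" "\<bar>x\<bar>" T] assms by (simp add: algebra_simps)
  have g: "(\<integral>\<^sup>+s. ?g s \<partial>lborel) = ennreal (gauss T (3 - 2 * x))"
    using gauss_hit_convolution[of "1 - x" "2 - x" T] assms by (simp add: algebra_simps)
  have [measurable]: "?f \<in> borel_measurable lborel" "?g \<in> borel_measurable lborel"
    unfolding hit_density_def normal_density_def by measurable
  have split: "ennreal (killed_gauss s x * hit_density (1 - x) (T - s)) * indicator {0<..<T} s = ?f s - ?g s" for s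
    using assms hit_density_nonneg[of "1 - x" "T - s"]
    by (auto split: split_indicator simp: killed_gauss_def * left_diff_distrib ennreal_minus)
  have le: "?g s \<le> ?f s" for s
    using killed_gauss_nonneg[of s x] assms hit_density_nonneg[of "1 - x" "T - s"]
    by (auto split: split_indicator simp: killed_gauss_def * intro!: ennreal_leI mult_right_mono)
  have "(\<integral>\<^sup>+s. ?f s - ?g s \<partial>lborel) = (\<integral>\<^sup>+s. ?f s \<partial>lborel) - (\<integral>\<^sup>+s. ?g s \<partial>lborel)"
    using le by (intro nn_integral_diff) (auto simp: g)
  then show ?thesis unfolding split f g by (simp add: ennreal_minus)
qed

lemma nn_integral_inverse_Ioo:
  assumes "0 < l" "l < u"
  shows "(\<integral>\<^sup>+T. ennreal (1 / T) * indicator {l<..<u} T \<partial>lborel) = ennreal (ln (u / l))"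
proof -
  have "(\<integral>\<^sup>+T. ennreal (1 / T) * indicator {l<..<u} T \<partial>lborel) = ennreal (ln u - ln l)"
    by (rule nn_integral_FTC_Ioo[where F=ln])
       (use assms in \<open>auto intro!: derivative_eq_intros continuous_intros tendsto_intros simp: field_simps\<close>)
  then show ?thesis using assms by (simp add: ln_div)
qed

definition alpha_density :: "real \<Rightarrow> real" where
  "alpha_density y = (if 0 \<le> y
     then sqrt (2 / pi) * (LINT w:{0..2}|lborel. 1 / (1 + w) * exp (- (2 * y\<^sup>2 / w\<^sup>2)))
     else sqrt (2 / pi) * ln 3 * exp (- (2 * y\<^sup>2)))"

lemma two_std_normal: "2 * std_gauss x = sqrt (2 / pi) * exp (- (x\<^sup>2 / 2))"
  by (simp add: std_gauss_eq real_sqrt_mult real_sqrt_divide field_simps)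

text \<open>At \<open>y = 0\<close> the two branches agree because \<open>\<integral>\<^sub>0\<^sup>2 dw / (1 + w) = ln 3\<close>.\<close>

lemma alpha_density_nonpos:
  assumes "y \<le> 0"
  shows "alpha_density y = sqrt (2 / pi) * ln 3 * exp (- (2 * y\<^sup>2))"
proof (cases "y = 0")
  case True
  have "(\<integral>\<^sup>+w. ennreal (1 / (1 + w)) * indicator {0<..<2} w \<partial>lborel) = ennreal (ln (1 + 2) - ln (1 + 0))"
    by (rule nn_integral_FTC_Ioo[where F="\<lambda>w. ln (1 + w)"])
       (auto intro!: derivative_eq_intros continuous_intros tendsto_eq_intros simp: field_simps)
  then have "(\<integral>\<^sup>+w. ennreal (indicator {0<..<2} w *\<^sub>R (1 / (1 + w))) \<partial>lborel) = ennreal (ln 3)"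
    by (subst nn_integral_cong[where v="\<lambda>w. ennreal (1 / (1 + w)) * indicator {0<..<2::real} w"]) (auto split: split_indicator)
  then have "(LINT w:{0<..<2}|lborel. 1 / (1 + w)) = (ln 3 :: real)"
    unfolding set_lebesgue_integral_def
    by (subst integral_eq_nn_integral) (auto split: split_indicator)
  moreover have "(LINT w:{0..2}|lborel. 1 / (1 + w)) = (LINT w:{0<..<2}|lborel. 1 / (1 + w :: real))"
    unfolding set_lebesgue_integral_def
    by (intro integral_cong_AE)
       (auto intro!: AE_I[where N="{0, 2}"] emeasure_lborel_countable split: split_indicator)
  ultimately show ?thesis using True by (simp add: alpha_density_def)
next
  case False then show ?thesis using assms by (simp add: alpha_density_def)
qed

lemma alpha_density_measurable[measurable]: "alpha_density \<in> borel_measurable borel"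
  unfolding alpha_density_def set_lebesgue_integral_def by measurable

lemma Collect_pair_sets:
  fixes Q :: "real \<times> real \<Rightarrow> bool"
  assumes "Measurable.pred (borel \<Otimes>\<^sub>M borel) Q"
  shows "Collect Q \<in> sets (borel \<Otimes>\<^sub>M borel)" "Collect Q \<in> sets (lborel \<Otimes>\<^sub>M lborel)"
proof -
  show "Collect Q \<in> sets (borel \<Otimes>\<^sub>M borel)"
    using assms by (simp add: pred_def space_pair_measure)
  also have "sets (borel \<Otimes>\<^sub>M borel) = sets (lborel \<Otimes>\<^sub>M (lborel :: real measure))"
    by (intro sets_pair_measure_cong) auto
  finally show "Collect Q \<in> sets (lborel \<Otimes>\<^sub>M lborel)" .
qed

lemma alpha_density_nn_integral:
  assumes "0 < y"
  shows "ennreal (alpha_density y) =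
    (\<integral>\<^sup>+w. ennreal (2 / (1 + w) * std_gauss (2 * y / w)) * indicator {0<..<2} w \<partial>lborel)"
proof -
  let ?f = "\<lambda>w::real. 1 / (1 + w) * exp (- (2 * y\<^sup>2 / w\<^sup>2))"
  have "norm (?f w) \<le> 1" if "0 \<le> w" for w
  proof -
    have "exp (- (2 * y\<^sup>2 / w\<^sup>2)) \<le> 1 + w"
      by (rule order.trans[of _ 1]) (use that in auto)
    then show ?thesis using that by (simp add: divide_le_eq)
  qed
  then have "integrable lborel (\<lambda>w. indicator {0..2} w *\<^sub>R ?f w)"
    by (intro integrableI_bounded_set_indicator[where B=1])
       (auto intro!: AE_I2)
  then have "ennreal (LINT w:{0..2}|lborel. ?f w) = (\<integral>\<^sup>+w. ennreal (indicator {0..2} w *\<^sub>R ?f w) \<partial>lborel)"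
    unfolding set_lebesgue_integral_def
    by (intro nn_integral_eq_integral[symmetric]) (auto split: split_indicator)
  then have "ennreal (alpha_density y) = ennreal (sqrt (2 / pi)) * (\<integral>\<^sup>+w. ennreal (indicator {0..2} w *\<^sub>R ?f w) \<partial>lborel)"
    using assms by (simp add: alpha_density_def ennreal_mult')
  also have "\<dots> = (\<integral>\<^sup>+w. ennreal (sqrt (2 / pi)) * ennreal (indicator {0..2} w *\<^sub>R ?f w) \<partial>lborel)"
    by (subst nn_integral_cmult) auto
  also have "\<dots> = (\<integral>\<^sup>+w. ennreal (2 / (1 + w) * std_gauss (2 * y / w)) * indicator {0<..<2} w \<partial>lborel)"
  proof (rule nn_integral_cong_AE, rule AE_I[where N="{0, 2}"])
    have "ennreal (sqrt (2 / pi)) * ennreal (?f w) = ennreal (2 / (1 + w) * std_gauss (2 * y / w))"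
      if "0 < w" for w
    proof -
      have "2 / (1 + w) * std_gauss (2 * y / w) = 1 / (1 + w) * (2 * std_gauss (2 * y / w))"
        by simp
      also have "\<dots> = sqrt (2 / pi) * ?f w"
        unfolding two_std_normal by (simp add: power_divide power_mult_distrib)
      finally have e: "2 / (1 + w) * std_gauss (2 * y / w) = sqrt (2 / pi) * ?f w" .
      show ?thesis unfolding e by (rule ennreal_mult'[symmetric]) simp
    qed
    then show "{w \<in> space lborel. ennreal (sqrt (2 / pi)) * ennreal (indicator {0..2} w *\<^sub>R ?f w) \<noteq>
         ennreal (2 / (1 + w) * std_gauss (2 * y / w)) * indicator {0<..<2} w} \<subseteq> {0, 2}"
      by (auto split: split_indicator)
  qed (auto intro: emeasure_lborel_countable)
  finally show ?thesis .
qed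

text \<open>Write \<open>p (2 y / w)\<close> as the integral of \<open>z p (z)\<close> over \<open>z > 2 y / w\<close> and integrate over \<open>w\<close> first. The
  condition on \<open>w\<close> becomes \<open>2 y / z < w < 2\<close>, which is possible only for \<open>z > y\<close>.\<close>

lemma alpha_density_log_form_pos:
  assumes "0 < y"
  shows "ennreal (alpha_density y) =
    (\<integral>\<^sup>+z. ennreal (z * std_gauss z) * ennreal (2 * ln (3 * z / (z + 2 * y))) * indicator {y<..} z \<partial>lborel)"
proof -
  define S where "S = {p. 0 < fst p \<and> fst p < 2 \<and> 2 * y / fst p < snd p}"
  have [measurable]: "S \<in> sets (lborel \<Otimes>\<^sub>M lborel)"
    unfolding S_def by (rule Collect_pair_sets) measurable
  let ?K = "\<lambda>w z. ennreal (z * std_gauss z) * (ennreal (2 / (1 + w)) * indicator S (w, z))"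
  have "ennreal (alpha_density y) =
    (\<integral>\<^sup>+w. (\<integral>\<^sup>+z. ?K w z \<partial>lborel) \<partial>lborel)"
    unfolding alpha_density_nn_integral[OF assms]
  proof (rule nn_integral_cong)
    fix w :: real
    show "ennreal (2 / (1 + w) * std_gauss (2 * y / w)) * indicator {0<..<2} w
       = (\<integral>\<^sup>+z. ?K w z \<partial>lborel)"
    proof (cases "0 < w \<and> w < 2")
      case True
      then have "(\<integral>\<^sup>+z. ?K w z \<partial>lborel)
        = (\<integral>\<^sup>+z. ennreal (2 / (1 + w)) * (ennreal (z * std_gauss z) * indicator {2 * y / w<..} z) \<partial>lborel)"
        by (intro nn_integral_cong) (auto split: split_indicator simp: mult_ac S_def)
      also have "\<dots> = ennreal (2 / (1 + w)) * ennreal (std_gauss (2 * y / w))"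
        using True assms by (subst nn_integral_cmult) (auto simp: nn_integral_std_normal_top)
      also have "\<dots> = ennreal (2 / (1 + w) * std_gauss (2 * y / w))"
        using True by (intro ennreal_mult[symmetric]) auto
      finally show ?thesis using True by simp
    qed (auto simp: S_def)
  qed
  also have "\<dots> = (\<integral>\<^sup>+z. (\<integral>\<^sup>+w. ?K w z \<partial>lborel) \<partial>lborel)"
    by (rule lborel_pair.Fubini') measurable
  also have "\<dots> = (\<integral>\<^sup>+z. ennreal (z * std_gauss z) * ennreal (2 * ln (3 * z / (z + 2 * y))) * indicator {y<..} z \<partial>lborel)"
  proof (rule nn_integral_cong)
    fix z :: real
    have "(\<integral>\<^sup>+w. ?K w z \<partial>lborel)
      = ennreal (z * std_gauss z) * (\<integral>\<^sup>+w. ennreal (2 / (1 + w)) * indicator S (w, z) \<partial>lborel)"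
      by (rule nn_integral_cmult) measurable
    also have "(\<integral>\<^sup>+w. ennreal (2 / (1 + w)) * indicator S (w, z) \<partial>lborel)
      = ennreal (2 * ln (3 * z / (z + 2 * y))) * indicator {y<..} z"
    proof (cases "y < z")
      case True
      have "(\<integral>\<^sup>+w. ennreal (2 / (1 + w)) * indicator S (w, z) \<partial>lborel)
        = (\<integral>\<^sup>+w. ennreal (2 / (1 + w)) * indicator {2 * y / z<..<2} w \<partial>lborel)"
      proof (intro nn_integral_cong arg_cong2[where f="(*)"] refl)
        fix w :: real
        have "(0 < w \<and> w < 2 \<and> 2 * y / w < z) = (2 * y / z < w \<and> w < 2)"
        proof (cases "0 < w")
          case w: True
          have "2 * y / w < z \<longleftrightarrow> 2 * y / z < w"
            using w True assms by (simp add: divide_less_eq mult.commute)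
          then show ?thesis using w by auto
        next
          case False
          moreover have "0 < 2 * y / z" using True assms by simp
          ultimately show ?thesis by auto
        qed
        then show "indicator S (w, z) = (indicator {2 * y / z<..<2} w :: ennreal)"
          by (auto split: split_indicator simp: S_def)
      qed
      also have "\<dots> = ennreal (2 * ln (1 + 2) - 2 * ln (1 + 2 * y / z))"
      proof (rule nn_integral_FTC_Ioo)
        have yz: "0 < 2 * y / z" using True assms by simp
        show "2 * y / z < 2" using True assms by (simp add: divide_less_eq)
        have pos: "1 + w \<noteq> 0" "0 < 1 + w" if "2 * y / z < w" for w
          using that yz by linarith+
        show "((\<lambda>w. 2 * ln (1 + w)) has_real_derivative 2 / (1 + w)) (at w)" if "2 * y / z < w" for w
          using pos[OF that] by (auto intro!: derivative_eq_intros)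
        show "isCont (\<lambda>w. 2 / (1 + w)) w" if "2 * y / z < w" for w
          using pos[OF that] by (intro continuous_intros) auto
        show "0 \<le> 2 / (1 + w)" if "2 * y / z < w" for w
          using pos[OF that] by simp
        show "((\<lambda>w. 2 * ln (1 + w)) \<longlongrightarrow> 2 * ln (1 + 2 * y / z)) (at_right (2 * y / z))"
          using yz by (intro tendsto_intros) linarith
        show "((\<lambda>w::real. 2 * ln (1 + w)) \<longlongrightarrow> 2 * ln (1 + 2)) (at_left 2)"
          by (intro tendsto_intros) auto
      qed
      also have "2 * ln (1 + 2) - 2 * ln (1 + 2 * y / z) = 2 * ln (3 * z / (z + 2 * y))"
      proof -
        have e: "1 + 2 * y / z = (z + 2 * y) / z" using True assms by (simp add: field_simps)
        have "ln (1 + 2 * y / z) = ln (z + 2 * y) - ln z"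
          unfolding e using True assms by (intro ln_divide_pos) auto
        moreover have "ln (3 * z / (z + 2 * y)) = ln (3 * z) - ln (z + 2 * y)"
          using True assms by (intro ln_divide_pos) auto
        moreover have "ln (3 * z) = ln 3 + ln z"
          using True assms by (intro ln_mult_pos) auto
        ultimately show ?thesis by simp
      qed
      finally show ?thesis using True by simp
    next
      case False
      have "\<not> (0 < w \<and> w < 2 \<and> 2 * y / w < z)" for w
      proof
        assume w: "0 < w \<and> w < 2 \<and> 2 * y / w < z"
        then have "2 * y < z * w" by (simp add: divide_less_eq)
        also have "z * w \<le> y * w" using w False by (intro mult_right_mono) auto
        also have "y * w \<le> y * 2" using w assms by (intro mult_left_mono) auto
        finally show False by simp
      qed
      then show ?thesis using False by (simp add: S_def)
    qed
    finally show "(\<integral>\<^sup>+w. ?K w z \<partial>lborel) =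
         ennreal (z * std_gauss z) * ennreal (2 * ln (3 * z / (z + 2 * y))) * indicator {y<..} z"
      by (simp add: mult.assoc)
  qed
  finally show ?thesis .
qed

text \<open>The counterpart for \<open>y \<le> 0\<close>, in a form parallel to the previous lemma, so that both match
  the value of the time integral computed below.\<close>

lemma alpha_density_log_form_nonpos:
  assumes "y \<le> 0"
  shows "ennreal (alpha_density y) =
    (\<integral>\<^sup>+z. ennreal (z * std_gauss z) * ennreal (2 * ln 3) * indicator {-2 * y<..} z \<partial>lborel)"
proof -
  have "alpha_density y = std_gauss (- 2 * y) * (2 * ln 3)"
    using two_std_normal[of "- 2 * y"] assms by (simp add: alpha_density_nonpos power_mult_distrib)
  also have "ennreal \<dots> = ennreal (std_gauss (- 2 * y)) * ennreal (2 * ln 3)"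
    by (intro ennreal_mult) auto
  also have "\<dots> = (\<integral>\<^sup>+z. ennreal (z * std_gauss z) * indicator {- 2 * y<..} z \<partial>lborel) * ennreal (2 * ln 3)"
    using assms by (subst nn_integral_std_normal_top) auto
  also have "\<dots> = (\<integral>\<^sup>+z. (ennreal (z * std_gauss z) * indicator {- 2 * y<..} z) * ennreal (2 * ln 3) \<partial>lborel)"
    by (rule nn_integral_multc[symmetric]) measurable
  finally show ?thesis by (simp add: mult_ac)
qed

text \<open>Brownian scaling: in the variables \<open>y = x / sqrt T\<close> and \<open>1 / sqrt T\<close> all Gaussian densities become
  standard. The difference of two values of the standard density is then an integral of \<open>z p (z)\<close>.\<close>

lemma scale_integral_region:
  assumes "0 < T" "y * sqrt T < 1"
  shows "ennreal (1 / sqrt T * (gauss T (\<bar>y * sqrt T\<bar> + 1 - y * sqrt T) - gauss T (3 - 2 * (y * sqrt T))))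
    = (\<integral>\<^sup>+z. ennreal (z * std_gauss z) * (ennreal (1 / T) * indicator {\<bar>y\<bar> - y + 1 / sqrt T<..<3 / sqrt T - 2 * y} z) \<partial>lborel)"
proof -
  let ?r = "1 / sqrt T"
  have r: "y < ?r" "0 < ?r" using assms by (auto simp: field_simps)
  have e1: "(\<bar>y * sqrt T\<bar> + 1 - y * sqrt T) / sqrt T = \<bar>y\<bar> - y + ?r"
    using assms by (simp add: abs_mult field_simps)
  have e2: "(3 - 2 * (y * sqrt T)) / sqrt T = 3 / sqrt T - 2 * y"
    using assms by (simp add: field_simps)
  have "1 / sqrt T * (gauss T (\<bar>y * sqrt T\<bar> + 1 - y * sqrt T) - gauss T (3 - 2 * (y * sqrt T)))
    = 1 / (sqrt T * sqrt T) * (std_gauss (\<bar>y\<bar> - y + ?r) - std_gauss (3 / sqrt T - 2 * y))"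
    unfolding gauss_scale[OF assms(1)] e1 e2
    by (simp only: diff_divide_distrib[symmetric] times_divide_times_eq times_divide_eq_left divide_divide_eq_left mult_1 mult.commute)
  also have "sqrt T * sqrt T = T" using assms by simp
  also have "ennreal (1 / T * (std_gauss (\<bar>y\<bar> - y + ?r) - std_gauss (3 / sqrt T - 2 * y)))
    = ennreal (1 / T) * ennreal (std_gauss (\<bar>y\<bar> - y + ?r) - std_gauss (3 / sqrt T - 2 * y))"
    using assms by (intro ennreal_mult') auto
  also have "\<dots> = ennreal (1 / T) * (\<integral>\<^sup>+z. ennreal (z * std_gauss z) * indicator {\<bar>y\<bar> - y + ?r<..<3 / sqrt T - 2 * y} z \<partial>lborel)"
    using r divide_strict_right_mono[of 1 3 "sqrt T"] assms by (subst nn_integral_std_normal) (auto simp: abs_if)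
  also have "\<dots> = (\<integral>\<^sup>+z. ennreal (1 / T) * (ennreal (z * std_gauss z) * indicator {\<bar>y\<bar> - y + ?r<..<3 / sqrt T - 2 * y} z) \<partial>lborel)"
    by (rule nn_integral_cmult[symmetric]) measurable
  finally show ?thesis by (simp add: mult_ac)
qed

text \<open>Exchanging the order of integration, the time \<open>T\<close> ranges for given \<open>z\<close> over an interval between two
  squares \<open>l\<^sup>2\<close> and \<open>u\<^sup>2\<close>, on which \<open>1 / T\<close> integrates to \<open>2 ln (u / l)\<close>. This replaces all nonlinear
  substitutions, and it treats both signs of \<open>y\<close> at once.\<close>

lemma alpha_density_integral:
  "(\<integral>\<^sup>+T. ennreal (1 / sqrt T * (gauss T (\<bar>y * sqrt T\<bar> + 1 - y * sqrt T) - gauss T (3 - 2 * (y * sqrt T)))) *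
      indicator {T. 0 < T \<and> y * sqrt T < 1} T \<partial>lborel) = ennreal (alpha_density y)"
proof -
  define S where "S = {p. 0 < fst p \<and> y * sqrt (fst p) < 1 \<and> \<bar>y\<bar> - y + 1 / sqrt (fst p) < snd p \<and> snd p < 3 / sqrt (fst p) - 2 * y}"
  have [measurable]: "S \<in> sets (lborel \<Otimes>\<^sub>M lborel)"
    unfolding S_def by (rule Collect_pair_sets) measurable
  let ?K = "\<lambda>T z. ennreal (z * std_gauss z) * (ennreal (1 / T) * indicator S (T, z))"
  let ?G = "\<lambda>T. ennreal (1 / sqrt T * (gauss T (\<bar>y * sqrt T\<bar> + 1 - y * sqrt T) - gauss T (3 - 2 * (y * sqrt T)))) *
      indicator {T. 0 < T \<and> y * sqrt T < 1} T"
  let ?L = "\<lambda>z. ennreal (2 * ln (3 * (z - (\<bar>y\<bar> - y)) / (z + 2 * y))) * indicator {max y (-2 * y)<..} z"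
  have "(\<integral>\<^sup>+T. ?G T \<partial>lborel)
    = (\<integral>\<^sup>+T. (\<integral>\<^sup>+z. ?K T z \<partial>lborel) \<partial>lborel)"
  proof (rule nn_integral_cong)
    fix T :: real
    show "?G T
      = (\<integral>\<^sup>+z. ?K T z \<partial>lborel)"
    proof (cases "0 < T \<and> y * sqrt T < 1")
      case True
      then have "indicator S (T, z) = (indicator {\<bar>y\<bar> - y + 1 / sqrt T<..<3 / sqrt T - 2 * y} z :: ennreal)" for z
        by (auto simp: S_def split: split_indicator)
      with True scale_integral_region[of T y] show ?thesis by simp
    next
      case False
      then have "indicator S (T, z) = (0 :: ennreal)" for z
        by (auto simp: S_def)
      with False show ?thesis by simp
    qed
  qed
  also have "\<dots> = (\<integral>\<^sup>+z. (\<integral>\<^sup>+T. ?K T z \<partial>lborel) \<partial>lborel)"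
    by (rule lborel_pair.Fubini') measurable
  also have "\<dots> = (\<integral>\<^sup>+z. ennreal (z * std_gauss z) *
      (?L z) \<partial>lborel)"
  proof (rule nn_integral_cong)
    fix z :: real
    have "(\<integral>\<^sup>+T. ?K T z \<partial>lborel)
      = ennreal (z * std_gauss z) * (\<integral>\<^sup>+T. ennreal (1 / T) * indicator S (T, z) \<partial>lborel)"
      by (rule nn_integral_cmult) measurable
    also have "(\<integral>\<^sup>+T. ennreal (1 / T) * indicator S (T, z) \<partial>lborel)
      = ?L z"
    proof (cases "max y (-2 * y) < z")
      case True
      define l where "l = 1 / (z - (\<bar>y\<bar> - y))"
      define u where "u = 3 / (z + 2 * y)"
      have pos: "0 < z - (\<bar>y\<bar> - y)" "0 < z + 2 * y" using True by auto
      have lu: "0 < l" "l < u"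
        using pos True by (auto simp: l_def u_def field_simps abs_if)
      (* The constraint y * sqrt T < 1 is implied by the upper bound u for sqrt T. *)
      have yu: "y * u \<le> 1" using pos True by (simp add: u_def field_simps)
      have "indicator S (T, z) = (indicator {l\<^sup>2<..<u\<^sup>2} T :: ennreal)" for T
      proof -
        have "(T, z) \<in> S \<longleftrightarrow> l\<^sup>2 < T \<and> T < u\<^sup>2"
        proof (cases "0 < T")
          case T: True
          have "\<bar>y\<bar> - y + 1 / sqrt T < z \<longleftrightarrow> l < sqrt T"
          proof -
            have "\<bar>y\<bar> - y + 1 / sqrt T < z \<longleftrightarrow> 1 / sqrt T < z - (\<bar>y\<bar> - y)" by auto
            also have "\<dots> \<longleftrightarrow> l < sqrt T"
              using T pos by (simp only: l_def divide_less_eq real_sqrt_gt_0_iff if_True mult.commute)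
            finally show ?thesis .
          qed
          moreover have "z < 3 / sqrt T - 2 * y \<longleftrightarrow> sqrt T < u"
          proof -
            have "z < 3 / sqrt T - 2 * y \<longleftrightarrow> z + 2 * y < 3 / sqrt T" by auto
            also have "\<dots> \<longleftrightarrow> sqrt T < u"
              using T pos by (simp only: u_def less_divide_eq real_sqrt_gt_0_iff if_True mult.commute)
            finally show ?thesis .
          qed
          moreover have "y * sqrt T < 1" if "sqrt T < u"
          proof (cases "0 < y")
            case True
            then have "y * sqrt T < y * u" using that by simp
            then show ?thesis using yu by simp
          next
            case False
            then have "y * sqrt T \<le> 0" using T by (simp add: mult_nonpos_nonneg)
            then show ?thesis by simp
          qed
          moreover have "l < sqrt T \<longleftrightarrow> l\<^sup>2 < T" "sqrt T < u \<longleftrightarrow> T < u\<^sup>2"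
            using real_sqrt_less_iff[of "l\<^sup>2" T] real_sqrt_less_iff[of T "u\<^sup>2"] lu by simp_all
          ultimately show ?thesis using T by (auto simp: S_def)
        next
          case False
          then have "\<not> l\<^sup>2 < T" using zero_le_power2[of l] by linarith
          with False show ?thesis by (auto simp: S_def)
        qed
        then show ?thesis by (auto split: split_indicator)
      qed
      then have "(\<integral>\<^sup>+T. ennreal (1 / T) * indicator S (T, z) \<partial>lborel) = ennreal (ln (u\<^sup>2 / l\<^sup>2))"
        using lu by (simp add: nn_integral_inverse_Ioo power_strict_mono)
      also have "ln (u\<^sup>2 / l\<^sup>2) = 2 * ln (u / l)"
        using lu by (simp add: ln_realpow flip: power_divide)
      also have "u / l = 3 * (z - (\<bar>y\<bar> - y)) / (z + 2 * y)"
        by (simp add: u_def l_def)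
      finally show ?thesis using True by simp
    next
      case False
      have "(T, z) \<notin> S" for T
      proof
        assume "(T, z) \<in> S"
        then have T: "0 < T" "y * sqrt T < 1" "\<bar>y\<bar> - y + 1 / sqrt T < z" by (auto simp: S_def)
        then have "y < 1 / sqrt T" "0 < 1 / sqrt T" by (auto simp: field_simps)
        with T(3) obtain r where "y < r" "0 < r" "\<bar>y\<bar> - y + r < z" by blast
        with False show False by (auto simp: abs_if max_def split: if_splits)
      qed
      then show ?thesis using False by simp
    qed
    finally show "(\<integral>\<^sup>+T. ?K T z \<partial>lborel) =
       ennreal (z * std_gauss z) *
      (?L z)" .
  qed
  also have "\<dots> = ennreal (alpha_density y)"
  proof (cases "0 < y")
    case True
    then have "max y (-2 * y) = y" by simp
    with True show ?thesis by (simp add: alpha_density_log_form_pos mult.assoc)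
  next
    case False
    then have "max y (-2 * y) = -2 * y" by simp
    moreover have "3 * (z - (\<bar>y\<bar> - y)) / (z + 2 * y) = 3" if "-2 * y < z" for z
      using that False by (simp add: divide_eq_eq)
    ultimately show ?thesis using False
      by (auto simp: alpha_density_log_form_nonpos mult.assoc intro!: nn_integral_cong split: split_indicator)
  qed
  finally show ?thesis .
qed

section \<open>Reflection of symmetric random walks\<close>

text \<open>Events about a whole path are obtained from events about finer and finer grids: for every outcome
  the grid event eventually has the same truth value as the limiting event. This yields measurability
  here, and convergence of probabilities in the next lemma.\<close>

lemma sets_of_eventually_eq:
  assumes E: "\<And>n::nat. E n \<in> sets M"
    and sub: "E' \<subseteq> space M"
    and ev: "\<And>\<omega>. \<omega> \<in> space M \<Longrightarrow> eventually (\<lambda>n. \<omega> \<in> E n \<longleftrightarrow> \<omega> \<in> E') sequentially"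
  shows "E' \<in> sets M"
proof -
  have "E' = {\<omega> \<in> space M. \<exists>N. \<forall>n\<ge>N. \<omega> \<in> E n}"
  proof (intro set_eqI iffI CollectI conjI)
    fix \<omega> assume \<omega>: "\<omega> \<in> E'"
    with sub show "\<omega> \<in> space M" by auto
    with ev \<omega> show "\<exists>N. \<forall>n\<ge>N. \<omega> \<in> E n" unfolding eventually_sequentially by fastforce
  next
    fix \<omega> assume "\<omega> \<in> {\<omega> \<in> space M. \<exists>N. \<forall>n\<ge>N. \<omega> \<in> E n}"
    then obtain N where "\<omega> \<in> space M" "\<forall>n\<ge>N. \<omega> \<in> E n" by auto
    moreover from ev[OF this(1)] obtain N' where "\<forall>n\<ge>N'. \<omega> \<in> E n \<longleftrightarrow> \<omega> \<in> E'"
      unfolding eventually_sequentially by auto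
    ultimately show "\<omega> \<in> E'" by (metis nat_le_linear)
  qed
  also have "\<dots> \<in> sets M" using E by measurable
  finally show ?thesis .
qed

lemma (in prob_space) prob_tendsto_of_eventually_eq:
  assumes E: "\<And>n. E n \<in> events"
    and sub: "E' \<subseteq> space M"
    and ev: "\<And>\<omega>. \<omega> \<in> space M \<Longrightarrow> eventually (\<lambda>n::nat. \<omega> \<in> E n \<longleftrightarrow> \<omega> \<in> E') sequentially"
  shows "(\<lambda>n. prob (E n)) \<longlonglongrightarrow> prob E'"
proof -
  have E': "E' \<in> events" using assms by (rule sets_of_eventually_eq)
  have "(\<lambda>n. \<integral>\<omega>. indicator (E n) \<omega> \<partial>M) \<longlonglongrightarrow> (\<integral>\<omega>. indicator E' \<omega> \<partial>M :: real)"
  proof (rule integral_dominated_convergence[where w="\<lambda>_. 1"])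
    show "AE \<omega> in M. (\<lambda>n. indicator (E n) \<omega>) \<longlonglongrightarrow> (indicator E' \<omega> :: real)"
    proof (rule AE_I2)
      fix \<omega> assume "\<omega> \<in> space M"
      then show "(\<lambda>n. indicator (E n) \<omega>) \<longlonglongrightarrow> (indicator E' \<omega> :: real)"
        by (intro tendsto_eventually eventually_mono[OF ev]) (auto split: split_indicator)
    qed
  qed (use E E' in \<open>auto split: split_indicator\<close>)
  then show "(\<lambda>n. prob (E n)) \<longlonglongrightarrow> prob E'"
    using E E' by simp
qed

text \<open>The joint law of independent variables is the product of their marginals, and flipping the sign of a
  symmetric variable does not change its marginal.\<close>

lemma (in prob_space) indep_vars_flip_signs:
  fixes \<xi> :: "nat \<Rightarrow> 'a \<Rightarrow> real"
  assumes indep: "indep_vars (\<lambda>_. borel) \<xi> {..<n}"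
    and sym: "\<And>i. i < n \<Longrightarrow> distr M borel (\<lambda>\<omega>. - \<xi> i \<omega>) = distr M borel (\<xi> i)"
    and C: "C \<in> sets (PiM {..<n} (\<lambda>_. borel))"
  shows "prob {\<omega> \<in> space M. (\<lambda>i\<in>{..<n}. \<xi> i \<omega>) \<in> C}
    = prob {\<omega> \<in> space M. (\<lambda>i\<in>{..<n}. if i \<in> K then - \<xi> i \<omega> else \<xi> i \<omega>) \<in> C}"
proof (cases "n = 0")
  case False
  let ?P = "PiM {..<n} (\<lambda>_. borel :: real measure)"
  define \<eta> where "\<eta> = (\<lambda>i \<omega>. if i \<in> K then - \<xi> i \<omega> else \<xi> i \<omega>)"
  have rv: "random_variable borel (\<xi> i)" if "i < n" for i
    using indep that by (auto simp: indep_vars_def)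
  have rv': "random_variable borel (\<eta> i)" if "i < n" for i
    using rv[OF that] unfolding \<eta>_def by measurable
  have "\<eta> = (\<lambda>i \<omega>. (if i \<in> K then uminus else id) (\<xi> i \<omega>))"
    by (auto simp: \<eta>_def fun_eq_iff)
  then have indep': "indep_vars (\<lambda>_. borel) \<eta> {..<n}"
    by (simp only:) (rule indep_vars_compose2[OF indep], auto)
  have marg: "distr M borel (\<eta> i) = distr M borel (\<xi> i)" if "i < n" for i
    using sym[OF that] by (cases "i \<in> K") (simp_all add: \<eta>_def)
  have "distr M ?P (\<lambda>\<omega>. \<lambda>i\<in>{..<n}. \<eta> i \<omega>) = (\<Pi>\<^sub>M i\<in>{..<n}. distr M borel (\<eta> i))"
    using indep' rv' False by (subst (asm) indep_vars_iff_distr_eq_PiM') auto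
  also have "\<dots> = (\<Pi>\<^sub>M i\<in>{..<n}. distr M borel (\<xi> i))"
    by (intro PiM_cong marg) auto
  also have "\<dots> = distr M ?P (\<lambda>\<omega>. \<lambda>i\<in>{..<n}. \<xi> i \<omega>)"
    using indep rv False by (subst (asm) indep_vars_iff_distr_eq_PiM') auto
  finally have eq: "measure (distr M ?P (\<lambda>\<omega>. \<lambda>i\<in>{..<n}. \<eta> i \<omega>)) C
     = measure (distr M ?P (\<lambda>\<omega>. \<lambda>i\<in>{..<n}. \<xi> i \<omega>)) C"
    by simp
  have m: "(\<lambda>\<omega>. \<lambda>i\<in>{..<n}. \<eta> i \<omega>) \<in> measurable M ?P"
    "(\<lambda>\<omega>. \<lambda>i\<in>{..<n}. \<xi> i \<omega>) \<in> measurable M ?P"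
    using rv rv' by (auto intro!: measurable_restrict)
  have "{\<omega> \<in> space M. f \<omega> \<in> C} = f -` C \<inter> space M" for f :: "'a \<Rightarrow> nat \<Rightarrow> real"
    by auto
  with eq show ?thesis
    by (simp add: measure_distr[OF m(1) C] measure_distr[OF m(2) C]) (simp add: \<eta>_def)
qed (auto simp: restrict_def)

definition first_passage :: "real \<Rightarrow> (nat \<Rightarrow> real) \<Rightarrow> nat \<Rightarrow> bool" where
  "first_passage a S k \<longleftrightarrow> a < S k \<and> (\<forall>j<k. S j \<le> a)"

lemma first_passage_exists:
  assumes "a < S k"
  shows "\<exists>j\<le>k. first_passage a S j"
proof -
  let ?j = "LEAST j. a < S j"
  have "a < S ?j" using assms by (rule LeastI)
  moreover have "?j \<le> k" using assms by (rule Least_le)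
  moreover have "S i \<le> a" if "i < ?j" for i
    using not_less_Least[OF that] by simp
  ultimately show ?thesis unfolding first_passage_def by blast
qed

lemma first_passage_unique: "first_passage a S j \<Longrightarrow> first_passage a S k \<Longrightarrow> j = k"
  unfolding first_passage_def by (metis linorder_neqE_nat not_less)

lemma measurable_first_passage:
  assumes "\<And>j. j \<le> k \<Longrightarrow> (\<lambda>\<omega>. S \<omega> j) \<in> borel_measurable M"
  shows "Measurable.pred M (\<lambda>\<omega>. first_passage a (S \<omega>) k)"
  unfolding first_passage_def using assms
  by (intro pred_intros_logic borel_measurable_pred_less pred_intros_countable_bounded) (auto intro!: borel_measurable_pred_less measurable_const simp: pred_def not_less[symmetric])

text \<open>Decompose by the time \<open>k\<close> of the first passage over \<open>a\<close> and flip the signs of all steps from index \<open>k\<close>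
  on. The path up to time \<open>k\<close>, and with it the event of first passage at \<open>k\<close>, stays the same,
  while the endpoint \<open>S n\<close> becomes \<open>2 S k - S n\<close>.\<close>

lemma (in prob_space) random_walk_reflection:
  fixes \<xi> :: "nat \<Rightarrow> 'a \<Rightarrow> real"
  assumes indep: "indep_vars (\<lambda>_. borel) \<xi> {..<n}"
    and sym: "\<And>i. i < n \<Longrightarrow> distr M borel (\<lambda>\<omega>. - \<xi> i \<omega>) = distr M borel (\<xi> i)"
  defines "S \<equiv> \<lambda>\<omega> k. \<Sum>i<k. \<xi> i \<omega>"
  shows "prob {\<omega> \<in> space M. \<exists>k\<le>n. first_passage a (S \<omega>) k \<and> S \<omega> n < x}
    = prob {\<omega> \<in> space M. \<exists>k\<le>n. first_passage a (S \<omega>) k \<and> 2 * S \<omega> k - S \<omega> n < x}"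
proof -
  have rv[measurable]: "random_variable borel (\<xi> i)" if "i < n" for i
    using indep that by (auto simp: indep_vars_def)
  have mS: "(\<lambda>\<omega>. S \<omega> k) \<in> borel_measurable M" if "k \<le> n" for k
    unfolding S_def using that by (intro borel_measurable_sum rv) auto
  have mFP: "Measurable.pred M (\<lambda>\<omega>. first_passage a (S \<omega>) k)" if "k \<le> n" for k
    using mS that by (intro measurable_first_passage) auto
  let ?D = "\<lambda>k. {\<omega> \<in> space M. first_passage a (S \<omega>) k \<and> S \<omega> n < x}"
  let ?D' = "\<lambda>k. {\<omega> \<in> space M. first_passage a (S \<omega>) k \<and> 2 * S \<omega> k - S \<omega> n < x}"
  have mD: "?D k \<in> events" "?D' k \<in> events" if "k \<le> n" for k
    using mFP[OF that] mS[OF that] mS[OF order.refl] by measurable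
  have "prob {\<omega> \<in> space M. \<exists>k\<le>n. first_passage a (S \<omega>) k \<and> S \<omega> n < x} = prob (\<Union>k\<in>{..n}. ?D k)"
    by (intro arg_cong[where f=prob]) auto
  also have "\<dots> = (\<Sum>k\<le>n. prob (?D k))"
    using mD(1) by (intro finite_measure_finite_Union)
      (auto simp: disjoint_family_on_def dest: first_passage_unique)
  also have "\<dots> = (\<Sum>k\<le>n. prob (?D' k))"
  proof (rule sum.cong[OF refl])
    fix k assume "k \<in> {..n}"
    then have k: "k \<le> n" by simp
    define ps :: "(nat \<Rightarrow> real) \<Rightarrow> nat \<Rightarrow> real" where "ps = (\<lambda>f k. \<Sum>i<k. f i)"
    define C where "C = {f \<in> space (PiM {..<n} (\<lambda>_. borel :: real measure)). first_passage a (ps f) k \<and> ps f n < x}"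
    have mps: "(\<lambda>f. ps f j) \<in> borel_measurable (PiM {..<n} (\<lambda>_. borel))" if "j \<le> n" for j
      unfolding ps_def using that by (intro borel_measurable_sum measurable_component_singleton) auto
    have "Measurable.pred (PiM {..<n} (\<lambda>_. borel)) (\<lambda>f. first_passage a (ps f) k)"
      using mps k by (intro measurable_first_passage) auto
    then have C: "C \<in> sets (PiM {..<n} (\<lambda>_. borel))"
      unfolding C_def using mps[OF order.refl] by measurable
    let ?v = "\<lambda>\<omega>. \<lambda>i\<in>{..<n}. \<xi> i \<omega>"
    let ?v' = "\<lambda>\<omega>. \<lambda>i\<in>{..<n}. if k \<le> i then - \<xi> i \<omega> else \<xi> i \<omega>"
    have ps1: "ps (?v \<omega>) j = S \<omega> j" if "j \<le> n" for \<omega> j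
      unfolding ps_def S_def using that by (intro sum.cong) auto
    have ps2: "ps (?v' \<omega>) j = S \<omega> j" if "j \<le> k" for \<omega> j
      unfolding ps_def S_def using that k by (intro sum.cong) auto
    have ps3: "ps (?v' \<omega>) n = 2 * S \<omega> k - S \<omega> n" for \<omega>
    proof -
      have split: "{..<n} = {..<k} \<union> {k..<n}" using k by auto
      have "ps (?v' \<omega>) n = (\<Sum>i<k. \<xi> i \<omega>) + (\<Sum>i\<in>{k..<n}. - \<xi> i \<omega>)"
        unfolding ps_def split by (subst sum.union_disjoint) (auto intro!: arg_cong2[where f="(+)"] sum.cong)
      moreover have "S \<omega> n = (\<Sum>i<k. \<xi> i \<omega>) + (\<Sum>i\<in>{k..<n}. \<xi> i \<omega>)"
        unfolding S_def split by (subst sum.union_disjoint) auto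
      ultimately show ?thesis by (simp add: S_def sum_negf)
    qed
    have "?D k = {\<omega> \<in> space M. ?v \<omega> \<in> C}"
      using k by (auto simp: C_def first_passage_def ps1 space_PiM)
    moreover have "?D' k = {\<omega> \<in> space M. ?v' \<omega> \<in> C}"
      by (auto simp: C_def first_passage_def ps2 ps3 space_PiM)
    ultimately show "prob (?D k) = prob (?D' k)"
      using indep_vars_flip_signs[OF indep sym C, of "{k..}"] by simp
  qed
  also have "\<dots> = prob (\<Union>k\<in>{..n}. ?D' k)"
    using mD(2) by (intro finite_measure_finite_Union[symmetric])
      (auto simp: disjoint_family_on_def dest: first_passage_unique)
  also have "(\<Union>k\<in>{..n}. ?D' k) = {\<omega> \<in> space M. \<exists>k\<le>n. first_passage a (S \<omega>) k \<and> 2 * S \<omega> k - S \<omega> n < x}"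
    by auto
  finally show ?thesis .
qed

text \<open>In discrete time \<open>S k\<close> exceeds \<open>a\<close> at the first passage by at most one step, so the reflection
  identity holds only up to the overshoot. The lower bound excludes steps larger than \<open>\<epsilon>\<close>.\<close>

lemma (in prob_space) random_walk_reflection_bounds:
  fixes \<xi> :: "nat \<Rightarrow> 'a \<Rightarrow> real"
  assumes indep: "indep_vars (\<lambda>_. borel) \<xi> {..<n}"
    and sym: "\<And>i. i < n \<Longrightarrow> distr M borel (\<lambda>\<omega>. - \<xi> i \<omega>) = distr M borel (\<xi> i)"
    and "0 \<le> a" "x \<le> a" "0 < \<epsilon>"
  defines "S \<equiv> \<lambda>\<omega> k. \<Sum>i<k. \<xi> i \<omega>"
  shows "prob {\<omega> \<in> space M. (\<exists>k\<le>n. a < S \<omega> k) \<and> S \<omega> n < x} \<le> prob {\<omega> \<in> space M. 2 * a - x < S \<omega> n}"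
    and "prob {\<omega> \<in> space M. 2 * a - x + 2 * \<epsilon> < S \<omega> n \<and> (\<forall>i<n. \<xi> i \<omega> \<le> \<epsilon>)}
      \<le> prob {\<omega> \<in> space M. (\<exists>k\<le>n. a < S \<omega> k) \<and> S \<omega> n < x}"
proof -
  have rv[measurable]: "random_variable borel (\<xi> i)" if "i < n" for i
    using indep that by (auto simp: indep_vars_def)
  have mS: "(\<lambda>\<omega>. S \<omega> k) \<in> borel_measurable M" if "k \<le> n" for k
    unfolding S_def using that by (intro borel_measurable_sum rv) auto
  have mFP: "Measurable.pred M (\<lambda>\<omega>. first_passage a (S \<omega>) k)" if "k \<le> n" for k
    using mS that by (intro measurable_first_passage) auto
  let ?R = "{\<omega> \<in> space M. \<exists>k\<le>n. first_passage a (S \<omega>) k \<and> 2 * S \<omega> k - S \<omega> n < x}"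
  have "?R = (\<Union>k\<in>{..n}. {\<omega> \<in> space M. first_passage a (S \<omega>) k \<and> 2 * S \<omega> k - S \<omega> n < x})"
    by auto
  also have "\<dots> \<in> events"
    using mFP mS by (intro sets.finite_UN) (auto intro!: sets.sets_Collect_conj simp: pred_def)
  finally have R: "?R \<in> events" .
  have *: "(\<exists>k\<le>n. a < S \<omega> k) \<longleftrightarrow> (\<exists>k\<le>n. first_passage a (S \<omega>) k)" for \<omega>
    using first_passage_exists[of a "S \<omega>"] by (meson first_passage_def order.trans)
  have eq: "prob {\<omega> \<in> space M. (\<exists>k\<le>n. a < S \<omega> k) \<and> S \<omega> n < x} = prob ?R"
  proof -
    have "{\<omega> \<in> space M. (\<exists>k\<le>n. a < S \<omega> k) \<and> S \<omega> n < x} = {\<omega> \<in> space M. \<exists>k\<le>n. first_passage a (S \<omega>) k \<and> S \<omega> n < x}"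
      using * by auto
    then show ?thesis using random_walk_reflection[OF indep sym, of a x] unfolding S_def by simp
  qed
  show "prob {\<omega> \<in> space M. (\<exists>k\<le>n. a < S \<omega> k) \<and> S \<omega> n < x} \<le> prob {\<omega> \<in> space M. 2 * a - x < S \<omega> n}"
    unfolding eq using mS[OF order.refl]
    by (intro finite_measure_mono) (auto simp: first_passage_def)
  show "prob {\<omega> \<in> space M. 2 * a - x + 2 * \<epsilon> < S \<omega> n \<and> (\<forall>i<n. \<xi> i \<omega> \<le> \<epsilon>)}
      \<le> prob {\<omega> \<in> space M. (\<exists>k\<le>n. a < S \<omega> k) \<and> S \<omega> n < x}"
    unfolding eq
  proof (intro finite_measure_mono R subsetI CollectI conjI; elim CollectE conjE)
    fix \<omega> assume \<omega>: "\<omega> \<in> space M" "2 * a - x + 2 * \<epsilon> < S \<omega> n" "\<forall>i<n. \<xi> i \<omega> \<le> \<epsilon>"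
    have "a < S \<omega> n" using \<omega> assms by linarith
    then obtain k where k: "k \<le> n" "first_passage a (S \<omega>) k"
      using first_passage_exists by blast
    (* The overshoot: before the first passage the walk is at most a, and 0 at time 0. *)
    have "S \<omega> k \<le> a + \<epsilon>"
    proof (cases k)
      case 0
      then show ?thesis using assms by (simp add: S_def)
    next
      case (Suc j)
      then have "S \<omega> j \<le> a" "\<xi> j \<omega> \<le> \<epsilon>" using k \<omega> by (auto simp: first_passage_def)
      then show ?thesis using Suc by (simp add: S_def)
    qed
    then show "\<exists>k\<le>n. first_passage a (S \<omega>) k \<and> 2 * S \<omega> k - S \<omega> n < x"
      using k \<omega> by (intro exI[of _ k]) auto
  qed
qed

section \<open>The reflection principle for continuous paths\<close>

text \<open>The path properties are separated from the probability measure because the hitting time will also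
  be needed as a function measurable with respect to a smaller \<open>\<sigma>\<close>-algebra. Continuity and the start
  at \<open>0\<close> hold for every outcome here; the passage from almost every outcome is made at the end.\<close>

locale continuous_paths =
  fixes M :: "'a measure" and X :: "real \<Rightarrow> 'a \<Rightarrow> real"
  assumes measurable_X: "\<And>t. 0 \<le> t \<Longrightarrow> X t \<in> borel_measurable M"
    and start: "\<And>\<omega>. X 0 \<omega> = 0"
    and cont: "\<And>\<omega>. continuous_on {0..} (\<lambda>t. X t \<omega>)"

locale continuous_brownian_motion = prob_space M + continuous_paths M X
  for M :: "'a measure" and X :: "real \<Rightarrow> 'a \<Rightarrow> real" +
  assumes bm: "brownian_motion M X"
begin

lemma increment_distributed:
  "0 \<le> s \<Longrightarrow> s < t \<Longrightarrow> distributed M lborel (\<lambda>\<omega>. X t \<omega> - X s \<omega>) (\<lambda>x. ennreal (gauss (t - s) x))"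
  using bm by (simp add: brownian_motion_def)

lemma X_distributed: "0 < t \<Longrightarrow> distributed M lborel (X t) (\<lambda>x. ennreal (gauss t x))"
  using increment_distributed[of 0 t] by (simp add: start)

lemma indep_increments:
  assumes "0 \<le> \<tau> 0" "\<And>i. i < n \<Longrightarrow> \<tau> i \<le> \<tau> (Suc i)"
  shows "indep_vars (\<lambda>_. borel) (\<lambda>i \<omega>. X (\<tau> (Suc i)) \<omega> - X (\<tau> i) \<omega>) {..<n::nat}"
proof -
  have "\<And>(n::nat) \<tau>. 0 \<le> \<tau> 0 \<Longrightarrow> (\<forall>i<n. \<tau> i \<le> \<tau> (Suc i)) \<Longrightarrow>
        indep_vars (\<lambda>_. borel) (\<lambda>i \<omega>. X (\<tau> (Suc i)) \<omega> - X (\<tau> i) \<omega>) {..<n}"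
    using bm unfolding brownian_motion_def by blast
  then show ?thesis using assms by blast
qed

lemma increment_symmetric:
  assumes "0 \<le> s" "s < t"
  shows "distr M borel (\<lambda>\<omega>. - (X t \<omega> - X s \<omega>)) = distr M borel (\<lambda>\<omega>. X t \<omega> - X s \<omega>)"
proof -
  have "distributed M lborel (\<lambda>\<omega>. 0 + (-1) * (X t \<omega> - X s \<omega>)) (\<lambda>x. ennreal (normal_density (0 + (-1) * 0) (\<bar>-1\<bar> * sqrt (t - s)) x))"
    using assms by (intro normal_density_affine increment_distributed) auto
  then have "distr M lborel (\<lambda>\<omega>. - (X t \<omega> - X s \<omega>)) = distr M lborel (\<lambda>\<omega>. X t \<omega> - X s \<omega>)"
    using increment_distributed[OF assms] by (simp add: distributed_def)
  moreover have "distr M lborel f = distr M borel f" for f :: "'a \<Rightarrow> real"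
    by (rule distr_cong) auto
  ultimately show ?thesis by simp
qed

lemma shift: "0 \<le> s \<Longrightarrow> continuous_brownian_motion M (\<lambda>v \<omega>. X (s + v) \<omega> - X s \<omega>)"
proof unfold_locales
  assume s: "0 \<le> s"
  show "X (s + 0) \<omega> - X s \<omega> = 0" for \<omega> by simp
  have "continuous_on {0..} (\<lambda>v. X (s + v) \<omega>)" for \<omega>
    by (rule continuous_on_compose2[OF cont[of \<omega>]]) (use s in \<open>auto intro!: continuous_intros\<close>)
  then show c: "continuous_on {0..} (\<lambda>v. X (s + v) \<omega> - X s \<omega>)" for \<omega>
    by (intro continuous_intros)
  show m: "(\<lambda>\<omega>. X (s + v) \<omega> - X s \<omega>) \<in> borel_measurable M" if "0 \<le> v" for v
    using that s by (intro borel_measurable_diff measurable_X) auto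
  show "brownian_motion M (\<lambda>v \<omega>. X (s + v) \<omega> - X s \<omega>)"
    unfolding brownian_motion_def
  proof (intro conjI allI impI)
    show "prob_space M" by unfold_locales
    show "distributed M lborel (\<lambda>\<omega>. (X (s + v) \<omega> - X s \<omega>) - (X (s + u) \<omega> - X s \<omega>)) (\<lambda>x. ennreal (gauss (v - u) x))"
      if "0 \<le> u" "u < v" for u v
      using increment_distributed[of "s + u" "s + v"] s that by simp
    show "indep_vars (\<lambda>_. borel) (\<lambda>i \<omega>. (X (s + \<tau> (Suc i)) \<omega> - X s \<omega>) - (X (s + \<tau> i) \<omega> - X s \<omega>)) {..<n}"
      if "0 \<le> \<tau> 0" "\<forall>i<n. \<tau> i \<le> \<tau> (Suc i)" for n :: nat and \<tau>
      using indep_increments[of "\<lambda>i. s + \<tau> i" n] s that by simp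
  qed (use c m in auto)
qed

end

lemma grid_point_tendsto:
  fixes u s :: real
  assumes "0 < s" "0 \<le> u" "u \<le> s"
  obtains k :: "nat \<Rightarrow> nat" where "\<And>n. k n \<le> Suc n" "(\<lambda>n. s * k n / Suc n) \<longlonglongrightarrow> u"
proof
  define k where "k = (\<lambda>n. nat \<lfloor>u * Suc n / s\<rfloor>)"
  show "k n \<le> Suc n" for n
  proof -
    have "u * Suc n / s \<le> Suc n" using assms by (simp add: divide_le_eq mult_right_mono mult.commute)
    then show ?thesis unfolding k_def by linarith
  qed
  have bounds: "u - s * inverse (real (Suc n)) \<le> s * k n / Suc n" "s * k n / Suc n \<le> u" for n
  proof -
    have "0 \<le> u * Suc n / s" using assms by simp
    then have "u * Suc n / s - 1 \<le> k n" "k n \<le> u * Suc n / s"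
      unfolding k_def by linarith+
    then have "s * (u * Suc n / s - 1) \<le> s * k n" "s * k n \<le> s * (u * Suc n / s)"
      using assms by (simp_all only: mult_left_mono less_imp_le)
    then have "u * Suc n - s \<le> s * k n" "s * k n \<le> u * Suc n"
      using assms by (auto simp: right_diff_distrib)
    then show "s * k n / Suc n \<le> u" "u - s * inverse (real (Suc n)) \<le> s * k n / Suc n"
      by (simp_all add: pos_le_divide_eq pos_divide_le_eq left_diff_distrib mult.assoc del: of_nat_Suc)
  qed
  show "(\<lambda>n. s * k n / Suc n) \<longlonglongrightarrow> u"
  proof (rule tendsto_sandwich)
    show "(\<lambda>n. u - s * inverse (real (Suc n))) \<longlonglongrightarrow> u"
      using tendsto_diff[OF tendsto_const tendsto_mult[OF tendsto_const LIMSEQ_inverse_real_of_nat], of u s] by simp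
    show "(\<lambda>n. u) \<longlonglongrightarrow> u" by simp
  qed (use bounds in auto)
qed

text \<open>If the path exceeds \<open>a\<close> somewhere, then by continuity it does so at the nearest grid points as
  soon as the grid is fine enough.\<close>

lemma eventually_grid_exceeds:
  fixes f :: "real \<Rightarrow> real"
  assumes f: "continuous_on {0..s} f" and "0 < s"
  shows "eventually (\<lambda>n. (\<exists>k\<le>Suc n. a < f (s * k / Suc n)) \<longleftrightarrow> (\<exists>u\<in>{0..s}. a < f u)) sequentially"
proof (cases "\<exists>u\<in>{0..s}. a < f u")
  case True
  then obtain u where u: "0 \<le> u" "u \<le> s" "a < f u" by auto
  obtain k where k: "\<And>n. k n \<le> Suc n" "(\<lambda>n. s * k n / Suc n) \<longlonglongrightarrow> u"
    using grid_point_tendsto[OF \<open>0 < s\<close> u(1,2)] by blast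
  have "s * k n / Suc n \<in> {0..s}" for n
    using k(1)[of n] \<open>0 < s\<close> by (auto simp: divide_le_eq mult_left_mono simp del: of_nat_Suc)
  then have "(\<lambda>n. f (s * k n / Suc n)) \<longlonglongrightarrow> f u"
    using u k(2) by (intro continuous_on_tendsto_compose[OF f]) (auto simp del: of_nat_Suc)
  then have "eventually (\<lambda>n. a < f (s * k n / Suc n)) sequentially"
    using u(3) by (rule order_tendstoD)
  then show ?thesis
    by eventually_elim (use True k(1) in blast)
next
  case False
  have "s * k / Suc n \<in> {0..s}" if "k \<le> Suc n" for k n :: nat
    using that \<open>0 < s\<close> by (auto simp: divide_le_eq mult_left_mono simp del: of_nat_Suc)
  with False show ?thesis by (auto intro!: always_eventually)
qed

lemma eventually_grid_increments_le:
  fixes f :: "real \<Rightarrow> real"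
  assumes f: "continuous_on {0..s} f" and "0 < s" "0 < \<epsilon>"
  shows "eventually (\<lambda>n. \<forall>i<Suc n. f (s * Suc i / Suc n) - f (s * i / Suc n) \<le> \<epsilon>) sequentially"
proof -
  have "uniformly_continuous_on {0..s} f"
    using f by (intro compact_uniformly_continuous) auto
  then obtain d where d: "0 < d" "\<And>x y. x \<in> {0..s} \<Longrightarrow> y \<in> {0..s} \<Longrightarrow> dist y x < d \<Longrightarrow> dist (f y) (f x) < \<epsilon>"
    using \<open>0 < \<epsilon>\<close> unfolding uniformly_continuous_on_def by metis
  have "(\<lambda>n. s * inverse (real (Suc n))) \<longlonglongrightarrow> 0"
    using tendsto_mult[OF tendsto_const LIMSEQ_inverse_real_of_nat, of s] by simp
  then have "eventually (\<lambda>n. s * inverse (real (Suc n)) < d) sequentially"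
    using d(1) by (rule order_tendstoD)
  then show ?thesis
  proof eventually_elim
    case (elim n)
    show ?case
    proof (intro allI impI)
      fix i assume i: "i < Suc n"
      have in_grid: "s * k / Suc n \<in> {0..s}" if "k \<le> Suc n" for k :: nat
        using that \<open>0 < s\<close> by (auto simp: divide_le_eq mult_left_mono simp del: of_nat_Suc)
      have "s * Suc i / Suc n - s * i / Suc n = s * inverse (real (Suc n))"
      proof -
        have "s * Suc i - s * i = s" by (simp add: algebra_simps)
        then show ?thesis by (simp only: divide_inverse left_diff_distrib[symmetric])
      qed
      then have "dist (s * Suc i / Suc n) (s * i / Suc n) < d"
        using elim \<open>0 < s\<close> by (simp add: dist_real_def del: of_nat_Suc)
      then have "dist (f (s * Suc i / Suc n)) (f (s * i / Suc n)) < \<epsilon>"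
        using i by (intro d in_grid) auto
      then show "f (s * Suc i / Suc n) - f (s * i / Suc n) \<le> \<epsilon>"
        by (simp add: dist_real_def)
    qed
  qed
qed

context continuous_paths
begin

lemma cont_Icc: "0 \<le> s \<Longrightarrow> continuous_on {0..s} (\<lambda>t. X t \<omega>)"
  by (rule continuous_on_subset[OF cont]) auto

lemma exceed_sets:
  assumes "0 < s"
  shows "{\<omega> \<in> space M. \<exists>u\<in>{0..s}. a < X u \<omega>} \<in> sets M"
proof (rule sets_of_eventually_eq)
  show "{\<omega> \<in> space M. \<exists>k\<le>Suc n. a < X (s * k / Suc n) \<omega>} \<in> sets M" for n
  proof -
    have [measurable]: "X (s * k / Suc n) \<in> borel_measurable M" for k :: nat
      using assms by (intro measurable_X) auto
    show ?thesis by measurable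
  qed
qed (use eventually_grid_exceeds[OF cont_Icc assms] assms in auto)

abbreviation below :: "real \<Rightarrow> real \<Rightarrow> 'a set" where
  "below a s \<equiv> {\<omega> \<in> space M. \<forall>u\<in>{0..s}. X u \<omega> \<le> a}"

lemma below_sets:
  assumes "0 < s"
  shows "below a s \<in> sets M"
proof -
  have "below a s = space M - {\<omega> \<in> space M. \<exists>u\<in>{0..s}. a < X u \<omega>}"
    by (auto simp: not_less)
  then show ?thesis using exceed_sets[OF assms] by auto
qed

end

context continuous_brownian_motion
begin

text \<open>The bounds for random walks are applied to the increments over a grid of \<open>n + 1\<close> equal
  steps. As \<open>n \<rightarrow> \<infinity>\<close>, uniform continuity makes all steps smaller than any \<open>\<epsilon> > 0\<close>, and then \<open>\<epsilon>\<close>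
  tends to \<open>0\<close>.\<close>

lemma reflection_principle:
  assumes "0 < s" "0 \<le> a" "x \<le> a"
  shows "prob {\<omega> \<in> space M. (\<exists>u\<in>{0..s}. a < X u \<omega>) \<and> X s \<omega> < x} = prob {\<omega> \<in> space M. 2 * a - x < X s \<omega>}"
proof (rule antisym)
  let ?R = "{\<omega> \<in> space M. 2 * a - x < X s \<omega>}"
  define \<tau> where "\<tau> = (\<lambda>n (k::nat). s * k / Suc n)"
  define \<xi> where "\<xi> = (\<lambda>n i \<omega>. X (\<tau> n (Suc i)) \<omega> - X (\<tau> n i) \<omega>)"
  have \<tau>: "0 \<le> \<tau> n i" "\<tau> n 0 = 0" "\<tau> n (Suc n) = s" "\<tau> n i < \<tau> n (Suc i)" for n i
    using assms by (auto simp: \<tau>_def divide_strict_right_mono)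
  have indep: "indep_vars (\<lambda>_. borel) (\<xi> n) {..<Suc n}" for n
    unfolding \<xi>_def by (rule indep_increments) (use \<tau> in \<open>auto simp: less_imp_le\<close>)
  have sym: "distr M borel (\<lambda>\<omega>. - \<xi> n i \<omega>) = distr M borel (\<xi> n i)" for n i
    unfolding \<xi>_def by (rule increment_symmetric) (use \<tau> in auto)
  have sum: "(\<Sum>i<k. \<xi> n i \<omega>) = X (\<tau> n k) \<omega>" for n k \<omega>
    unfolding \<xi>_def using sum_lessThan_telescope[of "\<lambda>k. X (\<tau> n k) \<omega>" k] by (simp add: \<tau> start)
  have [measurable]: "X (\<tau> n k) \<in> borel_measurable M" "X s \<in> borel_measurable M" for n k
    using \<tau> assms by (auto intro!: measurable_X)
  have [measurable]: "\<xi> n i \<in> borel_measurable M" for n i unfolding \<xi>_def by measurable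
  let ?E = "\<lambda>n. {\<omega> \<in> space M. (\<exists>k\<le>Suc n. a < X (\<tau> n k) \<omega>) \<and> X s \<omega> < x}"
  let ?E' = "{\<omega> \<in> space M. (\<exists>u\<in>{0..s}. a < X u \<omega>) \<and> X s \<omega> < x}"
  have lim: "(\<lambda>n. prob (?E n)) \<longlonglongrightarrow> prob ?E'"
  proof (rule prob_tendsto_of_eventually_eq)
    fix \<omega> assume "\<omega> \<in> space M"
    show "eventually (\<lambda>n. \<omega> \<in> ?E n \<longleftrightarrow> \<omega> \<in> ?E') sequentially"
      using eventually_grid_exceeds[OF cont_Icc assms(1), of a \<omega>] assms
      by (auto elim!: eventually_mono simp: \<tau>_def)
  qed auto
  show "prob ?E' \<le> prob ?R"
  proof (rule LIMSEQ_le_const2[OF lim], intro exI allI impI)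
    fix n
    show "prob (?E n) \<le> prob ?R"
      using random_walk_reflection_bounds(1)[OF indep sym assms(2,3) zero_less_one, of n]
      unfolding sum \<tau> .
  qed
  have lower: "prob {\<omega> \<in> space M. 2 * a - x + 2 * \<epsilon> < X s \<omega>} \<le> prob ?E'" if "0 < \<epsilon>" for \<epsilon>
  proof (rule LIMSEQ_le)
    show "(\<lambda>n. prob (?E n)) \<longlonglongrightarrow> prob ?E'" by (rule lim)
    let ?F = "\<lambda>n. {\<omega> \<in> space M. 2 * a - x + 2 * \<epsilon> < X s \<omega> \<and> (\<forall>i<Suc n. \<xi> n i \<omega> \<le> \<epsilon>)}"
    show "(\<lambda>n. prob (?F n)) \<longlonglongrightarrow> prob {\<omega> \<in> space M. 2 * a - x + 2 * \<epsilon> < X s \<omega>}"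
    proof (rule prob_tendsto_of_eventually_eq)
      fix \<omega> assume "\<omega> \<in> space M"
      then show "eventually (\<lambda>n. \<omega> \<in> ?F n \<longleftrightarrow> \<omega> \<in> {\<omega> \<in> space M. 2 * a - x + 2 * \<epsilon> < X s \<omega>}) sequentially"
        using eventually_grid_increments_le[OF cont_Icc assms(1) that, of \<omega>] assms
        by (auto elim!: eventually_mono simp: \<tau>_def \<xi>_def)
    qed auto
    show "\<exists>N. \<forall>n\<ge>N. prob (?F n) \<le> prob (?E n)"
      using random_walk_reflection_bounds(2)[OF indep sym assms(2,3) that]
      unfolding sum \<tau> by blast
  qed
  show "prob ?R \<le> prob ?E'"
  proof (rule LIMSEQ_le_const2)
    let ?G = "\<lambda>n. {\<omega> \<in> space M. 2 * a - x + 2 * inverse (Suc n) < X s \<omega>}"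
    show "(\<lambda>n. prob (?G n)) \<longlonglongrightarrow> prob ?R"
    proof (rule prob_tendsto_of_eventually_eq)
      fix \<omega> assume \<omega>: "\<omega> \<in> space M"
      have lim: "(\<lambda>n. 2 * a - x + 2 * inverse (Suc n)) \<longlonglongrightarrow> 2 * a - x + 2 * 0"
        by (intro tendsto_intros LIMSEQ_inverse_real_of_nat)
      show "eventually (\<lambda>n. \<omega> \<in> ?G n \<longleftrightarrow> \<omega> \<in> ?R) sequentially"
      proof (cases "2 * a - x < X s \<omega>")
        case True
        then have "eventually (\<lambda>n. 2 * a - x + 2 * inverse (Suc n) < X s \<omega>) sequentially"
          using lim by (intro order_tendstoD(2)[OF lim]) simp
        then show ?thesis using True \<omega> by (auto elim!: eventually_mono)
      next
        case False
        have "\<not> 2 * a - x + 2 * inverse (Suc n) < X s \<omega>" for n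
          using False inverse_positive_iff_positive[of "real (Suc n)"] by linarith
        then show ?thesis using False by simp
      qed
    qed auto
    show "\<exists>N. \<forall>n\<ge>N. prob (?G n) \<le> prob ?E'"
      by (intro exI allI impI lower) simp
  qed
qed

end

section \<open>The law of the maximum and of the killed position\<close>

lemma measure_eqI_rectangles:
  fixes P Q :: "(real \<times> real) measure" and a b :: "nat \<Rightarrow> real set"
  assumes sets: "sets P = sets (borel \<Otimes>\<^sub>M borel)" "sets Q = sets (borel \<Otimes>\<^sub>M borel)"
    and stable: "Int_stable Ea" "Int_stable Eb"
    and gen: "sets borel = sigma_sets UNIV Ea" "sets borel = sigma_sets UNIV Eb"
    and cover: "range a \<subseteq> Ea" "range b \<subseteq> Eb" "incseq a" "incseq b" "(\<Union>i. a i) = UNIV" "(\<Union>i. b i) = UNIV"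
    and finite: "\<And>i. emeasure P (a i \<times> b i) \<noteq> \<infinity>"
    and eq: "\<And>A B. A \<in> Ea \<Longrightarrow> B \<in> Eb \<Longrightarrow> emeasure P (A \<times> B) = emeasure Q (A \<times> B)"
  shows "P = Q"
proof (rule measure_eqI_generator_eq[where E="{A \<times> B | A B. A \<in> Ea \<and> B \<in> Eb}" and \<Omega>=UNIV and A="\<lambda>i. a i \<times> b i"])
  show "Int_stable {A \<times> B | A B. A \<in> Ea \<and> B \<in> Eb}"
  proof (rule Int_stableI)
    fix C D assume "C \<in> {A \<times> B | A B. A \<in> Ea \<and> B \<in> Eb}" "D \<in> {A \<times> B | A B. A \<in> Ea \<and> B \<in> Eb}"
    then obtain A1 B1 A2 B2 where "C = A1 \<times> B1" "A1 \<in> Ea" "B1 \<in> Eb" "D = A2 \<times> B2" "A2 \<in> Ea" "B2 \<in> Eb"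
      by blast
    then have "C \<inter> D = (A1 \<inter> A2) \<times> (B1 \<inter> B2)" "A1 \<inter> A2 \<in> Ea" "B1 \<inter> B2 \<in> Eb"
      using stable by (auto simp: Times_Int_Times Int_stable_def)
    then show "C \<inter> D \<in> {A \<times> B | A B. A \<in> Ea \<and> B \<in> Eb}" by blast
  qed
  have "sets (borel \<Otimes>\<^sub>M borel :: (real \<times> real) measure)
      = sets (sigma (space borel \<times> space borel) {A \<times> B | A B. A \<in> Ea \<and> B \<in> Eb})"
    by (rule sets_pair_eq[of _ _ "range a" _ _ "range b"])
       (use gen cover in auto)
  then have "sets (borel \<Otimes>\<^sub>M borel :: (real \<times> real) measure) = sigma_sets UNIV {A \<times> B | A B. A \<in> Ea \<and> B \<in> Eb}"
    by simp
  then show "sets P = sigma_sets UNIV {A \<times> B | A B. A \<in> Ea \<and> B \<in> Eb}"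
    "sets Q = sigma_sets UNIV {A \<times> B | A B. A \<in> Ea \<and> B \<in> Eb}"
    unfolding sets by auto
  show "(\<Union>i. a i \<times> b i) = UNIV"
  proof (intro set_eqI iffI UNIV_I)
    fix z :: "real \<times> real"
    obtain x y where z: "z = (x, y)" by force
    have "x \<in> (\<Union>i. a i)" unfolding cover(5) by (rule UNIV_I)
    then obtain i where i: "x \<in> a i" by (rule UN_E)
    have "y \<in> (\<Union>i. b i)" unfolding cover(6) by (rule UNIV_I)
    then obtain j where j: "y \<in> b j" by (rule UN_E)
    have "a i \<subseteq> a (max i j)" "b j \<subseteq> b (max i j)"
      by (rule incseqD[OF cover(3)], simp, rule incseqD[OF cover(4)], simp)
    then have "z \<in> a (max i j) \<times> b (max i j)" using i j z by blast
    then show "z \<in> (\<Union>i. a i \<times> b i)" by blast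
  qed
  show "range (\<lambda>i. a i \<times> b i) \<subseteq> {A \<times> B | A B. A \<in> Ea \<and> B \<in> Eb}"
    using cover(1,2) by blast
qed (use eq finite in auto)

lemma incseq_atMost_real: "incseq (\<lambda>i. {..real i})" "(\<Union>i. {..real i}) = UNIV"
proof -
  have "\<exists>i. x \<le> real i" for x by (rule real_arch_simple)
  then show "(\<Union>i. {..real i}) = UNIV" by blast
qed (auto simp: incseq_def)

lemma incseq_lessThan_real: "incseq (\<lambda>i. {..<real i})" "(\<Union>i. {..<real i}) = UNIV"
proof -
  have "\<exists>i. x < real i" for x by (rule reals_Archimedean2)
  then show "(\<Union>i. {..<real i}) = UNIV" by blast
qed (auto simp: incseq_def)

lemma incseq_greaterThan_real: "incseq (\<lambda>i. {- real i<..})" "(\<Union>i. {- real i<..}) = UNIV"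
proof -
  show "incseq (\<lambda>i. {- real i<..})" by (auto simp: incseq_def)
  have "\<exists>i. - real i < x" for x
    using reals_Archimedean2[of "- x"] by (auto simp: minus_less_iff)
  then show "(\<Union>i. {- real i<..}) = UNIV" by auto
qed

lemma Int_stable_rays:
  "Int_stable (range (atMost :: real \<Rightarrow> _))" "Int_stable (range (lessThan :: real \<Rightarrow> _))"
  "Int_stable (range (greaterThan :: real \<Rightarrow> _))"
proof -
  have "{..a} \<inter> {..b} = {..min a b}" "{..<a} \<inter> {..<b} = {..<min a b}" "{a<..} \<inter> {b<..} = {max a b<..}" for a b :: real
    by auto
  then show "Int_stable (range (atMost :: real \<Rightarrow> _))" "Int_stable (range (lessThan :: real \<Rightarrow> _))"
    "Int_stable (range (greaterThan :: real \<Rightarrow> _))"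
    unfolding Int_stable_def by blast+
qed

lemma sigma_rays:
  "sets borel = sigma_sets UNIV (range (atMost :: real \<Rightarrow> _))"
  "sets borel = sigma_sets UNIV (range (lessThan :: real \<Rightarrow> _))"
  "sets borel = sigma_sets UNIV (range (greaterThan :: real \<Rightarrow> _))"
proof -
  have *: "sets (borel :: real measure) = sigma_sets UNIV E" if "borel = sigma UNIV E" for E
    unfolding that by (rule sets_measure_of) auto
  show "sets borel = sigma_sets UNIV (range (atMost :: real \<Rightarrow> _))" by (rule *) (rule borel_eq_atMost)
  show "sets borel = sigma_sets UNIV (range (lessThan :: real \<Rightarrow> _))" by (rule *) (rule borel_Iio)
  show "sets borel = sigma_sets UNIV (range (greaterThan :: real \<Rightarrow> _))" by (rule *) (rule borel_Ioi)
qed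

text \<open>The derivative of \<open>x \<mapsto> Phi x + Phi (- x)\<close> vanishes, and its limit at infinity is \<open>1\<close>.\<close>

lemma Phi_minus: "Phi x + Phi (- x) = 1"
proof -
  have "((\<lambda>x. Phi x + Phi (- x)) has_real_derivative 0) (at x)" for x
    by (auto intro!: derivative_eq_intros simp: normal_density_def)
  then have const: "Phi y + Phi (- y) = Phi x + Phi (- x)" for y
    by (intro DERIV_isconst_all) auto
  have "((\<lambda>y. Phi y + Phi (- y)) \<longlongrightarrow> 1 + 0) at_top"
    by (intro tendsto_add Phi_at_top filterlim_compose[OF Phi_at_bot] filterlim_uminus_at_bot_at_top)
  moreover have "(\<lambda>y. Phi y + Phi (- y)) = (\<lambda>_. Phi x + Phi (- x))"
    using const by blast
  ultimately have "((\<lambda>_::real. Phi x + Phi (- x)) \<longlongrightarrow> 1) at_top"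
    by simp
  then show ?thesis by (simp add: tendsto_const_iff)
qed

lemma Phi_0: "2 * Phi 0 = 1"
  using Phi_minus[of 0] by simp

lemma gauss_atMost:
  assumes "0 < t"
  shows "(\<integral>\<^sup>+x. ennreal (gauss t x) * indicator {..c} x \<partial>lborel) = ennreal (Phi (c / sqrt t))"
proof -
  interpret real_distribution std_normal_distribution by (rule real_dist_normal_dist)
  have "(\<integral>\<^sup>+x. ennreal (gauss t x) * indicator {..c} x \<partial>lborel)
    = ennreal (sqrt t) * (\<integral>\<^sup>+x. ennreal (gauss t (0 + sqrt t * x)) * indicator {..c} (0 + sqrt t * x) \<partial>lborel)"
    using assms by (subst nn_integral_real_affine[where c="sqrt t" and t=0]) auto
  also have "\<dots> = (\<integral>\<^sup>+x. ennreal (sqrt t) * (ennreal (gauss t (0 + sqrt t * x)) * indicator {..c} (0 + sqrt t * x)) \<partial>lborel)"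
    by (rule nn_integral_cmult[symmetric]) measurable
  also have "\<dots> = (\<integral>\<^sup>+x. ennreal (std_gauss x) * indicator {..c / sqrt t} x \<partial>lborel)"
  proof (rule nn_integral_cong)
    fix x
    have "sqrt t * gauss t (sqrt t * x) = std_gauss x"
      using assms by (simp add: gauss_scale)
    moreover have "sqrt t * x \<le> c \<longleftrightarrow> x \<le> c / sqrt t"
      using assms by (simp add: le_divide_eq mult.commute)
    ultimately show "ennreal (sqrt t) * (ennreal (gauss t (0 + sqrt t * x)) * indicator {..c} (0 + sqrt t * x))
      = ennreal (std_gauss x) * indicator {..c / sqrt t} x"
      by (auto split: split_indicator simp: ennreal_mult'[symmetric] assms less_imp_le)
  qed
  also have "\<dots> = emeasure std_normal_distribution {..c / sqrt t}"
    by (simp add: emeasure_density)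
  also have "\<dots> = ennreal (Phi (c / sqrt t))"
    by (simp add: Phi_def cdf_def emeasure_eq_measure)
  finally show ?thesis .
qed

lemma emeasure_distr_on_event:
  assumes [measurable]: "Q \<in> sets M" "f \<in> measurable M N" "A \<in> sets N"
  shows "emeasure (distr (density M (indicator Q)) N f) A = emeasure M ({\<omega> \<in> space M. f \<omega> \<in> A} \<inter> Q)"
proof -
  have "emeasure (distr (density M (indicator Q)) N f) A = (\<integral>\<^sup>+\<omega>. indicator Q \<omega> * indicator (f -` A \<inter> space M) \<omega> \<partial>M)"
    by (subst emeasure_distr) (auto simp: emeasure_density)
  also have "\<dots> = (\<integral>\<^sup>+\<omega>. indicator ({\<omega> \<in> space M. f \<omega> \<in> A} \<inter> Q) \<omega> \<partial>M)"
    by (intro nn_integral_cong) (auto split: split_indicator)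
  finally show ?thesis by simp
qed

context continuous_brownian_motion
begin

lemma emeasure_X: "0 < t \<Longrightarrow> A \<in> sets borel \<Longrightarrow>
    emeasure M {\<omega> \<in> space M. X t \<omega> \<in> A} = (\<integral>\<^sup>+x. ennreal (gauss t x) * indicator A x \<partial>lborel)"
proof -
  assume "0 < t" "A \<in> sets borel"
  moreover have "{\<omega> \<in> space M. X t \<omega> \<in> A} = X t -` A \<inter> space M" by auto
  ultimately show ?thesis using distributed_emeasure[OF X_distributed, of t A] by simp
qed

lemma prob_X_eq_0: "0 < t \<Longrightarrow> prob {\<omega> \<in> space M. X t \<omega> = c} = 0"
proof -
  assume "0 < t"
  then have "emeasure M {\<omega> \<in> space M. X t \<omega> \<in> {c}} = (\<integral>\<^sup>+x. ennreal (gauss t x) * indicator {c} x \<partial>lborel)"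
    by (intro emeasure_X) auto
  also have "\<dots> = 0" by (subst nn_integral_0_iff_AE) (auto intro!: AE_I[where N="{c}"] split: split_indicator_asm)
  finally show ?thesis by (simp add: measure_def)
qed

lemma AE_X_neq: "0 < t \<Longrightarrow> AE \<omega> in M. X t \<omega> \<noteq> c"
proof -
  assume t: "0 < t"
  have [measurable]: "X t \<in> borel_measurable M" using t by (intro measurable_X) auto
  show ?thesis using prob_X_eq_0[OF t, of c] by (subst AE_iff_measurable[OF _ refl]) (auto simp: emeasure_eq_measure)
qed

lemma prob_X_le: "0 < t \<Longrightarrow> prob {\<omega> \<in> space M. X t \<omega> \<le> c} = Phi (c / sqrt t)"
proof -
  assume "0 < t"
  then have "emeasure M {\<omega> \<in> space M. X t \<omega> \<in> {..c}} = ennreal (Phi (c / sqrt t))"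
    by (subst emeasure_X) (auto simp: gauss_atMost)
  moreover have "0 \<le> Phi (c / sqrt t)" by (simp add: Phi_def cdf_def)
  ultimately show ?thesis by (simp add: emeasure_eq_measure)
qed

lemma prob_below_and_less:
  assumes "0 < s" "0 \<le> a" "x \<le> a"
  shows "prob {\<omega> \<in> space M. (\<forall>u\<in>{0..s}. X u \<omega> \<le> a) \<and> X s \<omega> < x}
    = prob {\<omega> \<in> space M. X s \<omega> < x} - prob {\<omega> \<in> space M. 2 * a - x < X s \<omega>}"
proof -
  have [measurable]: "X s \<in> borel_measurable M" using assms by (intro measurable_X) auto
  let ?E = "{\<omega> \<in> space M. (\<exists>u\<in>{0..s}. a < X u \<omega>) \<and> X s \<omega> < x}"
  have "?E = {\<omega> \<in> space M. \<exists>u\<in>{0..s}. a < X u \<omega>} \<inter> {\<omega> \<in> space M. X s \<omega> < x}" by auto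
  also have "\<dots> \<in> events" using exceed_sets[OF assms(1), of a] by (intro sets.Int) auto
  finally have E: "?E \<in> events" .
  have "{\<omega> \<in> space M. (\<forall>u\<in>{0..s}. X u \<omega> \<le> a) \<and> X s \<omega> < x} = {\<omega> \<in> space M. X s \<omega> < x} - ?E"
    by (auto simp: not_less)
  then show ?thesis
    using E reflection_principle[OF assms] by (simp add: finite_measure_Diff subset_eq)
qed

text \<open>The case \<open>x = a = c\<close> of the reflection principle, together with the symmetry of the Gaussian law.\<close>

lemma prob_below:
  assumes "0 < t" "0 < c"
  shows "prob (below c t) = 2 * Phi (c / sqrt t) - 1"
proof -
  have [measurable]: "X t \<in> borel_measurable M" using assms by (intro measurable_X) auto
  have B[measurable]: "below c t \<in> events" using below_sets assms by auto
  have "{\<omega> \<in> space M. (\<forall>u\<in>{0..t}. X u \<omega> \<le> c) \<and> X t \<omega> < c}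
      = below c t \<inter> {\<omega> \<in> space M. X t \<omega> < c}" by auto
  also have "\<dots> \<in> events" by measurable
  finally have B': "{\<omega> \<in> space M. (\<forall>u\<in>{0..t}. X u \<omega> \<le> c) \<and> X t \<omega> < c} \<in> events" .
  have "prob (below c t) = prob {\<omega> \<in> space M. (\<forall>u\<in>{0..t}. X u \<omega> \<le> c) \<and> X t \<omega> < c}"
    using AE_X_neq[OF assms(1), of c] assms
    by (intro finite_measure_eq_AE B B') (force elim!: eventually_mono simp: order.order_iff_strict)
  also have "\<dots> = prob {\<omega> \<in> space M. X t \<omega> < c} - prob {\<omega> \<in> space M. c < X t \<omega>}"
    using prob_below_and_less[of t c c] assms by simp
  also have "prob {\<omega> \<in> space M. X t \<omega> < c} = prob {\<omega> \<in> space M. X t \<omega> \<le> c}"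
    using AE_X_neq[OF assms(1), of c]
    by (intro finite_measure_eq_AE) (auto elim!: eventually_mono)
  also have "prob {\<omega> \<in> space M. c < X t \<omega>} = 1 - prob {\<omega> \<in> space M. X t \<omega> \<le> c}"
  proof -
    have "{\<omega> \<in> space M. c < X t \<omega>} = space M - {\<omega> \<in> space M. X t \<omega> \<le> c}" by auto
    then show ?thesis by (simp add: prob_compl)
  qed
  finally show ?thesis using assms by (simp add: prob_X_le)
qed

lemma emeasure_below:
  assumes "0 < t" "0 < c"
  shows "emeasure M (below c t)
    = (\<integral>\<^sup>+v. ennreal (hit_density c v) * indicator {t<..} v \<partial>lborel)"
  using assms by (simp add: emeasure_eq_measure prob_below hit_density_tail Phi_0)

text \<open>Both measures are compared on the rays \<open>{..<x}\<close>. For \<open>x > 1\<close> the ray may be cut off at \<open>1\<close>: the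
  density vanishes beyond \<open>1\<close>, and a path that stays below \<open>1\<close> ends below \<open>1\<close> almost surely.\<close>

lemma killed_law:
  assumes "0 < s"
  shows "distr (density M (indicator (below 1 s))) borel (X s)
    = density lborel (\<lambda>x. ennreal (killed_gauss s x) * indicator {..<1} x)"
proof -
  define Q where "Q = below 1 s"
  let ?L = "distr (density M (indicator Q)) borel (X s)"
  let ?R = "density lborel (\<lambda>x. ennreal (killed_gauss s x) * indicator {..<1} x)"
  have X[measurable]: "X s \<in> borel_measurable M" using assms by (intro measurable_X) auto
  have Q[measurable]: "Q \<in> events" unfolding Q_def using below_sets assms by auto
  have "?L = ?R"
  proof (rule measure_eqI_generator_eq[where E="range lessThan" and \<Omega>=UNIV and A="\<lambda>i. {..<real i}"])
    have [measurable]: "killed_gauss s \<in> borel_measurable borel"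
      unfolding killed_gauss_def by measurable
    have L: "emeasure ?L A = emeasure M (Q \<inter> {\<omega> \<in> space M. X s \<omega> \<in> A})" if "A \<in> sets borel" for A
      using that by (subst emeasure_distr_on_event) (auto simp: Int_commute)
    show "emeasure ?L {..<real i} \<noteq> \<infinity>" for i
      by (subst L) (auto simp: less_top[symmetric] emeasure_eq_measure)
    fix A :: "real set" assume "A \<in> range lessThan"
    then obtain x where A: "A = {..<x}" by auto
    define b where "b = min x 1"
    let ?g1 = "\<integral>\<^sup>+z. ennreal (gauss s z) * indicator {..<b} z \<partial>lborel"
      and ?g2 = "\<integral>\<^sup>+z. ennreal (gauss s (2 - z)) * indicator {..<b} z \<partial>lborel"
    have "emeasure ?L A = emeasure M (Q \<inter> {\<omega> \<in> space M. X s \<omega> \<in> A})"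
      by (rule L) (simp add: A)
    also have "\<dots> = emeasure M (Q \<inter> {\<omega> \<in> space M. X s \<omega> < b})"
    proof (rule emeasure_eq_AE)
      have "X s \<omega> \<le> 1" if "\<omega> \<in> Q" for \<omega>
        using that assms by (auto simp: Q_def)
      then show "AE \<omega> in M. \<omega> \<in> Q \<inter> {\<omega> \<in> space M. X s \<omega> \<in> A} \<longleftrightarrow> \<omega> \<in> Q \<inter> {\<omega> \<in> space M. X s \<omega> < b}"
        using AE_X_neq[OF assms, of 1]
        by (auto elim!: eventually_mono simp: A b_def less_le)
    qed (auto simp: A)
    also have "Q \<inter> {\<omega> \<in> space M. X s \<omega> < b} = {\<omega> \<in> space M. (\<forall>u\<in>{0..s}. X u \<omega> \<le> 1) \<and> X s \<omega> < b}"
      by (auto simp: Q_def)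
    also have "emeasure M \<dots> = ennreal (prob {\<omega> \<in> space M. X s \<omega> < b} - prob {\<omega> \<in> space M. 2 - b < X s \<omega>})"
      using prob_below_and_less[of s 1 b] assms by (simp add: emeasure_eq_measure b_def)
    also have "\<dots> = emeasure M {\<omega> \<in> space M. X s \<omega> \<in> {..<b}} - emeasure M {\<omega> \<in> space M. X s \<omega> \<in> {2 - b<..}}"
      by (simp add: emeasure_eq_measure ennreal_minus)
    also have "\<dots> = ?g1 - ?g2"
    proof -
      have "(\<integral>\<^sup>+z. ennreal (gauss s z) * indicator {2 - b<..} z \<partial>lborel)
        = ennreal \<bar>- 1\<bar> * (\<integral>\<^sup>+z. ennreal (gauss s (2 + (- 1) * z)) * indicator {2 - b<..} (2 + (- 1) * z) \<partial>lborel)"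
        by (rule nn_integral_real_affine) auto
      also have "\<dots> = ?g2"
        by (auto intro!: nn_integral_cong split: split_indicator)
      finally have r: "(\<integral>\<^sup>+z. ennreal (gauss s z) * indicator {2 - b<..} z \<partial>lborel)
        = ?g2" .
      show ?thesis
        by (subst (1 2) emeasure_X[OF assms]) (simp_all add: r)
    qed
    also have "\<dots> = (\<integral>\<^sup>+z. ennreal (gauss s z) * indicator {..<b} z - ennreal (gauss s (2 - z)) * indicator {..<b} z \<partial>lborel)"
    proof (rule nn_integral_diff[symmetric])
      have le: "ennreal (gauss s (2 - z)) * indicator {..<b} z \<le> ennreal (gauss s z) * indicator {..<b} z" for z
      proof (cases "z < b")
        case True
        then have "gauss s (2 - z) \<le> gauss s z"
          using killed_gauss_nonneg[OF assms, of z] by (simp add: killed_gauss_def b_def)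
        then show ?thesis by (intro mult_right_mono ennreal_leI) auto
      qed simp
      then show "AE z in lborel. ennreal (gauss s (2 - z)) * indicator {..<b} z \<le> ennreal (gauss s z) * indicator {..<b} z"
        by (intro AE_I2)
      have "?g2 \<le> ?g1"
        by (intro nn_integral_mono le)
      also have "\<dots> = emeasure M {\<omega> \<in> space M. X s \<omega> \<in> {..<b}}" using assms by (subst emeasure_X) auto
      finally show "?g2 \<noteq> \<infinity>"
        by (auto simp: emeasure_eq_measure top_unique)
    qed auto
    also have "\<dots> = (\<integral>\<^sup>+z. ennreal (killed_gauss s z) * indicator {..<1} z * indicator A z \<partial>lborel)"
    proof (rule nn_integral_cong)
      fix z
      show "ennreal (gauss s z) * indicator {..<b} z - ennreal (gauss s (2 - z)) * indicator {..<b} z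
        = ennreal (killed_gauss s z) * indicator {..<1} z * indicator A z"
        by (cases "z < b") (auto simp: killed_gauss_def A b_def ennreal_minus)
    qed
    also have "\<dots> = emeasure ?R A" by (subst emeasure_density) (auto simp: A)
    finally show "emeasure ?L A = emeasure ?R A" .
  qed (use sigma_rays incseq_lessThan_real in \<open>auto simp: Int_stable_rays\<close>)
  then show ?thesis unfolding Q_def .
qed

end

section \<open>Independence of past and future\<close>

lemma eventually_grid_below:
  fixes f :: "real \<Rightarrow> real"
  assumes "continuous_on {0..s} f" and "0 < s"
  shows "eventually (\<lambda>n. (\<forall>k\<le>Suc n. f (s * k / Suc n) \<le> a) \<longleftrightarrow> (\<forall>u\<in>{0..s}. f u \<le> a)) sequentially"
proof -
  have iff: "(\<forall>k\<le>m. g k \<le> a) = (\<not> (\<exists>k\<le>m. a < g k))" "(\<forall>u\<in>{0..s}. f u \<le> a) = (\<not> (\<exists>u\<in>{0..s}. a < f u))"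
    for g :: "nat \<Rightarrow> real" and m
    by (auto simp: not_less)
  show ?thesis
    using eventually_grid_exceeds[OF assms, of a]
    by (rule eventually_mono) (simp only: iff)
qed

context continuous_brownian_motion
begin

text \<open>On a grid of \<open>[0, s]\<close> continued by a grid of \<open>[s, s + t]\<close>, the two events are determined by disjoint
  blocks of independent increments. Both grids are refined simultaneously.\<close>

lemma prob_past_future:
  assumes "0 < s" "0 < t"
  shows "prob {\<omega> \<in> space M. ((\<forall>u\<in>{0..s}. X u \<omega> \<le> a) \<and> X s \<omega> \<le> x) \<and> (\<forall>v\<in>{0..t}. X (s + v) \<omega> - X s \<omega> \<le> c)}
    = prob {\<omega> \<in> space M. (\<forall>u\<in>{0..s}. X u \<omega> \<le> a) \<and> X s \<omega> \<le> x}
      * prob {\<omega> \<in> space M. \<forall>v\<in>{0..t}. X (s + v) \<omega> - X s \<omega> \<le> c}"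
proof -
  interpret S: continuous_brownian_motion M "\<lambda>v \<omega>. X (s + v) \<omega> - X s \<omega>"
    using assms by (intro shift) auto
  let ?E = "\<lambda>n. {\<omega> \<in> space M. (\<forall>k\<le>Suc n. X (s * k / Suc n) \<omega> \<le> a) \<and> X s \<omega> \<le> x}"
  let ?F = "\<lambda>n. {\<omega> \<in> space M. \<forall>k\<le>Suc n. X (s + t * k / Suc n) \<omega> - X s \<omega> \<le> c}"
  let ?E' = "{\<omega> \<in> space M. (\<forall>u\<in>{0..s}. X u \<omega> \<le> a) \<and> X s \<omega> \<le> x}"
  let ?F' = "{\<omega> \<in> space M. \<forall>v\<in>{0..t}. X (s + v) \<omega> - X s \<omega> \<le> c}"
  have [measurable]: "X (s * k / Suc n) \<in> borel_measurable M" "X (s + t * k / Suc n) \<in> borel_measurable M"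
    "X s \<in> borel_measurable M" for k n :: nat
    using assms by (auto intro!: measurable_X)
  have E: "?E n \<in> events" and F: "?F n \<in> events" for n by measurable
  have evE: "eventually (\<lambda>n. \<omega> \<in> ?E n \<longleftrightarrow> \<omega> \<in> ?E') sequentially" for \<omega>
    using eventually_grid_below[OF cont_Icc[of s \<omega>] assms(1), of a] assms
    by (auto elim!: eventually_mono)
  have evF: "eventually (\<lambda>n. \<omega> \<in> ?F n \<longleftrightarrow> \<omega> \<in> ?F') sequentially" for \<omega>
    using eventually_grid_below[OF S.cont_Icc[of t \<omega>] assms(2), of c] assms
    by (auto elim!: eventually_mono)
  have prod: "prob (?E n \<inter> ?F n) = prob (?E n) * prob (?F n)" for n
  proof -
    define N where "N = Suc n"
    define \<tau> where "\<tau> = (\<lambda>i::nat. if i \<le> N then s * i / N else s + t * real (i - N) / N)"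
    define \<xi> where "\<xi> = (\<lambda>i \<omega>. X (\<tau> (Suc i)) \<omega> - X (\<tau> i) \<omega>)"
    have N: "0 < N" by (simp add: N_def)
    let ?PA = "PiM {..<N} (\<lambda>_. borel :: real measure)" and ?PB = "PiM {N..<N + N} (\<lambda>_. borel :: real measure)"
    let ?VA = "\<lambda>\<omega>. \<lambda>i\<in>{..<N}. \<xi> i \<omega>" and ?VB = "\<lambda>\<omega>. \<lambda>i\<in>{N..<N + N}. \<xi> i \<omega>"
    have \<tau>_past: "\<tau> k = s * k / N" if "k \<le> N" for k using that by (simp add: \<tau>_def)
    have \<tau>_future: "\<tau> (N + k) = s + t * k / N" for k using N by (simp add: \<tau>_def)
    have mono: "\<tau> i \<le> \<tau> (Suc i)" for i
    proof (cases "i < N")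
      case True
      then show ?thesis using assms by (simp add: \<tau>_past divide_right_mono mult_left_mono)
    next
      case False
      then obtain k where "i = N + k" using le_Suc_ex not_less by blast
      then show ?thesis using assms \<tau>_future[of k] \<tau>_future[of "Suc k"]
        by (simp add: divide_right_mono mult_left_mono)
    qed
    have "indep_vars (\<lambda>_. borel) \<xi> {..<N + N}"
      unfolding \<xi>_def by (rule indep_increments) (use mono \<tau>_past[of 0] in auto)
    then have ind: "indep_var ?PA ?VA
        ?PB ?VB"
      by (rule indep_var_restrict) auto
    define CA where "CA = {f \<in> space ?PA. (\<forall>k\<le>N. (\<Sum>i<k. f i) \<le> a) \<and> (\<Sum>i<N. f i) \<le> x}"
    define CB where "CB = {f \<in> space ?PB. \<forall>k\<le>N. (\<Sum>i\<in>{N..<N + k}. f i) \<le> c}"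
    have mA: "(\<lambda>f. \<Sum>i<k. f i) \<in> borel_measurable ?PA" if "k \<le> N" for k
      using that by (intro borel_measurable_sum measurable_component_singleton) auto
    have mB: "(\<lambda>f. \<Sum>i\<in>{N..<N + k}. f i) \<in> borel_measurable ?PB" if "k \<le> N" for k
      using that by (intro borel_measurable_sum measurable_component_singleton) auto
    have CA: "CA \<in> sets ?PA"
    proof -
      have "CA = (\<Inter>k\<in>{..N}. {f \<in> space ?PA. (\<Sum>i<k. f i) \<le> a})
          \<inter> {f \<in> space ?PA. (\<Sum>i<N. f i) \<le> x}"
        by (auto simp: CA_def)
      also have "\<dots> \<in> sets ?PA"
        using mA by (intro sets.Int sets.finite_INT borel_measurable_le) auto
      finally show ?thesis .
    qed
    have CB: "CB \<in> sets ?PB"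
    proof -
      have "CB = (\<Inter>k\<in>{..N}. {f \<in> space ?PB. (\<Sum>i\<in>{N..<N + k}. f i) \<le> c})"
        by (auto simp: CB_def)
      also have "\<dots> \<in> sets ?PB"
        using mB by (intro sets.finite_INT borel_measurable_le) auto
      finally show ?thesis .
    qed
    have sumA: "(\<Sum>i<k. (\<lambda>i\<in>{..<N}. \<xi> i \<omega>) i) = X (s * k / N) \<omega>" if "k \<le> N" for k \<omega>
    proof -
      have "(\<Sum>i<k. (\<lambda>i\<in>{..<N}. \<xi> i \<omega>) i) = (\<Sum>i=0..<k. X (\<tau> (Suc i)) \<omega> - X (\<tau> i) \<omega>)"
        using that by (intro sum.cong) (auto simp: \<xi>_def)
      also have "\<dots> = X (\<tau> k) \<omega> - X (\<tau> 0) \<omega>"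
        using sum_Suc_diff'[of 0 k "\<lambda>i. X (\<tau> i) \<omega>"] by simp
      finally show ?thesis using that by (simp add: \<tau>_past start)
    qed
    have sumB: "(\<Sum>i\<in>{N..<N + k}. (\<lambda>i\<in>{N..<N + N}. \<xi> i \<omega>) i) = X (s + t * k / N) \<omega> - X s \<omega>" if "k \<le> N" for k \<omega>
    proof -
      have "(\<Sum>i\<in>{N..<N + k}. (\<lambda>i\<in>{N..<N + N}. \<xi> i \<omega>) i) = (\<Sum>i=N..<N + k. X (\<tau> (Suc i)) \<omega> - X (\<tau> i) \<omega>)"
        using that by (intro sum.cong) (auto simp: \<xi>_def)
      also have "\<dots> = X (\<tau> (N + k)) \<omega> - X (\<tau> (N + 0)) \<omega>"
        using sum_Suc_diff'[of N "N + k" "\<lambda>i. X (\<tau> i) \<omega>"] by simp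
      finally show ?thesis unfolding \<tau>_future by simp
    qed
    have "?E n = ?VA -` CA \<inter> space M"
      using N by (auto simp: CA_def sumA N_def[symmetric] space_PiM simp del: restrict_apply)
    moreover have "?F n = ?VB -` CB \<inter> space M"
      using N by (auto simp: CB_def sumB N_def[symmetric] space_PiM simp del: restrict_apply)
    moreover have "(\<lambda>\<omega>. (\<lambda>i\<in>{..<N}. \<xi> i \<omega>, \<lambda>i\<in>{N..<N + N}. \<xi> i \<omega>)) -` (CA \<times> CB) \<inter> space M
      = (?VA -` CA \<inter> space M) \<inter> (?VB -` CB \<inter> space M)"
      by auto
    ultimately show ?thesis using indep_varD[OF ind CA CB] by simp
  qed
  have lE: "(\<lambda>n. prob (?E n)) \<longlonglongrightarrow> prob ?E'"
    by (rule prob_tendsto_of_eventually_eq[OF E _ evE]) blast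
  have lF: "(\<lambda>n. prob (?F n)) \<longlonglongrightarrow> prob ?F'"
    by (rule prob_tendsto_of_eventually_eq[OF F _ evF]) blast
  have EF: "?E n \<inter> ?F n \<in> events" for n using E F by (rule sets.Int)
  have evEF: "eventually (\<lambda>n. \<omega> \<in> ?E n \<inter> ?F n \<longleftrightarrow> \<omega> \<in> ?E' \<inter> ?F') sequentially" for \<omega>
    using evE[of \<omega>] evF[of \<omega>] by eventually_elim (simp only: Int_iff)
  have "(\<lambda>n. prob (?E n \<inter> ?F n)) \<longlonglongrightarrow> prob (?E' \<inter> ?F')"
    by (rule prob_tendsto_of_eventually_eq[OF EF _ evEF]) blast
  moreover have "(\<lambda>n. prob (?E n) * prob (?F n)) \<longlonglongrightarrow> prob ?E' * prob ?F'"
    by (intro tendsto_mult lE lF)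
  ultimately have "prob (?E' \<inter> ?F') = prob ?E' * prob ?F'"
    unfolding prod by (rule LIMSEQ_unique)
  moreover have "?E' \<inter> ?F' = {\<omega> \<in> space M. ((\<forall>u\<in>{0..s}. X u \<omega> \<le> a) \<and> X s \<omega> \<le> x) \<and> (\<forall>v\<in>{0..t}. X (s + v) \<omega> - X s \<omega> \<le> c)}"
    by blast
  ultimately show ?thesis by simp
qed

end

text \<open>Independence of two real variables, expressed as a product law, follows from the factorisation of
  their joint distribution function.\<close>

lemma (in prob_space) distr_pair_eq_of_rays:
  fixes Y W :: "'a \<Rightarrow> real"
  assumes [measurable]: "Y \<in> borel_measurable M" "W \<in> borel_measurable M"
    and indep: "\<And>x c. prob {\<omega> \<in> space M. Y \<omega> \<le> x \<and> W \<omega> \<le> c}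
      = prob {\<omega> \<in> space M. Y \<omega> \<le> x} * prob {\<omega> \<in> space M. W \<omega> \<le> c}"
  shows "distr M (borel \<Otimes>\<^sub>M borel) (\<lambda>\<omega>. (Y \<omega>, W \<omega>)) = distr M borel Y \<Otimes>\<^sub>M distr M borel W"
    (is "?L = ?R")
proof (rule measure_eqI_rectangles[where Ea="range atMost" and Eb="range atMost" and a="\<lambda>i. {..real i}" and b="\<lambda>i. {..real i}"])
  interpret Y: prob_space "distr M borel Y" by (rule prob_space_distr) measurable
  interpret W: prob_space "distr M borel W" by (rule prob_space_distr) measurable
  interpret L: prob_space ?L by (rule prob_space_distr) measurable
  show "emeasure ?L ({..real i} \<times> {..real i}) \<noteq> \<infinity>" for i
    by (simp add: L.emeasure_eq_measure)
  fix A B :: "real set" assume "A \<in> range atMost" "B \<in> range atMost"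
  then obtain x c where AB: "A = {..x}" "B = {..c}" by blast
  have "emeasure ?L (A \<times> B) = emeasure M {\<omega> \<in> space M. Y \<omega> \<le> x \<and> W \<omega> \<le> c}"
    by (subst emeasure_distr) (auto simp: AB intro!: arg_cong[where f="emeasure M"])
  also have "\<dots> = ennreal (prob {\<omega> \<in> space M. Y \<omega> \<le> x}) * ennreal (prob {\<omega> \<in> space M. W \<omega> \<le> c})"
    by (simp add: emeasure_eq_measure indep ennreal_mult)
  also have "\<dots> = emeasure (distr M borel Y) A * emeasure (distr M borel W) B"
    by (subst (1 2) emeasure_distr) (auto simp: AB emeasure_eq_measure intro!: arg_cong2[where f="(*)"] arg_cong[where f=ennreal] arg_cong[where f=prob])
  also have "\<dots> = emeasure ?R (A \<times> B)"
    by (rule W.emeasure_pair_measure_Times[symmetric]) (auto simp: AB)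
  finally show "emeasure ?L (A \<times> B) = emeasure ?R (A \<times> B)" .
next
  show "sets ?R = sets (borel \<Otimes>\<^sub>M borel)" by (intro sets_pair_measure_cong) auto
qed (use sigma_rays Int_stable_rays incseq_atMost_real in auto)

context continuous_paths
begin

definition running_max :: "real \<Rightarrow> 'a \<Rightarrow> real" where
  "running_max t \<omega> = (SUP v\<in>{0..t}. X v \<omega>)"

lemma running_max_le_iff:
  assumes "0 \<le> t"
  shows "running_max t \<omega> \<le> c \<longleftrightarrow> (\<forall>v\<in>{0..t}. X v \<omega> \<le> c)"
proof -
  have "compact ((\<lambda>v. X v \<omega>) ` {0..t})"
    using cont_Icc[OF assms] by (intro compact_continuous_image) auto
  then have "bdd_above ((\<lambda>v. X v \<omega>) ` {0..t})"
    by (intro bounded_imp_bdd_above compact_imp_bounded)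
  then show ?thesis
    unfolding running_max_def using assms by (subst cSUP_le_iff) auto
qed

lemma running_max_nonneg: "0 \<le> t \<Longrightarrow> 0 \<le> running_max t \<omega>"
  using running_max_le_iff[of t \<omega> "running_max t \<omega>"] start[of \<omega>] by (auto dest!: bspec[of _ _ 0])

lemma measurable_running_max:
  assumes "0 \<le> t"
  shows "running_max t \<in> borel_measurable M"
proof (cases "t = 0")
  case True
  have "running_max 0 = (\<lambda>_. 0)" unfolding running_max_def by (simp add: start fun_eq_iff)
  then show ?thesis using True by simp
next
  case False
  then show ?thesis
    unfolding borel_measurable_iff_le using below_sets[of t] assms by (simp add: running_max_le_iff)
qed

end

context continuous_brownian_motion
begin

text \<open>The path stays below \<open>1\<close> up to time \<open>s + t\<close> iff it does so up to time \<open>s\<close> and the maximum \<open>W\<close> of the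
  increments after \<open>s\<close> is at most \<open>1 - X s\<close>. The past enters only through one real variable \<open>Y\<close>,
  independent of \<open>W\<close>, so the probability is an integral of the law of \<open>W\<close> against that of \<open>Y\<close>.\<close>

lemma emeasure_X_below:
  assumes "0 < s" "0 < t" and A[measurable]: "A \<in> sets borel"
  shows "emeasure M {\<omega> \<in> space M. X s \<omega> \<in> A \<and> (\<forall>u\<in>{0..s + t}. X u \<omega> \<le> 1)}
    = (\<integral>\<^sup>+x. ennreal (killed_gauss s x) * indicator {..<1} x * indicator A x *
        (\<integral>\<^sup>+v. ennreal (hit_density (1 - x) v) * indicator {t<..} v \<partial>lborel) \<partial>lborel)"
proof -
  let ?q = "\<lambda>x. (\<integral>\<^sup>+v. ennreal (hit_density (1 - x) v) * indicator {t<..} v \<partial>lborel)"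
  let ?k = "\<lambda>x. ennreal (killed_gauss s x) * indicator {..<1} x"
  interpret S: continuous_brownian_motion M "\<lambda>v \<omega>. X (s + v) \<omega> - X s \<omega>"
    using assms by (intro shift) auto
  have X[measurable]: "X s \<in> borel_measurable M" using assms by (intro measurable_X) auto
  define Q where "Q = below 1 s"
  have Q[measurable]: "Q \<in> events" unfolding Q_def using below_sets assms by auto
  (* The default 2 encodes that the level has been exceeded before time s: since W is nonnegative,
     the condition W <= 1 - Y then fails. *)
  define Y where "Y = (\<lambda>\<omega>. if \<omega> \<in> Q then X s \<omega> else 2)"
  define W where "W = S.running_max t"
  have Y[measurable]: "Y \<in> borel_measurable M" unfolding Y_def by measurable
  have W[measurable]: "W \<in> borel_measurable M" unfolding W_def using assms by (intro S.measurable_running_max) auto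
  have W_le: "W \<omega> \<le> c \<longleftrightarrow> (\<forall>v\<in>{0..t}. X (s + v) \<omega> - X s \<omega> \<le> c)" for \<omega> c
    unfolding W_def using assms by (intro S.running_max_le_iff) auto
  have W_nonneg: "0 \<le> W \<omega>" for \<omega>
    unfolding W_def using assms by (intro S.running_max_nonneg) auto
  define g where "g = (\<lambda>y. emeasure M {\<omega> \<in> space M. W \<omega> \<le> 1 - y})"
  interpret DW: prob_space "distr M borel W" by (rule prob_space_distr) measurable
  have sets_borel_W: "sets (N \<Otimes>\<^sub>M distr M borel W) = sets (N \<Otimes>\<^sub>M borel)" for N :: "real measure"
    by (rule sets_pair_measure_cong) auto
  have g[measurable]: "g \<in> borel_measurable borel"
  proof -
    have "{p. snd p \<le> 1 - fst p} \<in> sets (borel \<Otimes>\<^sub>M distr M borel W)"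
      unfolding sets_borel_W by (rule Collect_pair_sets) measurable
    then have "(\<lambda>y. emeasure (distr M borel W) (Pair y -` {p. snd p \<le> 1 - fst p})) \<in> borel_measurable borel"
      by (rule DW.measurable_emeasure_Pair)
    moreover have "emeasure (distr M borel W) (Pair y -` {p. snd p \<le> 1 - fst p}) = g y" for y
      by (subst emeasure_distr) (auto simp: g_def vimage_def intro!: arg_cong[where f="emeasure M"])
    ultimately show ?thesis by (simp only:)
  qed
  have joint: "distr M (borel \<Otimes>\<^sub>M borel) (\<lambda>\<omega>. (Y \<omega>, W \<omega>)) = distr M borel Y \<Otimes>\<^sub>M distr M borel W"
  proof (rule distr_pair_eq_of_rays)
    fix x c
    show "prob {\<omega> \<in> space M. Y \<omega> \<le> x \<and> W \<omega> \<le> c} = prob {\<omega> \<in> space M. Y \<omega> \<le> x} * prob {\<omega> \<in> space M. W \<omega> \<le> c}"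
    proof (cases "x < 2")
      case True
      then have "Y \<omega> \<le> x \<longleftrightarrow> (\<forall>u\<in>{0..s}. X u \<omega> \<le> 1) \<and> X s \<omega> \<le> x" if "\<omega> \<in> space M" for \<omega>
        using that by (auto simp: Y_def Q_def)
      then show ?thesis
        using prob_past_future[OF assms(1,2), of 1 x c] by (simp add: W_le cong: conj_cong)
    next
      case False
      have "Y \<omega> \<le> x" if "\<omega> \<in> space M" for \<omega>
      proof (cases "\<omega> \<in> Q")
        case True
        then have "X s \<omega> \<le> 1" using assms by (auto simp: Q_def)
        then show ?thesis using True False by (simp add: Y_def)
      qed (use False in \<open>simp add: Y_def\<close>)
      then show ?thesis by (simp add: prob_space cong: conj_cong)
    qed
  qed measurable
  have below_iff: "X s \<omega> \<in> A \<and> (\<forall>u\<in>{0..s + t}. X u \<omega> \<le> 1) \<longleftrightarrow> Y \<omega> \<in> A \<and> W \<omega> \<le> 1 - Y \<omega>"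
    if \<omega>: "\<omega> \<in> space M" for \<omega>
  proof (cases "\<omega> \<in> Q")
    case True
    have "(\<forall>u\<in>{0..s + t}. X u \<omega> \<le> 1) \<longleftrightarrow> (\<forall>v\<in>{0..t}. X (s + v) \<omega> \<le> 1)"
    proof
      assume "\<forall>u\<in>{0..s + t}. X u \<omega> \<le> 1"
      then show "\<forall>v\<in>{0..t}. X (s + v) \<omega> \<le> 1" using assms by auto
    next
      assume R: "\<forall>v\<in>{0..t}. X (s + v) \<omega> \<le> 1"
      show "\<forall>u\<in>{0..s + t}. X u \<omega> \<le> 1"
      proof
        fix u assume "u \<in> {0..s + t}"
        then show "X u \<omega> \<le> 1" using R[rule_format, of "u - s"] True by (cases "u \<le> s") (auto simp: Q_def)
      qed
    qed
    also have "\<dots> \<longleftrightarrow> W \<omega> \<le> 1 - X s \<omega>" unfolding W_le by (auto simp: algebra_simps)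
    finally show ?thesis using True by (simp add: Y_def)
  next
    case False
    then have "\<not> (\<forall>u\<in>{0..s + t}. X u \<omega> \<le> 1)" using assms \<omega> by (force simp: Q_def)
    moreover have "\<not> W \<omega> \<le> 1 - Y \<omega>" using W_nonneg[of \<omega>] False by (simp add: Y_def)
    ultimately show ?thesis by blast
  qed
  define S where "S = {p. fst p \<in> A \<and> snd p \<le> 1 - fst p}"
  have S: "S \<in> sets (borel \<Otimes>\<^sub>M (borel :: real measure))"
    unfolding S_def by (rule Collect_pair_sets) measurable
  have "{\<omega> \<in> space M. X s \<omega> \<in> A \<and> (\<forall>u\<in>{0..s + t}. X u \<omega> \<le> 1)} = (\<lambda>\<omega>. (Y \<omega>, W \<omega>)) -` S \<inter> space M"
    using below_iff unfolding S_def by auto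
  then have "emeasure M {\<omega> \<in> space M. X s \<omega> \<in> A \<and> (\<forall>u\<in>{0..s + t}. X u \<omega> \<le> 1)}
    = emeasure (distr M (borel \<Otimes>\<^sub>M borel) (\<lambda>\<omega>. (Y \<omega>, W \<omega>))) S"
    using S by (subst emeasure_distr) auto
  also have "\<dots> = (\<integral>\<^sup>+y. emeasure (distr M borel W) (Pair y -` S) \<partial>distr M borel Y)"
    unfolding joint
  proof (rule DW.emeasure_pair_measure_alt)
    have "sets (distr M borel Y \<Otimes>\<^sub>M distr M borel W) = sets (borel \<Otimes>\<^sub>M borel)"
      by (intro sets_pair_measure_cong) auto
    with S show "S \<in> sets (distr M borel Y \<Otimes>\<^sub>M distr M borel W)" by simp
  qed
  also have "\<dots> = (\<integral>\<^sup>+y. indicator A y * g y \<partial>distr M borel Y)"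
  proof (rule nn_integral_cong)
    fix y
    have "Pair y -` S = (if y \<in> A then {..1 - y} else {})"
      by (auto simp: S_def)
    moreover have "emeasure (distr M borel W) {..1 - y} = g y"
      by (subst emeasure_distr) (auto simp: g_def intro!: arg_cong[where f="emeasure M"])
    ultimately show "emeasure (distr M borel W) (Pair y -` S) = indicator A y * g y"
      by simp
  qed
  also have "\<dots> = (\<integral>\<^sup>+\<omega>. indicator A (Y \<omega>) * g (Y \<omega>) \<partial>M)"
  proof (rule nn_integral_distr)
    show "(\<lambda>y. indicator A y * g y) \<in> borel_measurable (distr M borel Y)"
      by measurable
  qed measurable
  also have "\<dots> = (\<integral>\<^sup>+\<omega>. indicator Q \<omega> * (indicator A (X s \<omega>) * g (X s \<omega>)) \<partial>M)"
  proof (rule nn_integral_cong)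
    fix \<omega>
    have "{\<omega> \<in> space M. W \<omega> \<le> 1 - 2} = {}" using W_nonneg by (auto simp: not_le intro: less_le_trans[of _ 0])
    then have "g 2 = 0" unfolding g_def by (simp only: emeasure_empty)
    then show "indicator A (Y \<omega>) * g (Y \<omega>) = indicator Q \<omega> * (indicator A (X s \<omega>) * g (X s \<omega>))"
      by (simp add: Y_def)
  qed
  also have "\<dots> = (\<integral>\<^sup>+x. indicator A x * g x \<partial>distr (density M (indicator Q)) borel (X s))"
    by (subst nn_integral_distr) (auto simp: nn_integral_density)
  also have "\<dots> = (\<integral>\<^sup>+x. indicator A x * g x \<partial>density lborel (\<lambda>x. ?k x))"
    using killed_law[OF assms(1)] unfolding Q_def by simp
  also have "\<dots> = (\<integral>\<^sup>+x. ?k x * (indicator A x * g x) \<partial>lborel)"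
  proof (rule nn_integral_density)
    show "(\<lambda>y. indicator A y * g y) \<in> borel_measurable lborel"
      by measurable
    show "(\<lambda>x. ?k x) \<in> borel_measurable lborel"
      unfolding killed_gauss_def by measurable
  qed
  also have "\<dots> = (\<integral>\<^sup>+x. ?k x * indicator A x *
        ?q x \<partial>lborel)"
  proof (rule nn_integral_cong)
    fix x :: real
    have "g x = ?q x" if "x < 1"
      unfolding g_def W_le using S.emeasure_below[OF assms(2), of "1 - x"] that by simp
    then show "?k x * (indicator A x * g x) =
      ?k x * indicator A x *
        ?q x"
      by (auto split: split_indicator)
  qed
  finally show ?thesis .
qed

end

section \<open>The joint law of position and hitting time\<close>

context continuous_paths
begin

abbreviation T :: "'a \<Rightarrow> real" where
  "T \<equiv> hitting_time X 1"

definition hits :: "'a \<Rightarrow> bool" where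
  "hits \<omega> \<longleftrightarrow> (\<exists>t\<ge>0. X t \<omega> = 1)"

lemma hits_before:
  assumes "0 \<le> u" "1 \<le> X u \<omega>"
  shows "\<exists>t\<in>{0..u}. X t \<omega> = 1"
  using IVT'[of "\<lambda>t. X t \<omega>" 0 1 u] assms start[of \<omega>] cont_Icc[of u \<omega>] by auto

lemma
  assumes "hits \<omega>"
  shows hitting_time_nonneg: "0 \<le> T \<omega>" and X_hitting_time: "X (T \<omega>) \<omega> = 1"
    and hitting_time_le: "0 \<le> t \<Longrightarrow> X t \<omega> = 1 \<Longrightarrow> T \<omega> \<le> t"
proof -
  let ?S = "{t. 0 \<le> t \<and> X t \<omega> = 1}"
  have bdd: "bdd_below ?S" by (rule bdd_belowI[of _ 0]) auto
  have "closed ({0..} \<inter> (\<lambda>t. X t \<omega>) -` {1})"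
    using cont by (intro continuous_closed_preimage) auto
  also have "{0..} \<inter> (\<lambda>t. X t \<omega>) -` {1} = ?S" by auto
  finally have "T \<omega> \<in> ?S"
    unfolding hitting_time_def using assms bdd by (intro closed_contains_Inf) (auto simp: hits_def)
  then show "0 \<le> T \<omega>" "X (T \<omega>) \<omega> = 1" by auto
  show "T \<omega> \<le> t" if "0 \<le> t" "X t \<omega> = 1"
    unfolding hitting_time_def using bdd that by (intro cInf_lower) auto
qed

lemma hitting_time_pos: "hits \<omega> \<Longrightarrow> 0 < T \<omega>"
  using hitting_time_nonneg[of \<omega>] X_hitting_time[of \<omega>] start[of \<omega>] by (cases "T \<omega> = 0") auto

lemma less_hitting_time_iff:
  assumes "hits \<omega>" "0 \<le> r"
  shows "r < T \<omega> \<longleftrightarrow> (\<forall>u\<in>{0..r}. X u \<omega> < 1)"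
proof
  assume r: "r < T \<omega>"
  show "\<forall>u\<in>{0..r}. X u \<omega> < 1"
  proof (rule ballI, rule ccontr)
    fix u assume u: "u \<in> {0..r}" "\<not> X u \<omega> < 1"
    then obtain t where "t \<in> {0..u}" "X t \<omega> = 1" using hits_before[of u \<omega>] by auto
    then show False using hitting_time_le[OF assms(1), of t] u r by auto
  qed
next
  assume "\<forall>u\<in>{0..r}. X u \<omega> < 1"
  then show "r < T \<omega>"
    using X_hitting_time[OF assms(1)] hitting_time_nonneg[OF assms(1)] by (force simp: not_less[symmetric])
qed

lemma running_max_less_iff:
  assumes "0 \<le> t"
  shows "running_max t \<omega> < c \<longleftrightarrow> (\<forall>v\<in>{0..t}. X v \<omega> < c)"
proof
  assume "running_max t \<omega> < c"
  then show "\<forall>v\<in>{0..t}. X v \<omega> < c"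
    using running_max_le_iff[OF assms, of \<omega> "running_max t \<omega>"] by force
next
  assume R: "\<forall>v\<in>{0..t}. X v \<omega> < c"
  obtain v where v: "v \<in> {0..t}" "\<forall>w\<in>{0..t}. X w \<omega> \<le> X v \<omega>"
    using continuous_attains_sup[OF _ _ cont_Icc[OF assms, of \<omega>]] assms by auto
  then have "running_max t \<omega> \<le> X v \<omega>" using running_max_le_iff[OF assms] by blast
  then show "running_max t \<omega> < c" using R v(1) by force
qed

lemma hits_iff: "hits \<omega> \<longleftrightarrow> (\<exists>n::nat. \<not> running_max (real n) \<omega> < 1)"
proof
  assume "hits \<omega>"
  then obtain t where t: "0 \<le> t" "X t \<omega> = 1" by (auto simp: hits_def)
  obtain n :: nat where "t \<le> n" using real_arch_simple by blast
  then show "\<exists>n::nat. \<not> running_max (real n) \<omega> < 1"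
    using t by (intro exI[of _ n]) (force simp: running_max_less_iff)
next
  assume "\<exists>n::nat. \<not> running_max (real n) \<omega> < 1"
  then obtain n :: nat and u where "u \<in> {0..real n}" "1 \<le> X u \<omega>"
    by (auto simp: running_max_less_iff not_less)
  then show "hits \<omega>" using hits_before[of u \<omega>] by (auto simp: hits_def)
qed

lemma measurable_hits: "Measurable.pred M hits"
proof -
  have [measurable]: "running_max (real n) \<in> borel_measurable M" for n :: nat
    by (rule measurable_running_max) simp
  show ?thesis unfolding hits_iff[abs_def] by measurable
qed

lemma measurable_hitting_time: "T \<in> borel_measurable M"
  unfolding borel_measurable_iff_greater
proof
  fix r :: real
  note measurable_hits[measurable]
  have T_miss: "T \<omega> = Inf {}" if "\<not> hits \<omega>" for \<omega>
  proof -
    have "{t. 0 \<le> t \<and> X t \<omega> = 1} = {}" using that by (auto simp: hits_def)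
    then show ?thesis unfolding hitting_time_def by (rule arg_cong)
  qed
  show "{\<omega> \<in> space M. r < T \<omega>} \<in> sets M"
  proof (cases "0 \<le> r")
    case True
    have [measurable]: "running_max r \<in> borel_measurable M" using True by (rule measurable_running_max)
    have "r < T \<omega> \<longleftrightarrow> (if hits \<omega> then running_max r \<omega> < 1 else r < Inf {})" for \<omega>
      using True by (cases "hits \<omega>") (simp_all add: less_hitting_time_iff running_max_less_iff T_miss)
    then have "{\<omega> \<in> space M. r < T \<omega>} = {\<omega> \<in> space M. if hits \<omega> then running_max r \<omega> < 1 else r < Inf {}}"
      by simp
    also have "\<dots> \<in> sets M" by measurable
    finally show ?thesis .
  next
    case False
    have "r < T \<omega> \<longleftrightarrow> hits \<omega> \<or> r < Inf {}" for \<omega>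
      using False hitting_time_nonneg[of \<omega>] by (cases "hits \<omega>") (simp_all add: T_miss)
    then have "{\<omega> \<in> space M. r < T \<omega>} = {\<omega> \<in> space M. hits \<omega> \<or> r < Inf {}}"
      by simp
    also have "\<dots> \<in> sets M" by measurable
    finally show ?thesis .
  qed
qed

lemma measurable_X_pair: "(\<lambda>(s, \<omega>). X (max 0 s) \<omega>) \<in> borel_measurable (borel \<Otimes>\<^sub>M M)"
proof (rule borel_measurable_LIMSEQ_real)
  define k where "k = (\<lambda>n (s::real). nat \<lfloor>max 0 s * Suc n\<rfloor>)"
  let ?u = "\<lambda>n p. X (real (k n (fst p)) / Suc n) (snd p)"
  show "?u n \<in> borel_measurable (borel \<Otimes>\<^sub>M M)" for n
  proof (rule measurable_compose_countable[where f="\<lambda>i p. X (real i / Suc n) (snd p)" and g="\<lambda>p. k n (fst p)"])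
    show "(\<lambda>p. X (real i / Suc n) (snd p)) \<in> borel_measurable (borel \<Otimes>\<^sub>M M)" for i :: nat
      using measurable_X[of "real i / Suc n"] by measurable
    show "(\<lambda>p. k n (fst p)) \<in> measurable (borel \<Otimes>\<^sub>M M) (count_space UNIV)"
      unfolding k_def by measurable
  qed
  fix p :: "real \<times> 'a" assume "p \<in> space (borel \<Otimes>\<^sub>M M)"
  obtain s \<omega> where p: "p = (s, \<omega>)" by force
  have "(\<lambda>n. real (k n s) / Suc n) \<longlonglongrightarrow> max 0 s"
  proof (rule tendsto_sandwich)
    have b: "max 0 s * Suc n - 1 \<le> k n s" "k n s \<le> max 0 s * Suc n" for n
    proof -
      have "0 \<le> max 0 s * Suc n" by simp
      then show "max 0 s * Suc n - 1 \<le> k n s" "k n s \<le> max 0 s * Suc n" unfolding k_def by linarith+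
    qed
    show "eventually (\<lambda>n. max 0 s - inverse (real (Suc n)) \<le> real (k n s) / Suc n) sequentially"
      using b(1) by (intro always_eventually allI) (simp add: pos_le_divide_eq left_diff_distrib del: of_nat_Suc)
    show "eventually (\<lambda>n. real (k n s) / Suc n \<le> max 0 s) sequentially"
      using b(2) by (intro always_eventually allI) (simp add: pos_divide_le_eq del: of_nat_Suc)
    show "(\<lambda>n. max 0 s - inverse (real (Suc n))) \<longlonglongrightarrow> max 0 s"
      using tendsto_diff[OF tendsto_const LIMSEQ_inverse_real_of_nat, of "max 0 s"] by simp
    show "(\<lambda>n. max 0 s) \<longlonglongrightarrow> max 0 s" by simp
  qed
  then show "(\<lambda>n. ?u n p) \<longlonglongrightarrow> (case p of (s, \<omega>) \<Rightarrow> X (max 0 s) \<omega>)"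
    unfolding p prod.case fst_conv snd_conv
    by (intro continuous_on_tendsto_compose[OF cont]) auto
qed

end

context continuous_brownian_motion
begin

text \<open>The probability of staying below \<open>1\<close> up to time \<open>n\<close> is \<open>2 Phi (1 / sqrt n) - 1\<close>, which tends to \<open>0\<close>.\<close>

lemma AE_hits: "AE \<omega> in M. hits \<omega>"
proof -
  note measurable_hits[measurable]
  have le: "prob {\<omega> \<in> space M. \<not> hits \<omega>} \<le> 2 * Phi (1 / sqrt (real (Suc n))) - 1" for n
  proof -
    have "prob {\<omega> \<in> space M. \<not> hits \<omega>} \<le> prob (below 1 (real (Suc n)))"
    proof (intro finite_measure_mono below_sets subsetI CollectI conjI ballI)
      fix \<omega> u assume "\<omega> \<in> {\<omega> \<in> space M. \<not> hits \<omega>}" "u \<in> {0..real (Suc n)}"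
      then show "X u \<omega> \<le> 1" using hits_before[of u \<omega>] by (force simp: hits_def)
    qed auto
    then show ?thesis using prob_below[of "real (Suc n)" 1] by simp
  qed
  have lim: "(\<lambda>n. 2 * Phi (1 / sqrt (real (Suc n))) - 1) \<longlonglongrightarrow> 2 * Phi 0 - 1"
  proof (intro tendsto_intros isCont_tendsto_compose[OF isCont_Phi])
    show "(\<lambda>n. 1 / sqrt (real (Suc n))) \<longlonglongrightarrow> 0"
      by real_asymp
  qed
  have "prob {\<omega> \<in> space M. \<not> hits \<omega>} \<le> 2 * Phi 0 - 1"
    by (rule LIMSEQ_le_const[OF lim]) (use le in auto)
  then have "prob {\<omega> \<in> space M. \<not> hits \<omega>} = 0"
    using Phi_0 measure_nonneg[of M "{\<omega> \<in> space M. \<not> hits \<omega>}"] by linarith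
  then show ?thesis by (subst AE_iff_measurable[OF _ refl]) (auto simp: emeasure_eq_measure)
qed

text \<open>The distribution function of the maximum is continuous at \<open>1\<close>.\<close>

lemma AE_running_max_neq_1:
  assumes "0 < r"
  shows "AE \<omega> in M. running_max r \<omega> \<noteq> 1"
proof -
  have [measurable]: "running_max r \<in> borel_measurable M" using assms by (intro measurable_running_max) auto
  have prob: "prob {\<omega> \<in> space M. running_max r \<omega> \<le> c} = 2 * Phi (c / sqrt r) - 1" if "0 < c" for c
    using prob_below[OF assms that] assms by (simp add: running_max_le_iff)
  let ?c = "\<lambda>n::nat. 1 - inverse (real (Suc (Suc n)))"
  let ?E = "\<lambda>n. {\<omega> \<in> space M. running_max r \<omega> \<le> ?c n}" and ?E' = "{\<omega> \<in> space M. running_max r \<omega> < 1}"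
  have c: "?c \<longlonglongrightarrow> 1" by real_asymp
  have "(\<lambda>n. prob (?E n)) \<longlonglongrightarrow> prob ?E'"
  proof (rule prob_tendsto_of_eventually_eq)
    fix \<omega>
    show "eventually (\<lambda>n. \<omega> \<in> (?E n) \<longleftrightarrow> \<omega> \<in> ?E') sequentially"
    proof (cases "running_max r \<omega> < 1")
      case True
      have "eventually (\<lambda>n. running_max r \<omega> < ?c n) sequentially"
        using True by (rule order_tendstoD(1)[OF c])
      then show ?thesis by eventually_elim (use True in auto)
    next
      case False
      have "\<not> running_max r \<omega> \<le> ?c n" for n
        using False inverse_positive_iff_positive[of "real (Suc (Suc n))"] by linarith
      with False show ?thesis by (intro always_eventually) auto
    qed
  qed auto
  moreover have "(\<lambda>n. prob (?E n)) \<longlonglongrightarrow> 2 * Phi (1 / sqrt r) - 1"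
  proof -
    have "(\<lambda>n. 2 * Phi (?c n / sqrt r) - 1) \<longlonglongrightarrow> 2 * Phi (1 / sqrt r) - 1"
      using c assms by (intro tendsto_intros isCont_tendsto_compose[OF isCont_Phi]) auto
    moreover have "prob (?E n) = 2 * Phi (?c n / sqrt r) - 1" for n
      by (rule prob) (simp add: field_simps)
    ultimately show ?thesis by simp
  qed
  ultimately have "prob ?E' = 2 * Phi (1 / sqrt r) - 1"
    by (rule LIMSEQ_unique)
  then have eq: "prob ?E' = prob {\<omega> \<in> space M. running_max r \<omega> \<le> 1}"
    by (simp add: prob)
  have "{\<omega> \<in> space M. running_max r \<omega> = 1} = {\<omega> \<in> space M. running_max r \<omega> \<le> 1} - ?E'"
    by auto
  then have "prob {\<omega> \<in> space M. running_max r \<omega> = 1} = 0"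
    using eq by (simp add: finite_measure_Diff Collect_mono)
  then show ?thesis by (subst AE_iff_measurable[OF _ refl]) (auto simp: emeasure_eq_measure)
qed

text \<open>If the level \<open>1\<close> is hit at all, then \<open>r < T\<close> means that the path is strictly below \<open>1\<close> on \<open>[0, r]\<close>.
  The weak inequality is equivalent up to the null event that the maximum equals \<open>1\<close>.\<close>

lemma AE_less_hitting_time_iff:
  assumes "0 < r"
  shows "AE \<omega> in M. r < T \<omega> \<longleftrightarrow> (\<forall>u\<in>{0..r}. X u \<omega> \<le> 1)"
  using AE_hits AE_running_max_neq_1[OF assms]
proof eventually_elim
  case (elim \<omega>)
  have "r < T \<omega> \<longleftrightarrow> running_max r \<omega> < 1"
    using elim assms by (simp add: less_hitting_time_iff running_max_less_iff)
  also have "\<dots> \<longleftrightarrow> running_max r \<omega> \<le> 1" using elim by auto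
  finally show ?case using assms by (simp add: running_max_le_iff)
qed

lemma emeasure_X_less_hitting_time:
  assumes "0 < s" "0 \<le> t" and A[measurable]: "A \<in> sets borel"
  shows "emeasure M {\<omega> \<in> space M. X s \<omega> \<in> A \<and> s + t < T \<omega>}
    = (\<integral>\<^sup>+x. ennreal (killed_gauss s x) * indicator {..<1} x * indicator A x *
        (\<integral>\<^sup>+v. ennreal (hit_density (1 - x) v) * indicator {t<..} v \<partial>lborel) \<partial>lborel)"
proof -
  let ?q = "\<lambda>x. (\<integral>\<^sup>+v. ennreal (hit_density (1 - x) v) * indicator {t<..} v \<partial>lborel)"
  let ?k = "\<lambda>x. ennreal (killed_gauss s x) * indicator {..<1} x"
  note measurable_hitting_time[measurable]
  have [measurable]: "X s \<in> borel_measurable M" using assms by (intro measurable_X) auto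
  define Q where "Q = below 1 (s + t)"
  have Q[measurable]: "Q \<in> events" unfolding Q_def using assms by (intro below_sets) auto
  have Q_eq: "{\<omega> \<in> space M. X s \<omega> \<in> A \<and> (\<forall>u\<in>{0..s + t}. X u \<omega> \<le> 1)} = {\<omega> \<in> space M. X s \<omega> \<in> A} \<inter> Q"
    by (auto simp: Q_def)
  have "emeasure M {\<omega> \<in> space M. X s \<omega> \<in> A \<and> s + t < T \<omega>} = emeasure M ({\<omega> \<in> space M. X s \<omega> \<in> A} \<inter> Q)"
  proof (rule emeasure_eq_AE)
    show "AE \<omega> in M. \<omega> \<in> {\<omega> \<in> space M. X s \<omega> \<in> A \<and> s + t < T \<omega>} \<longleftrightarrow> \<omega> \<in> {\<omega> \<in> space M. X s \<omega> \<in> A} \<inter> Q"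
      using AE_less_hitting_time_iff[of "s + t"] assms by (auto elim!: eventually_mono simp: Q_def)
  qed measurable
  also have "\<dots> = (\<integral>\<^sup>+x. ?k x * indicator A x *
        ?q x \<partial>lborel)"
  proof (cases "t = 0")
    case False
    then show ?thesis using emeasure_X_below[of s t A] assms unfolding Q_eq by simp
  next
    case True
    have [measurable]: "killed_gauss s \<in> borel_measurable borel"
      unfolding killed_gauss_def by measurable
    have "emeasure M ({\<omega> \<in> space M. X s \<omega> \<in> A} \<inter> Q) = emeasure (distr (density M (indicator Q)) borel (X s)) A"
      by (rule emeasure_distr_on_event[symmetric]) measurable
    also have "\<dots> = emeasure (density lborel (\<lambda>x. ?k x)) A"
      using killed_law[OF assms(1)] True unfolding Q_def by simp
    also have "\<dots> = (\<integral>\<^sup>+x. ?k x * indicator A x \<partial>lborel)"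
      by (rule emeasure_density) auto
    also have "\<dots> = (\<integral>\<^sup>+x. ?k x * indicator A x *
        ?q x \<partial>lborel)"
    proof (rule nn_integral_cong)
      fix x :: real
      have "?q x = 1" if "x < 1"
        using hit_density_tail_0[of "1 - x"] that True Phi_0 by simp
      then show "?k x * indicator A x =
          ?k x * indicator A x *
          ?q x"
        by (auto split: split_indicator)
    qed
    finally show ?thesis .
  qed
  finally show ?thesis .
qed

end

text \<open>The density of position and hitting time at \<open>(x, r)\<close>, on the event that the level is hit after time \<open>s\<close>.\<close>

definition joint_density :: "real \<Rightarrow> real \<times> real \<Rightarrow> ennreal" where
  "joint_density s = (\<lambda>(x, r). ennreal (killed_gauss s x) * indicator {..<1} x *
      (ennreal (hit_density (1 - x) (r - s)) * indicator {s<..} r))"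

lemma measurable_joint_density[measurable]:
  "joint_density s \<in> borel_measurable (borel \<Otimes>\<^sub>M borel)"
  unfolding joint_density_def killed_gauss_def hit_density_def normal_density_def by measurable

context continuous_brownian_motion
begin

text \<open>Both measures are compared on sets \<open>A \<times> {c<..}\<close>; on the event \<open>s < T\<close> the ray may be cut off at \<open>s\<close>.\<close>

lemma joint_law:
  assumes "0 < s"
  shows "distr (density M (indicator {\<omega> \<in> space M. s < T \<omega>})) (borel \<Otimes>\<^sub>M borel) (\<lambda>\<omega>. (X s \<omega>, T \<omega>))
    = density (lborel \<Otimes>\<^sub>M lborel) (joint_density s)"
    (is "?L = ?R")
proof -
  let ?k = "\<lambda>x. ennreal (killed_gauss s x) * indicator {..<1} x"
  note measurable_hitting_time[measurable]
  have [measurable]: "X s \<in> borel_measurable M" using assms by (intro measurable_X) auto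
  define Q where "Q = {\<omega> \<in> space M. s < T \<omega>}"
  have Q[measurable]: "Q \<in> events" unfolding Q_def by measurable
  have sets_lb: "sets (lborel \<Otimes>\<^sub>M lborel) = sets (borel \<Otimes>\<^sub>M (borel :: real measure) :: (real \<times> real) measure)"
    by (intro sets_pair_measure_cong) auto
  have [measurable]: "joint_density s \<in> borel_measurable (lborel \<Otimes>\<^sub>M lborel)"
    using measurable_joint_density by (simp cong: measurable_cong_sets add: sets_lb)
  have L: "emeasure ?L S = emeasure M {\<omega> \<in> space M. s < T \<omega> \<and> (X s \<omega>, T \<omega>) \<in> S}"
    if [measurable]: "S \<in> sets (borel \<Otimes>\<^sub>M borel)" for S
  proof -
    have "{\<omega> \<in> space M. (X s \<omega>, T \<omega>) \<in> S} \<inter> Q = {\<omega> \<in> space M. s < T \<omega> \<and> (X s \<omega>, T \<omega>) \<in> S}"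
      by (auto simp: Q_def)
    moreover have "emeasure (distr (density M (indicator Q)) (borel \<Otimes>\<^sub>M borel) (\<lambda>\<omega>. (X s \<omega>, T \<omega>))) S
        = emeasure M ({\<omega> \<in> space M. (X s \<omega>, T \<omega>) \<in> S} \<inter> Q)"
      by (rule emeasure_distr_on_event) measurable
    ultimately show ?thesis unfolding Q_def by simp
  qed
  show ?thesis
  proof (rule measure_eqI_rectangles[where Ea="sets borel" and Eb="range greaterThan" and a="\<lambda>_. UNIV" and b="\<lambda>i. {- real i<..}"])
    show "sets ?L = sets (borel \<Otimes>\<^sub>M borel)" by simp
    show "sets ?R = sets (borel \<Otimes>\<^sub>M borel)" using sets_lb by simp
    show "Int_stable (sets (borel :: real measure))" by (rule sets.Int_stable)
    show "sets (borel :: real measure) = sigma_sets UNIV (sets borel)"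
      using sets.sigma_sets_eq[of "borel :: real measure"] by simp
    show "emeasure ?L (UNIV \<times> {- real i<..}) \<noteq> \<infinity>" for i
      by (subst L) (auto simp: emeasure_eq_measure)
    fix A B :: "real set" assume A[measurable]: "A \<in> sets borel" and "B \<in> range greaterThan"
    then obtain c where B: "B = {c<..}" by blast
    define m where "m = max s c"
    define t where "t = m - s"
    have t: "0 \<le> t" by (simp add: t_def m_def)
    have "emeasure ?L (A \<times> B) = emeasure M {\<omega> \<in> space M. X s \<omega> \<in> A \<and> s + t < T \<omega>}"
      by (subst L) (auto simp: B t_def m_def intro!: arg_cong[where f="emeasure M"])
    also have "\<dots> = (\<integral>\<^sup>+x. ?k x * indicator A x *
        (\<integral>\<^sup>+v. ennreal (hit_density (1 - x) v) * indicator {t<..} v \<partial>lborel) \<partial>lborel)"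
      by (rule emeasure_X_less_hitting_time) (use assms t in auto)
    also have "\<dots> = (\<integral>\<^sup>+x. (\<integral>\<^sup>+r. joint_density s (x, r) * indicator (A \<times> B) (x, r) \<partial>lborel) \<partial>lborel)"
    proof (rule nn_integral_cong)
      fix x :: real
      have [measurable]: "hit_density (1 - x) \<in> borel_measurable borel" unfolding hit_density_def by measurable
      have "(\<integral>\<^sup>+r. joint_density s (x, r) * indicator (A \<times> B) (x, r) \<partial>lborel)
        = (\<integral>\<^sup>+r. (?k x * indicator A x) *
            (ennreal (hit_density (1 - x) (r - s)) * indicator {m<..} r) \<partial>lborel)"
        by (intro nn_integral_cong) (auto simp: joint_density_def B m_def split: split_indicator)
      also have "\<dots> = (?k x * indicator A x) *
            (\<integral>\<^sup>+r. ennreal (hit_density (1 - x) (r - s)) * indicator {m<..} r \<partial>lborel)"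
        by (rule nn_integral_cmult) measurable
      also have "(\<integral>\<^sup>+r. ennreal (hit_density (1 - x) (r - s)) * indicator {m<..} r \<partial>lborel)
          = ennreal \<bar>1\<bar> * (\<integral>\<^sup>+v. ennreal (hit_density (1 - x) (s + 1 * v - s)) * indicator {m<..} (s + 1 * v) \<partial>lborel)"
        by (rule nn_integral_real_affine) auto
      also have "\<dots> = (\<integral>\<^sup>+v. ennreal (hit_density (1 - x) v) * indicator {t<..} v \<partial>lborel)"
        by (auto intro!: nn_integral_cong simp: t_def split: split_indicator)
      finally show "?k x * indicator A x *
        (\<integral>\<^sup>+v. ennreal (hit_density (1 - x) v) * indicator {t<..} v \<partial>lborel) =
        (\<integral>\<^sup>+r. joint_density s (x, r) * indicator (A \<times> B) (x, r) \<partial>lborel)" by simp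
    qed
    also have "\<dots> = (\<integral>\<^sup>+p. joint_density s p * indicator (A \<times> B) p \<partial>(lborel \<Otimes>\<^sub>M lborel))"
      by (rule lborel.nn_integral_fst) (use A in \<open>measurable, auto simp: B\<close>)
    also have "\<dots> = emeasure ?R (A \<times> B)"
      by (rule emeasure_density[symmetric]) (auto simp: B)
    finally show "emeasure ?L (A \<times> B) = emeasure ?R (A \<times> B)" .
  qed (use sigma_rays Int_stable_rays incseq_greaterThan_real in \<open>auto simp: incseq_def\<close>)
qed

lemma nn_integral_joint_law:
  assumes "0 < s" and F[measurable]: "F \<in> borel_measurable (borel \<Otimes>\<^sub>M borel)"
  shows "(\<integral>\<^sup>+\<omega>. indicator {\<omega> \<in> space M. s < T \<omega>} \<omega> * F (X s \<omega>, T \<omega>) \<partial>M)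
    = (\<integral>\<^sup>+x. (\<integral>\<^sup>+r. joint_density s (x, r) * F (x, r) \<partial>lborel) \<partial>lborel)"
proof -
  note measurable_hitting_time[measurable]
  have [measurable]: "X s \<in> borel_measurable M" using assms by (intro measurable_X) auto
  have sets_lb: "sets (lborel \<Otimes>\<^sub>M lborel) = sets (borel \<Otimes>\<^sub>M (borel :: real measure) :: (real \<times> real) measure)"
    by (intro sets_pair_measure_cong) auto
  have [measurable]: "joint_density s \<in> borel_measurable (lborel \<Otimes>\<^sub>M lborel)" "F \<in> borel_measurable (lborel \<Otimes>\<^sub>M lborel)"
    using measurable_joint_density F by (simp_all cong: measurable_cong_sets add: sets_lb)
  have "(\<integral>\<^sup>+\<omega>. indicator {\<omega> \<in> space M. s < T \<omega>} \<omega> * F (X s \<omega>, T \<omega>) \<partial>M)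
    = (\<integral>\<^sup>+p. F p \<partial>distr (density M (indicator {\<omega> \<in> space M. s < T \<omega>})) (borel \<Otimes>\<^sub>M borel) (\<lambda>\<omega>. (X s \<omega>, T \<omega>)))"
    by (subst nn_integral_distr) (auto simp: nn_integral_density)
  also have "\<dots> = (\<integral>\<^sup>+p. joint_density s p * F p \<partial>(lborel \<Otimes>\<^sub>M lborel))"
    unfolding joint_law[OF assms(1)] by (rule nn_integral_density) measurable
  also have "\<dots> = (\<integral>\<^sup>+x. (\<integral>\<^sup>+r. joint_density s (x, r) * F (x, r) \<partial>lborel) \<partial>lborel)"
    by (rule lborel.nn_integral_fst[symmetric]) measurable
  finally show ?thesis .
qed

end

section \<open>The occupation formula\<close>

text \<open>The integral over \<open>s\<close> is moved inside and evaluated by the convolution formula; then \<open>x = y sqrt r\<close> is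
  substituted and the integral over \<open>r\<close> is the one computed for \<open>alpha_density\<close>.\<close>

lemma occupation_integral:
  fixes \<phi> :: "real \<Rightarrow> ennreal"
  assumes [measurable]: "\<phi> \<in> borel_measurable borel"
  shows "(\<integral>\<^sup>+s. indicator {0<..} s * (\<integral>\<^sup>+x. (\<integral>\<^sup>+r. joint_density s (x, r) * (ennreal (1 / r) * \<phi> (x / sqrt r)) \<partial>lborel) \<partial>lborel) \<partial>lborel)
    = (\<integral>\<^sup>+y. \<phi> y * ennreal (alpha_density y) \<partial>lborel)"
proof -
  define J where "J = (\<lambda>s x r. indicator {0<..} s * (joint_density s (x, r) * (ennreal (1 / r) * \<phi> (x / sqrt r))))"
  define g where "g = (\<lambda>r x. gauss r (\<bar>x\<bar> + 1 - x) - gauss r (3 - 2 * x))"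
  let ?I = "\<lambda>r x. ennreal (1 / r) * \<phi> (x / sqrt r) * (ennreal (g r x) * indicator {..<1} x * indicator {0<..} r)"
  let ?I' = "\<lambda>r y. \<phi> y * (ennreal (1 / sqrt r * g r (y * sqrt r)) * indicator {T. 0 < T \<and> y * sqrt T < 1} r)"
  have J[measurable]: "(\<lambda>p. J (fst p) (fst (snd p)) (snd (snd p))) \<in> borel_measurable (borel \<Otimes>\<^sub>M borel \<Otimes>\<^sub>M borel)"
  proof -
    (* The indicator of a ray that depends on s is replaced by a condition, which makes
       joint measurability in s, x and r visible. *)
    have "J s x r = (if 0 < s \<and> s < r \<and> x < 1 then ennreal (killed_gauss s x) * ennreal (hit_density (1 - x) (r - s)) * (ennreal (1 / r) * \<phi> (x / sqrt r)) else 0)" for s x r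
      by (auto simp: J_def joint_density_def mult_ac)
    then show ?thesis
      by (simp only: killed_gauss_def hit_density_def normal_density_def) measurable
  qed
  have J'[measurable]: "(\<lambda>p. J (f p) (f' p) (f'' p)) \<in> borel_measurable N"
    if [measurable]: "f \<in> borel_measurable N" "f' \<in> borel_measurable N" "f'' \<in> borel_measurable N" for f f' f'' and N :: "'z measure"
    using measurable_compose[OF _ J, of "\<lambda>p. (f p, f' p, f'' p)" N] by simp
  have [measurable]: "(\<lambda>p. g (f p) (f' p)) \<in> borel_measurable N"
    if [measurable]: "f \<in> borel_measurable N" "f' \<in> borel_measurable N" for f f' and N :: "'z measure"
    unfolding g_def normal_density_def by measurable
  have inner: "(\<integral>\<^sup>+s. J s x r \<partial>lborel) = ?I r x"
    if x: "x \<noteq> 0" for x r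
  proof (cases "x < 1 \<and> 0 < r")
    case True
    have "(\<integral>\<^sup>+s. J s x r \<partial>lborel)
      = (\<integral>\<^sup>+s. ennreal (1 / r) * \<phi> (x / sqrt r) * (ennreal (killed_gauss s x * hit_density (1 - x) (r - s)) * indicator {0<..<r} s) \<partial>lborel)"
    proof (rule nn_integral_cong)
      fix s :: real
      show "J s x r = ennreal (1 / r) * \<phi> (x / sqrt r) * (ennreal (killed_gauss s x * hit_density (1 - x) (r - s)) * indicator {0<..<r} s)"
      proof (cases "0 < s \<and> s < r")
        case s: True
        then have "ennreal (killed_gauss s x * hit_density (1 - x) (r - s)) = ennreal (killed_gauss s x) * ennreal (hit_density (1 - x) (r - s))"
          using True by (intro ennreal_mult killed_gauss_nonneg hit_density_nonneg) auto
        then show ?thesis using True s by (simp add: J_def joint_density_def mult_ac)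
      qed (auto simp: J_def joint_density_def)
    qed
    also have "\<dots> = ennreal (1 / r) * \<phi> (x / sqrt r) * (\<integral>\<^sup>+s. ennreal (killed_gauss s x * hit_density (1 - x) (r - s)) * indicator {0<..<r} s \<partial>lborel)"
      by (rule nn_integral_cmult) (unfold killed_gauss_def hit_density_def normal_density_def, measurable)
    also have "(\<integral>\<^sup>+s. ennreal (killed_gauss s x * hit_density (1 - x) (r - s)) * indicator {0<..<r} s \<partial>lborel) = ennreal (g r x)"
      unfolding g_def using True x by (intro killed_hit_convolution) auto
    finally show ?thesis using True by simp
  next
    case False
    have "J s x r = 0" for s
      using False by (cases "0 < s"; cases "s < r"; cases "x < 1") (auto simp: J_def joint_density_def)
    then show ?thesis using False by auto
  qed
  have "(\<integral>\<^sup>+s. indicator {0<..} s * (\<integral>\<^sup>+x. (\<integral>\<^sup>+r. joint_density s (x, r) * (ennreal (1 / r) * \<phi> (x / sqrt r)) \<partial>lborel) \<partial>lborel) \<partial>lborel)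
    = (\<integral>\<^sup>+s. (\<integral>\<^sup>+x. (\<integral>\<^sup>+r. J s x r \<partial>lborel) \<partial>lborel) \<partial>lborel)"
    by (intro nn_integral_cong) (auto simp: J_def split: split_indicator)
  also have "\<dots> = (\<integral>\<^sup>+x. (\<integral>\<^sup>+s. (\<integral>\<^sup>+r. J s x r \<partial>lborel) \<partial>lborel) \<partial>lborel)"
    by (rule lborel_pair.Fubini'[symmetric]) measurable
  also have "\<dots> = (\<integral>\<^sup>+x. (\<integral>\<^sup>+r. (\<integral>\<^sup>+s. J s x r \<partial>lborel) \<partial>lborel) \<partial>lborel)"
    by (intro nn_integral_cong lborel_pair.Fubini'[symmetric]) measurable
  also have "\<dots> = (\<integral>\<^sup>+x. (\<integral>\<^sup>+r. ?I r x \<partial>lborel) \<partial>lborel)"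
  proof (rule nn_integral_cong_AE)
    show "AE x in lborel. (\<integral>\<^sup>+r. (\<integral>\<^sup>+s. J s x r \<partial>lborel) \<partial>lborel)
      = (\<integral>\<^sup>+r. ?I r x \<partial>lborel)"
      using AE_lborel_singleton[of "0 :: real"] by eventually_elim (intro nn_integral_cong inner)
  qed
  also have "\<dots> = (\<integral>\<^sup>+r. (\<integral>\<^sup>+x. ?I r x \<partial>lborel) \<partial>lborel)"
    by (rule lborel_pair.Fubini'[symmetric]) measurable
  also have "\<dots> = (\<integral>\<^sup>+r. (\<integral>\<^sup>+y. ?I' r y \<partial>lborel) \<partial>lborel)"
  proof (rule nn_integral_cong)
    fix r :: real
    show "(\<integral>\<^sup>+x. ?I r x \<partial>lborel)
      = (\<integral>\<^sup>+y. ?I' r y \<partial>lborel)"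
    proof (cases "0 < r")
      case r: True
      have "(\<integral>\<^sup>+x. ?I r x \<partial>lborel)
        = ennreal \<bar>sqrt r\<bar> * (\<integral>\<^sup>+y. ?I r (0 + sqrt r * y) \<partial>lborel)"
        using r by (intro nn_integral_real_affine) auto
      also have "\<dots> = (\<integral>\<^sup>+y. ennreal \<bar>sqrt r\<bar> * (?I r (0 + sqrt r * y)) \<partial>lborel)"
        by (rule nn_integral_cmult[symmetric]) measurable
      also have "\<dots> = (\<integral>\<^sup>+y. ?I' r y \<partial>lborel)"
      proof (rule nn_integral_cong)
        fix y :: real
        have "sqrt r * (1 / r) = 1 / sqrt r" using r by (simp add: real_div_sqrt field_simps)
        then have e: "ennreal \<bar>sqrt r\<bar> * ennreal (1 / r) = ennreal (1 / sqrt r)"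
          using r by (simp add: ennreal_mult'[symmetric])
        have "ennreal (1 / sqrt r * g r (y * sqrt r)) = ennreal \<bar>sqrt r\<bar> * ennreal (1 / r) * ennreal (g r (y * sqrt r))"
          unfolding e using r by (intro ennreal_mult') auto
        then show "ennreal \<bar>sqrt r\<bar> * (?I r (0 + sqrt r * y))
          = ?I' r y"
          using r by (auto split: split_indicator simp: mult_ac)
      qed
      finally show ?thesis .
    qed auto
  qed
  also have "\<dots> = (\<integral>\<^sup>+y. (\<integral>\<^sup>+r. ?I' r y \<partial>lborel) \<partial>lborel)"
  proof (rule lborel_pair.Fubini')
    have "indicator {T. 0 < T \<and> y * sqrt T < 1} r = (indicator {p. 0 < snd p \<and> fst p * sqrt (snd p) < 1} (y, r) :: ennreal)" for y r :: real
      by (auto split: split_indicator)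
    moreover have [measurable]: "{p. 0 < snd p \<and> fst p * sqrt (snd p) < 1} \<in> sets (borel \<Otimes>\<^sub>M (borel :: real measure))"
      by (rule Collect_pair_sets) measurable
    ultimately show "(\<lambda>(y, r). ?I' r y) \<in> borel_measurable (lborel \<Otimes>\<^sub>M lborel)"
      by simp
  qed
  also have "\<dots> = (\<integral>\<^sup>+y. \<phi> y * ennreal (alpha_density y) \<partial>lborel)"
  proof (rule nn_integral_cong)
    fix y :: real
    have "(\<integral>\<^sup>+r. ?I' r y \<partial>lborel)
      = \<phi> y * (\<integral>\<^sup>+r. ennreal (1 / sqrt r * g r (y * sqrt r)) * indicator {T. 0 < T \<and> y * sqrt T < 1} r \<partial>lborel)"
      by (rule nn_integral_cmult) measurable
    then show "(\<integral>\<^sup>+r. ?I' r y \<partial>lborel)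
      = \<phi> y * ennreal (alpha_density y)"
      unfolding g_def alpha_density_integral .
  qed
  finally show ?thesis .
qed

context continuous_brownian_motion
begin

text \<open>The substitution \<open>s = u T\<close> turns the average over \<open>u\<close> into a time average up to \<open>T\<close>, and exchanging
  expectation and time integral leaves the joint law of \<open>X s\<close> and \<open>T\<close> at fixed \<open>s\<close>. The maximum with \<open>0\<close>
  keeps the time argument in the half-line on which the paths are continuous.\<close>

lemma occupation_formula:
  fixes \<phi> :: "real \<Rightarrow> ennreal"
  assumes [measurable]: "\<phi> \<in> borel_measurable borel"
  shows "(\<integral>\<^sup>+\<omega>. (\<integral>\<^sup>+u. indicator {0..1} u * \<phi> (X (max 0 (u * T \<omega>)) \<omega> / sqrt (T \<omega>)) \<partial>lborel) \<partial>M)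
    = (\<integral>\<^sup>+y. \<phi> y * ennreal (alpha_density y) \<partial>lborel)"
proof -
  let ?j = "\<lambda>s x. \<integral>\<^sup>+r. joint_density s (x, r) * (ennreal (1 / r) * \<phi> (x / sqrt r)) \<partial>lborel"
  let ?I = "\<lambda>\<omega> s. indicator {0<..} s * (indicator {s<..} (T \<omega>) * (ennreal (1 / T \<omega>) * \<phi> (X (max 0 s) \<omega> / sqrt (T \<omega>))))"
  note measurable_hitting_time[measurable]
  interpret P: pair_sigma_finite M "lborel :: real measure" ..
  have Xp[measurable]: "(\<lambda>p. X (max 0 (f p)) (f' p)) \<in> borel_measurable N"
    if [measurable]: "f \<in> borel_measurable N" "f' \<in> measurable N M" for f f' and N :: "'z measure"
    using measurable_compose[OF _ measurable_X_pair, of "\<lambda>p. (f p, f' p)" N] by simp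
  have "(\<integral>\<^sup>+\<omega>. (\<integral>\<^sup>+u. indicator {0..1} u * \<phi> (X (max 0 (u * T \<omega>)) \<omega> / sqrt (T \<omega>)) \<partial>lborel) \<partial>M)
    = (\<integral>\<^sup>+\<omega>. (\<integral>\<^sup>+s. ?I \<omega> s \<partial>lborel) \<partial>M)"
  proof (rule nn_integral_cong_AE)
    show "AE \<omega> in M. (\<integral>\<^sup>+u. indicator {0..1} u * \<phi> (X (max 0 (u * T \<omega>)) \<omega> / sqrt (T \<omega>)) \<partial>lborel)
      = (\<integral>\<^sup>+s. ?I \<omega> s \<partial>lborel)"
      using AE_hits AE_space
    proof eventually_elim
      case (elim \<omega>)
      then have T: "0 < T \<omega>" by (intro hitting_time_pos)
      have [measurable]: "(\<lambda>s. X (max 0 s) \<omega>) \<in> borel_measurable borel"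
        using elim by (intro Xp) auto
      define c where "c = T \<omega>"
      have c: "0 < c" using T by (simp add: c_def)
      let ?J = "\<lambda>s. indicator {0<..} s * (indicator {s<..} c * (ennreal (1 / c) * \<phi> (X (max 0 s) \<omega> / sqrt c)))"
      have "(\<integral>\<^sup>+s. ?J s \<partial>lborel)
        = ennreal \<bar>c\<bar> * (\<integral>\<^sup>+u. ?J (0 + c * u) \<partial>lborel)"
      proof (rule nn_integral_real_affine)
        have "(\<lambda>s. indicator {s<..} c) = (indicator {..<c} :: real \<Rightarrow> ennreal)"
          by (auto split: split_indicator)
        then have [measurable]: "(\<lambda>s. indicator {s<..} c :: ennreal) \<in> borel_measurable borel" by simp
        show "(\<lambda>s. ?J s) \<in> borel_measurable borel"
          by measurable
      qed (use c in auto)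
      also have "\<dots> = (\<integral>\<^sup>+u. ennreal \<bar>c\<bar> * (?J (0 + c * u)) \<partial>lborel)"
      proof (rule nn_integral_cmult[symmetric])
        have "(\<lambda>u. indicator {0 + c * u<..} c) = (\<lambda>u. indicator {..<c} (c * u) :: ennreal)"
          by (auto split: split_indicator)
        then have [measurable]: "(\<lambda>u. indicator {0 + c * u<..} c :: ennreal) \<in> borel_measurable borel" by simp
        show "(\<lambda>u. ?J (0 + c * u)) \<in> borel_measurable lborel"
          by measurable
      qed
      also have "\<dots> = (\<integral>\<^sup>+u. indicator {0<..<1} u * \<phi> (X (max 0 (u * c)) \<omega> / sqrt c) \<partial>lborel)"
      proof (rule nn_integral_cong)
        fix u :: real
        have cancel: "ennreal \<bar>c\<bar> * (ennreal (1 / c) * z) = z" for z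
          using c by (simp only: mult.assoc[symmetric] ennreal_mult'[symmetric] abs_ge_zero) simp
        have "0 < c * u \<longleftrightarrow> 0 < u" "c * u < c \<longleftrightarrow> u < 1" using c by (auto simp: zero_less_mult_iff)
        then show "ennreal \<bar>c\<bar> * (?J (0 + c * u))
          = indicator {0<..<1} u * \<phi> (X (max 0 (u * c)) \<omega> / sqrt c)"
          unfolding mult.commute[of u c] using cancel by (cases "0 < u \<and> u < 1") auto
      qed
      also have "\<dots> = (\<integral>\<^sup>+u. indicator {0..1} u * \<phi> (X (max 0 (u * c)) \<omega> / sqrt c) \<partial>lborel)"
        by (rule nn_integral_cong_AE, rule AE_I[where N="{0, 1}"])
           (auto intro: emeasure_lborel_countable split: split_indicator)
      finally show ?case unfolding c_def by simp
    qed
  qed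
  also have "\<dots> = (\<integral>\<^sup>+s. (\<integral>\<^sup>+\<omega>. ?I \<omega> s \<partial>M) \<partial>lborel)"
  proof (rule P.Fubini'[symmetric])
    have "indicator {s<..} (T \<omega>) = (indicator {p. fst p < snd p} (s, T \<omega>) :: ennreal)" for s \<omega>
      by (auto split: split_indicator)
    moreover have [measurable]: "{p. fst p < snd p} \<in> sets (borel \<Otimes>\<^sub>M (borel :: real measure))"
      by (rule Collect_pair_sets) measurable
    ultimately show "(\<lambda>(\<omega>, s). ?I \<omega> s) \<in> borel_measurable (M \<Otimes>\<^sub>M lborel)"
      by simp
  qed
  also have "\<dots> = (\<integral>\<^sup>+s. indicator {0<..} s * (\<integral>\<^sup>+x. ?j s x \<partial>lborel) \<partial>lborel)"
  proof (rule nn_integral_cong)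
    fix s :: real
    show "(\<integral>\<^sup>+\<omega>. ?I \<omega> s \<partial>M)
      = indicator {0<..} s * (\<integral>\<^sup>+x. ?j s x \<partial>lborel)"
    proof (cases "0 < s")
      case True
      have "(\<integral>\<^sup>+\<omega>. ?I \<omega> s \<partial>M)
        = (\<integral>\<^sup>+\<omega>. indicator {\<omega> \<in> space M. s < T \<omega>} \<omega> * (case (X s \<omega>, T \<omega>) of (x, r) \<Rightarrow> ennreal (1 / r) * \<phi> (x / sqrt r)) \<partial>M)"
        using True by (intro nn_integral_cong) (auto split: split_indicator)
      also have "\<dots> = (\<integral>\<^sup>+x. (\<integral>\<^sup>+r. joint_density s (x, r) * (case (x, r) of (x, r) \<Rightarrow> ennreal (1 / r) * \<phi> (x / sqrt r)) \<partial>lborel) \<partial>lborel)"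
        by (rule nn_integral_joint_law[OF True]) measurable
      finally show ?thesis using True by simp
    qed simp
  qed
  also have "\<dots> = (\<integral>\<^sup>+y. \<phi> y * ennreal (alpha_density y) \<partial>lborel)"
    by (rule occupation_integral) measurable
  finally show ?thesis .
qed

end

section \<open>Randomisation and the law of alpha\<close>

text \<open>A uniform variable that is independent of the \<open>\<sigma>\<close>-algebra \<open>F\<close> may be integrated out first: the joint
  law of \<open>U\<close> and the outcome, seen as a point of the space with \<open>\<sigma>\<close>-algebra \<open>F\<close>, is a product measure.\<close>

lemma (in prob_space) nn_integral_indep_uniform:
  fixes U :: "'a \<Rightarrow> real" and H :: "real \<times> 'a \<Rightarrow> ennreal"
  assumes F: "subalgebra M F"
    and U: "distributed M lborel U (indicator {0..1})"
    and indep: "\<And>C A. C \<in> sets borel \<Longrightarrow> A \<in> sets F \<Longrightarrow>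
      prob ({\<omega> \<in> space M. U \<omega> \<in> C} \<inter> A) = prob {\<omega> \<in> space M. U \<omega> \<in> C} * prob A"
    and H[measurable]: "H \<in> borel_measurable (borel \<Otimes>\<^sub>M F)"
  shows "(\<integral>\<^sup>+\<omega>. H (U \<omega>, \<omega>) \<partial>M) = (\<integral>\<^sup>+\<omega>. (\<integral>\<^sup>+u. indicator {0..1} u * H (u, \<omega>) \<partial>lborel) \<partial>M)"
proof -
  have U_meas[measurable]: "U \<in> borel_measurable M"
    using distributed_measurable[OF U] by simp
  have id[measurable]: "(\<lambda>\<omega>. \<omega>) \<in> measurable M F"
    using F by (intro measurableI) (auto simp: subalgebra_def)
  define R where "R = restr_to_subalg M F"
  define D where "D = density lborel (indicator {0..1 :: real} :: real \<Rightarrow> ennreal)"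
  have R: "sets R = sets F" "\<And>A. A \<in> sets F \<Longrightarrow> emeasure R A = emeasure M A"
    using F by (auto simp: R_def sets_restr_to_subalg emeasure_restr_to_subalg)
  have D: "emeasure D C = emeasure M {\<omega> \<in> space M. U \<omega> \<in> C}" if "C \<in> sets borel" for C
  proof -
    have "D = distr M lborel U" using U by (simp add: distributed_def D_def)
    then show ?thesis using that by (simp add: emeasure_distr vimage_def Int_def conj_commute)
  qed
  have finR: "finite_measure R"
  proof
    have "space R = space M" by (simp add: R_def space_restr_to_subalg)
    then show "emeasure R (space R) \<noteq> \<infinity>"
      using F R(2)[of "space M"] by (metis emeasure_space_1 ennreal_one_neq_top infinity_ennreal_def sets.top subalgebra_def)
  qed
  have finD: "finite_measure D"
    by (rule finite_measureI) (auto simp: D_def emeasure_density)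
  interpret R: finite_measure R by fact
  interpret D: finite_measure D by fact
  interpret DR: pair_sigma_finite D R ..
  have sets_DR: "sets (D \<Otimes>\<^sub>M R) = sets (borel \<Otimes>\<^sub>M F)"
    by (intro sets_pair_measure_cong) (auto simp: D_def R)
  have pair_eq: "D \<Otimes>\<^sub>M R = distr M (borel \<Otimes>\<^sub>M F) (\<lambda>\<omega>. (U \<omega>, \<omega>))"
  proof (rule pair_measure_eqI)
    fix C A assume "C \<in> sets D" "A \<in> sets R"
    then have C: "C \<in> sets borel" and A: "A \<in> sets F" by (auto simp: D_def R)
    have "A \<in> events" using A F by (auto simp: subalgebra_def)
    then have "(\<lambda>\<omega>. (U \<omega>, \<omega>)) -` (C \<times> A) \<inter> space M = {\<omega> \<in> space M. U \<omega> \<in> C} \<inter> A"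
      using sets.sets_into_space by auto
    then show "emeasure D C * emeasure R A = emeasure (distr M (borel \<Otimes>\<^sub>M F) (\<lambda>\<omega>. (U \<omega>, \<omega>))) (C \<times> A)"
      using C A indep[OF C A]
      by (subst emeasure_distr) (auto simp: D R emeasure_eq_measure ennreal_mult)
  qed (use sets_DR R.sigma_finite_measure_axioms D.sigma_finite_measure_axioms in auto)
  have H'[measurable]: "H \<in> borel_measurable (D \<Otimes>\<^sub>M R)"
    using H by (simp cong: measurable_cong_sets add: sets_DR)
  have "(\<integral>\<^sup>+\<omega>. H (U \<omega>, \<omega>) \<partial>M) = (\<integral>\<^sup>+p. H p \<partial>distr M (borel \<Otimes>\<^sub>M F) (\<lambda>\<omega>. (U \<omega>, \<omega>)))"
    by (subst nn_integral_distr) auto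
  also have "\<dots> = (\<integral>\<^sup>+\<omega>. (\<integral>\<^sup>+u. H (u, \<omega>) \<partial>D) \<partial>R)"
    unfolding pair_eq[symmetric] by (rule DR.nn_integral_snd[symmetric]) (rule H')
  also have "\<dots> = (\<integral>\<^sup>+\<omega>. (\<integral>\<^sup>+u. indicator {0..1} u * H (u, \<omega>) \<partial>lborel) \<partial>R)"
  proof (rule nn_integral_cong)
    fix \<omega> assume "\<omega> \<in> space R"
    then have "\<omega> \<in> space F" using sets_eq_imp_space_eq[OF R(1)] by simp
    then have "(\<lambda>u. H (u, \<omega>)) \<in> borel_measurable borel" by measurable
    then show "(\<integral>\<^sup>+u. H (u, \<omega>) \<partial>D) = (\<integral>\<^sup>+u. indicator {0..1} u * H (u, \<omega>) \<partial>lborel)"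
      unfolding D_def by (intro nn_integral_density) auto
  qed
  also have "\<dots> = (\<integral>\<^sup>+\<omega>. (\<integral>\<^sup>+u. indicator {0..1} u * H (u, \<omega>) \<partial>lborel) \<partial>M)"
    unfolding R_def by (rule nn_integral_subalgebra2[OF F]) measurable
  finally show ?thesis .
qed

lemma (in prob_space) indep_vars_cong_AE:
  fixes \<xi> \<eta> :: "nat \<Rightarrow> 'a \<Rightarrow> real"
  assumes indep: "indep_vars (\<lambda>_. borel) \<xi> {..<n}"
    and eq: "\<And>i. i < n \<Longrightarrow> AE \<omega> in M. \<xi> i \<omega> = \<eta> i \<omega>"
    and rv: "\<And>i. i < n \<Longrightarrow> random_variable borel (\<eta> i)"
  shows "indep_vars (\<lambda>_. borel) \<eta> {..<n}"
proof (cases "n = 0")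
  case True
  then show ?thesis by (simp add: indep_vars_def indep_sets_def)
next
  case False
  have rv': "random_variable borel (\<xi> i)" if "i < n" for i
    using indep that by (auto simp: indep_vars_def)
  have "AE \<omega> in M. \<forall>i\<in>{..<n}. \<xi> i \<omega> = \<eta> i \<omega>"
    using eq by (intro AE_finite_allI) auto
  then have "AE \<omega> in M. (\<lambda>i\<in>{..<n}. \<eta> i \<omega>) = (\<lambda>i\<in>{..<n}. \<xi> i \<omega>)"
    by eventually_elim (auto simp: restrict_def)
  then have "distr M (PiM {..<n} (\<lambda>_. borel)) (\<lambda>\<omega>. \<lambda>i\<in>{..<n}. \<eta> i \<omega>)
      = distr M (PiM {..<n} (\<lambda>_. borel)) (\<lambda>\<omega>. \<lambda>i\<in>{..<n}. \<xi> i \<omega>)"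
    by (intro distr_cong_AE) (auto intro!: measurable_restrict rv rv')
  also have "\<dots> = (\<Pi>\<^sub>M i\<in>{..<n}. distr M borel (\<xi> i))"
    using indep rv' False by (subst (asm) indep_vars_iff_distr_eq_PiM') auto
  also have "\<dots> = (\<Pi>\<^sub>M i\<in>{..<n}. distr M borel (\<eta> i))"
    using eq rv rv' by (intro PiM_cong distr_cong_AE) auto
  finally show ?thesis
    using rv False by (subst indep_vars_iff_distr_eq_PiM') auto
qed

text \<open>Set the path to \<open>0\<close> outside the almost sure event of continuity and start at \<open>0\<close>.\<close>

lemma brownian_motion_continuous_version:
  assumes "brownian_motion M B"
  obtains X where "continuous_brownian_motion M X" "AE \<omega> in M. \<forall>t. X t \<omega> = B t \<omega>"
proof -
  interpret prob_space M using assms by (simp add: brownian_motion_def)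
  have B[measurable]: "B t \<in> borel_measurable M" if "0 \<le> t" for t
    using assms that by (simp add: brownian_motion_def)
  have "AE \<omega> in M. B 0 \<omega> = 0 \<and> continuous_on {0..} (\<lambda>t. B t \<omega>)"
    using assms unfolding brownian_motion_def by (auto intro: AE_conjI)
  then obtain N where N: "\<And>\<omega>. \<omega> \<in> space M - N \<Longrightarrow> B 0 \<omega> = 0 \<and> continuous_on {0..} (\<lambda>t. B t \<omega>)"
    "N \<in> null_sets M"
    by (rule AE_E3) blast
  define X where "X = (\<lambda>t \<omega>. if \<omega> \<in> space M - N then B t \<omega> else 0)"
  have [measurable]: "N \<in> events" using N(2) by auto
  have X[measurable]: "X t \<in> borel_measurable M" if "0 \<le> t" for t
    using B[OF that] unfolding X_def by measurable
  have eq: "AE \<omega> in M. \<forall>t. X t \<omega> = B t \<omega>"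
    using AE_not_in[OF N(2)] AE_space by eventually_elim (auto simp: X_def)
  have start: "X 0 \<omega> = 0" for \<omega> using N(1)[of \<omega>] by (auto simp: X_def)
  have cont: "continuous_on {0..} (\<lambda>t. X t \<omega>)" for \<omega>
    using N(1)[of \<omega>] by (cases "\<omega> \<in> space M - N") (auto simp: X_def)
  have "continuous_brownian_motion M X"
  proof unfold_locales
    show "X t \<in> borel_measurable M" if "0 \<le> t" for t using that by (rule X)
    show "X 0 \<omega> = 0" for \<omega> by (rule start)
    show "continuous_on {0..} (\<lambda>t. X t \<omega>)" for \<omega> by (rule cont)
    show "brownian_motion M X"
      unfolding brownian_motion_def
    proof (intro conjI allI impI)
      show "prob_space M" by unfold_locales
      show "distributed M lborel (\<lambda>\<omega>. X t \<omega> - X s \<omega>) (\<lambda>x. ennreal (gauss (t - s) x))" if "0 \<le> s" "s < t" for s t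
      proof -
        have "distributed M lborel (\<lambda>\<omega>. B t \<omega> - B s \<omega>) (\<lambda>x. ennreal (gauss (t - s) x))"
          using assms that by (simp add: brownian_motion_def)
        moreover have "distr M lborel (\<lambda>\<omega>. X t \<omega> - X s \<omega>) = distr M lborel (\<lambda>\<omega>. B t \<omega> - B s \<omega>)"
          using eq that by (intro distr_cong_AE) (auto elim!: eventually_mono)
        ultimately show ?thesis using that by (simp add: distributed_def)
      qed
      show "indep_vars (\<lambda>_. borel) (\<lambda>i \<omega>. X (\<tau> (Suc i)) \<omega> - X (\<tau> i) \<omega>) {..<n}"
        if \<tau>: "0 \<le> \<tau> 0" "\<forall>i<n. \<tau> i \<le> \<tau> (Suc i)" for n :: nat and \<tau>
      proof (rule indep_vars_cong_AE)
        have nonneg: "0 \<le> \<tau> i" if "i \<le> n" for i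
          using that \<tau> by (induction i) (auto intro: order.trans)
        show "indep_vars (\<lambda>_. borel) (\<lambda>i \<omega>. B (\<tau> (Suc i)) \<omega> - B (\<tau> i) \<omega>) {..<n}"
          using assms \<tau> unfolding brownian_motion_def by blast
        show "AE \<omega> in M. B (\<tau> (Suc i)) \<omega> - B (\<tau> i) \<omega> = X (\<tau> (Suc i)) \<omega> - X (\<tau> i) \<omega>" for i
          using eq by eventually_elim simp
        show "random_variable borel (\<lambda>\<omega>. X (\<tau> (Suc i)) \<omega> - X (\<tau> i) \<omega>)" if "i < n" for i
          using that nonneg[of i] nonneg[of "Suc i"] by (intro borel_measurable_diff X) auto
      qed
    qed (use X start cont in auto)
  qed
  then show thesis using eq that by blast
qed

text \<open>The \<open>\<sigma>\<close>-algebra of the events of \<open>M\<close> that differ from an event of \<open>V\<close> only by a null set. The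
  continuous version of the process is measurable with respect to it even though it depends on the
  exceptional null set, which need not be determined by the original process; and independence
  of \<open>V\<close> carries over to it.\<close>

definition augmented :: "'a measure \<Rightarrow> 'a measure \<Rightarrow> 'a measure" where
  "augmented M V = sigma (space M) {A \<in> sets M. \<exists>A'\<in>sets V. AE \<omega> in M. \<omega> \<in> A \<longleftrightarrow> \<omega> \<in> A'}"

lemma sets_augmented:
  assumes V: "space V = space M"
  shows "sets (augmented M V) = {A \<in> sets M. \<exists>A'\<in>sets V. AE \<omega> in M. \<omega> \<in> A \<longleftrightarrow> \<omega> \<in> A'}" (is "_ = ?S")
proof -
  have "sigma_algebra (space M) ?S"
    unfolding sigma_algebra_iff2
  proof (intro conjI ballI allI impI)
    show "?S \<subseteq> Pow (space M)" using sets.sets_into_space by auto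
    show "{} \<in> ?S" by (auto intro!: bexI[of _ "{}"])
    fix A assume "A \<in> ?S"
    then obtain A' where A: "A \<in> sets M" "A' \<in> sets V" "AE \<omega> in M. \<omega> \<in> A \<longleftrightarrow> \<omega> \<in> A'" by auto
    have "AE \<omega> in M. \<omega> \<in> space M - A \<longleftrightarrow> \<omega> \<in> space V - A'"
      using A(3) AE_space by eventually_elim (simp add: V)
    moreover have "space M - A \<in> sets M" "space V - A' \<in> sets V" using A by auto
    ultimately show "space M - A \<in> ?S" by blast
  next
    fix A :: "nat \<Rightarrow> _" assume "range A \<subseteq> ?S"
    then have "\<forall>i. \<exists>A'. A i \<in> sets M \<and> A' \<in> sets V \<and> (AE \<omega> in M. \<omega> \<in> A i \<longleftrightarrow> \<omega> \<in> A')" by blast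
    then obtain A' where A: "\<And>i. A i \<in> sets M" "\<And>i. A' i \<in> sets V" "\<And>i. AE \<omega> in M. \<omega> \<in> A i \<longleftrightarrow> \<omega> \<in> A' i"
      by metis
    have "AE \<omega> in M. \<forall>i. \<omega> \<in> A i \<longleftrightarrow> \<omega> \<in> A' i"
      using A(3) by (simp add: AE_all_countable)
    then have "AE \<omega> in M. \<omega> \<in> (\<Union>i. A i) \<longleftrightarrow> \<omega> \<in> (\<Union>i. A' i)"
      by eventually_elim auto
    moreover have "(\<Union>i. A i) \<in> sets M" "(\<Union>i. A' i) \<in> sets V" using A by auto
    ultimately show "(\<Union>i. A i) \<in> ?S" by blast
  qed
  then interpret sigma_algebra "space M" ?S .
  show ?thesis unfolding augmented_def by (rule sets_measure_of_eq)
qed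

lemma subalgebra_augmented: "space V = space M \<Longrightarrow> subalgebra M (augmented M V)"
  unfolding subalgebra_def using sets_augmented[of V M] by (auto simp: augmented_def space_measure_of_conv)

text \<open>Up to null sets \<open>alpha B U\<close> is the same functional \<open>Z\<close> of the continuous version. The law of \<open>Z\<close> is obtained
  by integrating out \<open>U\<close> and applying the occupation formula to indicator functions.\<close>

lemma alpha_law:
  fixes M :: "'a measure" and B :: "real \<Rightarrow> 'a \<Rightarrow> real" and U :: "'a \<Rightarrow> real"
  assumes "brownian_motion M B"
    and U: "distributed M lborel U (indicator {0..1})"
    and indep: "indep_of_process M U B"
  shows "distributed (completion M) lborel (alpha B U) (\<lambda>y. ennreal (alpha_density y))"
proof -
  let ?P = "PiM {0..} (\<lambda>_. borel :: real measure)"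
  interpret prob_space M using assms(1) by (simp add: brownian_motion_def)
  obtain X where X: "continuous_brownian_motion M X" and X_eq: "AE \<omega> in M. \<forall>t. X t \<omega> = B t \<omega>"
    by (rule brownian_motion_continuous_version[OF assms(1)])
  interpret X: continuous_brownian_motion M X by fact
  have U_meas[measurable]: "U \<in> borel_measurable M"
    using distributed_measurable[OF U] by simp
  have B[measurable]: "B t \<in> borel_measurable M" if "0 \<le> t" for t
    using assms(1) that by (simp add: brownian_motion_def)
  define path where "path = (\<lambda>\<omega>. \<lambda>t\<in>{0..}. B t \<omega>)"
  define V where "V = vimage_algebra (space M) path ?P"
  define F where "F = augmented M V"
  have V: "space V = space M" by (simp add: V_def)
  have F: "subalgebra M F" unfolding F_def by (rule subalgebra_augmented[OF V])
  have space_F: "space F = space M" using F by (simp add: subalgebra_def)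
  have path: "path \<in> space M \<rightarrow> space ?P"
    by (auto simp: path_def space_PiM)
  have X_F: "X t \<in> borel_measurable F" if t: "0 \<le> t" for t
  proof (rule measurableI)
    fix C :: "real set" assume C: "C \<in> sets borel"
    have "{f \<in> space ?P. f t \<in> C} \<in> sets (PiM {0..} (\<lambda>_. borel))"
      using t C measurable_sets[OF measurable_component_singleton[of t "{0..}" "\<lambda>_. borel :: real measure"], of C]
      by (simp add: vimage_def Int_def conj_commute)
    then have "path -` {f \<in> space ?P. f t \<in> C} \<inter> space M \<in> sets V"
      unfolding V_def by (rule in_vimage_algebra)
    also have "path -` {f \<in> space ?P. f t \<in> C} \<inter> space M = {\<omega> \<in> space M. B t \<omega> \<in> C}"
      using t path by (auto simp: path_def space_PiM)
    finally have "{\<omega> \<in> space M. B t \<omega> \<in> C} \<in> sets V" .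
    moreover have "X t -` C \<inter> space M \<in> events" using X.measurable_X[OF t] C by (rule measurable_sets)
    moreover have "AE \<omega> in M. \<omega> \<in> X t -` C \<inter> space M \<longleftrightarrow> \<omega> \<in> {\<omega> \<in> space M. B t \<omega> \<in> C}"
      using X_eq by eventually_elim auto
    ultimately show "X t -` C \<inter> space F \<in> sets F"
      unfolding space_F unfolding F_def sets_augmented[OF V] by blast
  qed auto
  interpret XF: continuous_paths F X
    using X_F X.start X.cont by unfold_locales auto
  let ?T = "hitting_time X 1"
  have indep': "prob ({\<omega> \<in> space M. U \<omega> \<in> C} \<inter> A) = prob {\<omega> \<in> space M. U \<omega> \<in> C} * prob A"
    if C: "C \<in> sets borel" and A: "A \<in> sets F" for C A
  proof -
    from A obtain A' where A': "A \<in> events" "A' \<in> sets V" "AE \<omega> in M. \<omega> \<in> A \<longleftrightarrow> \<omega> \<in> A'"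
      by (auto simp: F_def sets_augmented[OF V])
    have iset: "indep_set (sets (vimage_algebra (space M) U borel)) (sets V)"
      using indep unfolding indep_of_process_def V_def path_def .
    have A'_ev: "A' \<in> events" using iset A'(2) unfolding indep_set_def indep_sets_def by (auto split: bool.splits dest!: spec[of _ False])
    have UC: "{\<omega> \<in> space M. U \<omega> \<in> C} = U -` C \<inter> space M" by auto
    have "prob ({\<omega> \<in> space M. U \<omega> \<in> C} \<inter> A) = prob ({\<omega> \<in> space M. U \<omega> \<in> C} \<inter> A')"
      using A' A'_ev C by (intro finite_measure_eq_AE) (auto elim!: eventually_mono)
    also have "\<dots> = prob {\<omega> \<in> space M. U \<omega> \<in> C} * prob A'"
      unfolding UC by (rule indep_setD[OF iset in_vimage_algebra[OF C] A'(2)])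
    also have "prob A' = prob A"
      using A' A'_ev by (intro finite_measure_eq_AE) (auto elim!: eventually_mono)
    finally show ?thesis .
  qed
  define Z where "Z = (\<lambda>\<omega>. X (max 0 (U \<omega> * ?T \<omega>)) \<omega> / sqrt (?T \<omega>))"
  note XF.measurable_hitting_time[measurable] X.measurable_hitting_time[measurable]
  have Z[measurable]: "Z \<in> borel_measurable M"
  proof -
    have "(\<lambda>\<omega>. X (max 0 (U \<omega> * ?T \<omega>)) \<omega>) \<in> borel_measurable M"
      using measurable_compose[OF _ X.measurable_X_pair, of "\<lambda>\<omega>. (U \<omega> * ?T \<omega>, \<omega>)" M] by simp
    then show ?thesis unfolding Z_def by measurable
  qed
  have Z_law: "distr M lborel Z = density lborel (\<lambda>y. ennreal (alpha_density y))"
  proof (rule measure_eqI)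
    fix C :: "real set" assume "C \<in> sets (distr M lborel Z)"
    then have C[measurable]: "C \<in> sets borel" by simp
    define H where "H = (\<lambda>p. indicator C (X (max 0 (fst p * ?T (snd p))) (snd p) / sqrt (?T (snd p))) :: ennreal)"
    have H: "H \<in> borel_measurable (borel \<Otimes>\<^sub>M F)"
    proof -
      have [measurable]: "(\<lambda>p. X (max 0 (fst p * ?T (snd p))) (snd p)) \<in> borel_measurable (borel \<Otimes>\<^sub>M F)"
        using measurable_compose[OF _ XF.measurable_X_pair, of "\<lambda>p. (fst p * ?T (snd p), snd p)" "borel \<Otimes>\<^sub>M F"] by simp
      show ?thesis unfolding H_def by measurable
    qed
    have "emeasure (distr M lborel Z) C = (\<integral>\<^sup>+\<omega>. H (U \<omega>, \<omega>) \<partial>M)"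
    proof -
      have "emeasure (distr M lborel Z) C = (\<integral>\<^sup>+\<omega>. indicator (Z -` C \<inter> space M) \<omega> \<partial>M)"
        by (subst emeasure_distr) auto
      also have "\<dots> = (\<integral>\<^sup>+\<omega>. H (U \<omega>, \<omega>) \<partial>M)"
        by (intro nn_integral_cong) (auto simp: H_def Z_def split: split_indicator)
      finally show ?thesis .
    qed
    also have "\<dots> = (\<integral>\<^sup>+\<omega>. (\<integral>\<^sup>+u. indicator {0..1} u * H (u, \<omega>) \<partial>lborel) \<partial>M)"
      by (rule nn_integral_indep_uniform[OF F U indep' H])
    also have "\<dots> = (\<integral>\<^sup>+y. indicator C y * ennreal (alpha_density y) \<partial>lborel)"
      unfolding H_def fst_conv snd_conv by (rule X.occupation_formula) measurable
    also have "\<dots> = emeasure (density lborel (\<lambda>y. ennreal (alpha_density y))) C"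
      by (subst emeasure_density) (auto simp: mult.commute)
    finally show "emeasure (distr M lborel Z) C = emeasure (density lborel (\<lambda>y. ennreal (alpha_density y))) C" .
  qed simp
  have "AE y in lborel. (0 :: ennreal) < indicator {0..1} y \<longrightarrow> 0 \<le> (y :: real)"
    by (auto split: split_indicator)
  then have "AE \<omega> in M. 0 \<le> U \<omega>"
    by (subst distributed_AE2[OF U]) auto
  then have alpha_eq: "AE \<omega> in M. alpha B U \<omega> = Z \<omega>"
    using X_eq X.AE_hits
  proof eventually_elim
    case (elim \<omega>)
    have "hitting_time B 1 \<omega> = ?T \<omega>"
      using elim(2) by (simp add: hitting_time_def)
    moreover have "max 0 (U \<omega> * ?T \<omega>) = U \<omega> * ?T \<omega>"
      using elim(1) X.hitting_time_nonneg[OF elim(3)] by (simp add: max_def)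
    ultimately show ?case using elim(2) by (simp add: alpha_def Z_def)
  qed
  have alpha_meas: "alpha B U \<in> borel_measurable (completion M)"
  proof (rule measurableI)
    fix C :: "real set" assume C: "C \<in> sets borel"
    have Z_C: "Z -` C \<inter> space (completion M) \<in> sets (completion M)"
      using measurable_completion[OF Z] C by (rule measurable_sets)
    have eq: "AE \<omega> in completion M. \<omega> \<in> Z -` C \<inter> space (completion M) \<longleftrightarrow> \<omega> \<in> alpha B U -` C \<inter> space (completion M)"
      using AE_completion[OF alpha_eq] by eventually_elim auto
    show "alpha B U -` C \<inter> space (completion M) \<in> sets (completion M)"
      by (rule completion.in_sets_AE[OF eq Z_C]) blast
  qed simp
  have "distr (completion M) lborel (alpha B U) = distr (completion M) lborel Z"
    by (rule distr_cong_AE[OF refl refl AE_completion[OF alpha_eq]])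
       (simp_all add: alpha_meas measurable_completion Z)
  also have "\<dots> = distr M lborel Z" by (rule distr_completion) simp
  finally have "distr (completion M) lborel (alpha B U) = density lborel (\<lambda>y. ennreal (alpha_density y))"
    unfolding Z_law .
  then show ?thesis
    unfolding distributed_def using alpha_meas by (intro conjI) simp_all
qed

theorem theorem3p2:
  fixes M :: "'a measure" and B :: "real \<Rightarrow> 'a \<Rightarrow> real" and U :: "'a \<Rightarrow> real"
  assumes "brownian_motion M B"
    and "distributed M lborel U (indicator {0..1})"
    and "indep_of_process M U B"
  shows "\<exists>h :: real \<Rightarrow> real.
           distributed (completion M) lborel (alpha B U) (\<lambda>y. ennreal (h y)) \<and>
           (\<forall>y\<ge>0. h y = sqrt (2 / pi) *
              (LINT w:{0..2}|lborel. 1 / (1 + w) * exp (- (2 * y\<^sup>2 / w\<^sup>2)))) \<and>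
           (\<forall>y\<le>0. h y = sqrt (2 / pi) * ln 3 * exp (- (2 * y\<^sup>2)))"
proof (intro exI conjI allI impI)
  show "distributed (completion M) lborel (alpha B U) (\<lambda>y. ennreal (alpha_density y))"
    by (rule alpha_law[OF assms])
  show "alpha_density y = sqrt (2 / pi) * (LINT w:{0..2}|lborel. 1 / (1 + w) * exp (- (2 * y\<^sup>2 / w\<^sup>2)))" if "0 \<le> y" for y
    using that by (simp add: alpha_density_def)
  show "alpha_density y = sqrt (2 / pi) * ln 3 * exp (- (2 * y\<^sup>2))" if "y \<le> 0" for y
    using that by (rule alpha_density_nonpos)
qed

end
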